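(* Let $M\in\mathbb Z^{s\times s}$ be a dilation matrix all of whose eigenvalues are larger than $1$ in absolute value, and let $\{\mathbf a^{(k)},\ k\ge1\}$ be a sequence of masks supported in $\{0,\dots,N\}^s$. Assume that the sequence of symbols $\{a_*^{(k)}(z),\ k\ge1\}$ satisfies approximate sum rules of order $1$ and that $\rho(\mathcal T_{\mathcal A}|_{V_0})<1$, where $\mathcal A$ is the set of limit points of $\{\mathbf a^{(k)},\ k\ge1\}$. Then the non-stationary scheme $\{S_{\mathbf a^{(k)}},\ k\ge1\}$ is $C^0$-convergent.
   Context: A mask is a real sequence $\mathbf a=\{\mathrm a(\alpha)\}_{\alpha\in\mathbb Z^s}$ supported in $\{0,\dots,N\}^s$ ($N$ fixed). Its symbol is $a_*(z)=\sum_\alpha\mathrm a(\alpha)z^\alpha$. The subdivision operator is $(S_{\mathbf a}\boldsymbol c)(\alpha)=\sum_{\beta\in\mathbb Z^s}\mathrm a(\alpha-M\beta)c(\beta)$. $E$ is a complete set of representatives of $\mathbb Z^s/M\mathbb Z^s$ ($E=\{0,\dots,m-1\}^s$ if $M=mI$, $m\ge2$). $\Xi=\{e^{2\pi iM^{-T}\xi}:\ \xi\text{ a coset representative of }\mathbb Z^s/M^T\mathbb Z^s\}$ (componentwise exponential), $1=(1,\dots,1)$. The symbols $\{a_*^{(k)}\}$ satisfy approximate sum rules of order $1$ if the sequences $\mu_k=\bigl|a_*^{(k)}(1)-|\det M|\bigr|$ and $\delta_k=\max_{\epsilon\in\Xi\setminus\{1\}}|a_*^{(k)}(\epsilon)|$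 are summable. $\mathcal A$ is the set of masks $\mathbf a$ that are limits of some subsequence $\{\mathbf a^{(k_n)}\}$. Let $K=\mathbb Z^s\cap\{\sum_{r\ge1}M^{-r}g_r:\ g_r\in G\}$, where $G=\{-m,\dots,N+1\}^s$ if $M=mI$ and, for general $M$, $G$ is the corresponding set $\{\gamma-\varepsilon+\theta:\ \gamma\in\{0,\dots,N\}^s,\ \varepsilon\in E,\ \theta\in\{-1,0,1\}^s\}$ (the two agree for $M=mI$). Let $T_{\varepsilon,\mathbf a}=[\mathrm a(\varepsilon+M\alpha-\beta)]_{\alpha,\beta\in K}$, $\varepsilon\in E$. $V_0=\{v\in\mathbb R^{|K|}:\sum_jv_j=0\}$; under approximate sum rules of order $1$ every $\mathbf a\in\mathcal A$ satisfies $a_*(1)=|\det M|$ and $a_*(\epsilon)=0$ for $\epsilon\in\Xi\setminus\{1\}$, and then $V_0$ is invariant under all $T_{\varepsilon,\mathbf a}$. $\mathcal T_{\mathcal A}|_{V_0}=\{T_{\varepsilon,\mathbf a}|_{V_0}:\varepsilon\in E,\mathbf a\in\mathcal A\}$. The joint spectral radius of a compact set $\mathcal M$ of square matrices is $\rho(\mathcal M)=\lim_{n\to\infty}\max_{M_1,\dots,M_n\in\mathcal M}\|M_1\cdots M_n\|^{1/n}$. $C^0$-convergence: for every $\boldsymbol c\in\ell_\infty(\mathbb Z^s)$ there is $g_{\boldsymbol c}\in C(\mathbb R^s)$ such that for any continuous test function $f$, $\lim_{k\to\infty}\|g_{\boldsymbol c}-\sum_\alpha(S_{\mathbf a^{(k)}}\cdots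 S_{\mathbf a^{(1)}}\boldsymbol c)(\alpha)f(M^k\cdot-\alpha)\|_\infty=0$. A test function (here) is a compactly supported, sufficiently smooth function $f$ with $\hat f(0)=1$, $\hat f(\alpha)=0$ for $\alpha\in\mathbb Z^s\setminus\{0\}$ (where $\hat f(\omega)=\int f(x)e^{-2\pi ix\cdot\omega}dx$), which is stable: there are $0<C_1\le C_2<\infty$ with $C_1\|\boldsymbol c\|_{\ell_\infty}\le\|\sum_\alpha c(\alpha)f(\cdot-\alpha)\|_\infty\le C_2\|\boldsymbol c\|_{\ell_\infty}$ for all $\boldsymbol c\in\ell_\infty(\mathbb Z^s)$.
   Formalization: The formal theorem additionally assumes that the masks a^(k), k≥1, are uniformly bounded; without this the statement fails, since a subsequence of masks can diverge without contributing any limit point to the set A. *)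

theory Defs
  imports "HOL-Analysis.Analysis"
begin

definition vec_of_int :: "int ^ 's \<Rightarrow> 'a::ring_1 ^ 's" where
  "vec_of_int x = (\<chi> i. of_int (x $ i))"

definition dilation_matrix :: "int ^ 's ^ 's \<Rightarrow> bool" where
  "dilation_matrix M \<longleftrightarrow>
     (\<forall>(l::complex) v. v \<noteq> 0 \<and> map_matrix of_int M *v v = l *s v \<longrightarrow> cmod l > 1)"

abbreviation real_mat :: "int ^ 's ^ 's \<Rightarrow> real ^ 's ^ 's" where
  "real_mat M \<equiv> map_matrix of_int M"

definition complete_residues :: "int ^ 's ^ 's \<Rightarrow> (int ^ 's) set \<Rightarrow> bool" where
  "complete_residues M E \<longleftrightarrow> (\<forall>\<alpha>. \<exists>!\<epsilon>. \<epsilon> \<in> E \<and> \<alpha> - \<epsilon> \<in> range ((*v) M))"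

definition int_box :: "int \<Rightarrow> int \<Rightarrow> (int ^ 's) set" where
  "int_box l u = {\<alpha>. \<forall>i. l \<le> \<alpha> $ i \<and> \<alpha> $ i \<le> u}"


section \<open>Masks, symbols and subdivision\<close>

definition is_mask :: "nat \<Rightarrow> (int ^ 's \<Rightarrow> real) \<Rightarrow> bool" where
  "is_mask N a \<longleftrightarrow> {\<alpha>. a \<alpha> \<noteq> 0} \<subseteq> int_box 0 (int N)"

definition symbol :: "(int ^ 's \<Rightarrow> real) \<Rightarrow> complex ^ 's \<Rightarrow> complex" where
  "symbol a z = (\<Sum>\<^sub>\<infinity>\<alpha>. of_real (a \<alpha>) * (\<Prod>i\<in>UNIV. (z $ i) powi (\<alpha> $ i)))"

definition subdivision :: "int ^ 's ^ 's \<Rightarrow> (int ^ 's \<Rightarrow> real) \<Rightarrow> (int ^ 's \<Rightarrow> real) \<Rightarrow> (int ^ 's \<Rightarrow> real)" where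
  "subdivision M a c = (\<lambda>\<alpha>. \<Sum>\<^sub>\<infinity>\<beta>. a (\<alpha> - M *v \<beta>) * c \<beta>)"

text \<open>Sequences of masks are indexed by \<open>k \<ge> 1\<close>; the value at \<open>0\<close> is never used.\<close>

primrec subdivision_iter ::
  "int ^ 's ^ 's \<Rightarrow> (nat \<Rightarrow> int ^ 's \<Rightarrow> real) \<Rightarrow> nat \<Rightarrow> (int ^ 's \<Rightarrow> real) \<Rightarrow> (int ^ 's \<Rightarrow> real)" where
  "subdivision_iter M a 0 c = c"
| "subdivision_iter M a (Suc k) c = subdivision M (a (Suc k)) (subdivision_iter M a k c)"


section \<open>Approximate sum rules of order 1\<close>

text \<open>Every integer vector \<open>\<xi>\<close> represents its coset modulo the range of \<open>transpose M\<close>, and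
  \<open>exp (2 \<pi> i M\<^sup>-\<^sup>T \<xi>)\<close> depends only on that coset, so no system of representatives is fixed.\<close>

definition dual_roots :: "int ^ 's ^ 's \<Rightarrow> (complex ^ 's) set" where
  "dual_roots M = range (\<lambda>\<xi>. \<chi> i.
     exp (2 * of_real pi * \<i> *
       of_real ((matrix_inv (transpose (real_mat M)) *v vec_of_int \<xi>) $ i)))"

definition approx_sum_rules_1 :: "int ^ 's ^ 's \<Rightarrow> (nat \<Rightarrow> int ^ 's \<Rightarrow> real) \<Rightarrow> bool" where
  "approx_sum_rules_1 M a \<longleftrightarrow>
     summable (\<lambda>k. cmod (symbol (a (Suc k)) 1 - of_int \<bar>det M\<bar>)) \<and>
     summable (\<lambda>k. Max ((\<lambda>\<epsilon>. cmod (symbol (a (Suc k)) \<epsilon>)) ` (dual_roots M - {1})))"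


section \<open>Transition matrices on the zero-sum space\<close>

definition limit_masks :: "(nat \<Rightarrow> int ^ 's \<Rightarrow> real) \<Rightarrow> (int ^ 's \<Rightarrow> real) set" where
  "limit_masks a = {b. \<exists>r. strict_mono r \<and> (\<forall>\<alpha>. (\<lambda>n. a (r n) \<alpha>) \<longlonglongrightarrow> b \<alpha>)}"

definition digit_set :: "nat \<Rightarrow> (int ^ 's) set \<Rightarrow> (int ^ 's) set" where
  "digit_set N E =
     {\<gamma> - \<epsilon> + \<theta> |\<gamma> \<epsilon> \<theta>. \<gamma> \<in> int_box 0 (int N) \<and> \<epsilon> \<in> E \<and> \<theta> \<in> int_box (-1) 1}"

definition index_set :: "int ^ 's ^ 's \<Rightarrow> nat \<Rightarrow> (int ^ 's) set \<Rightarrow> (int ^ 's) set" where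
  "index_set M N E = {\<kappa>. \<exists>g. range g \<subseteq> digit_set N E \<and>
     (\<lambda>r. ((*v) (matrix_inv (real_mat M)) ^^ Suc r) (vec_of_int (g r))) sums vec_of_int \<kappa>}"

text \<open>For a finite index set \<open>K\<close>, vectors indexed by \<open>K\<close> are functions vanishing outside \<open>K\<close>.\<close>

definition matrix_op :: "'i set \<Rightarrow> ('i \<Rightarrow> 'i \<Rightarrow> real) \<Rightarrow> ('i \<Rightarrow> real) \<Rightarrow> ('i \<Rightarrow> real)" where
  "matrix_op K A v = (\<lambda>\<alpha>. if \<alpha> \<in> K then \<Sum>\<beta>\<in>K. A \<alpha> \<beta> * v \<beta> else 0)"

definition transition_matrix ::
  "int ^ 's ^ 's \<Rightarrow> int ^ 's \<Rightarrow> (int ^ 's \<Rightarrow> real) \<Rightarrow> int ^ 's \<Rightarrow> int ^ 's \<Rightarrow> real" where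
  "transition_matrix M \<epsilon> a = (\<lambda>\<alpha> \<beta>. a (\<epsilon> + M *v \<alpha> - \<beta>))"

definition transition_ops ::
  "int ^ 's ^ 's \<Rightarrow> (int ^ 's) set \<Rightarrow> (int ^ 's) set \<Rightarrow> (int ^ 's \<Rightarrow> real) set
    \<Rightarrow> ((int ^ 's \<Rightarrow> real) \<Rightarrow> (int ^ 's \<Rightarrow> real)) set" where
  "transition_ops M K E \<A> = {matrix_op K (transition_matrix M \<epsilon> a) |\<epsilon> a. \<epsilon> \<in> E \<and> a \<in> \<A>}"

definition zero_sum_space :: "'i set \<Rightarrow> ('i \<Rightarrow> real) set" where
  "zero_sum_space K = {v. (\<forall>i. i \<notin> K \<longrightarrow> v i = 0) \<and> (\<Sum>i\<in>K. v i) = 0}"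

text \<open>The operator norm of the restriction of \<open>T\<close> to the subspace \<open>V\<close>, for the Euclidean norm.\<close>

definition restricted_onorm ::
  "'i set \<Rightarrow> ('i \<Rightarrow> real) set \<Rightarrow> (('i \<Rightarrow> real) \<Rightarrow> ('i \<Rightarrow> real)) \<Rightarrow> real" where
  "restricted_onorm K V T = (SUP v\<in>{v \<in> V. L2_set v K \<le> 1}. L2_set (T v) K)"

text \<open>The joint spectral radius of the restrictions of a set of operators to a common invariant
  subspace \<open>V\<close>. For a compact nonempty set the supremum over the products is a maximum.\<close>

definition joint_spectral_radius ::
  "'i set \<Rightarrow> ('i \<Rightarrow> real) set \<Rightarrow> (('i \<Rightarrow> real) \<Rightarrow> ('i \<Rightarrow> real)) set \<Rightarrow> real" where
  "joint_spectral_radius K V \<M> =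
     lim (\<lambda>n. root n (SUP Ts\<in>{Ts. length Ts = n \<and> set Ts \<subseteq> \<M>}.
       restricted_onorm K V (foldr (\<circ>) Ts id)))"


section \<open>Convergence\<close>

definition fourier :: "(real ^ 's \<Rightarrow> real) \<Rightarrow> real ^ 's \<Rightarrow> complex" where
  "fourier f \<omega> = (LINT x|lborel. of_real (f x) * exp (- 2 * of_real pi * \<i> * of_real (x \<bullet> \<omega>)))"

definition supnorm :: "('b \<Rightarrow> real) \<Rightarrow> real" where
  "supnorm h = (SUP x. \<bar>h x\<bar>)"

definition stable :: "(real ^ 's \<Rightarrow> real) \<Rightarrow> bool" where
  "stable f \<longleftrightarrow> (\<exists>C1 C2. 0 < C1 \<and> C1 \<le> C2 \<and>
     (\<forall>c :: int ^ 's \<Rightarrow> real. bounded (range c) \<longrightarrow>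
        C1 * supnorm c \<le> supnorm (\<lambda>x. \<Sum>\<^sub>\<infinity>\<alpha>. c \<alpha> * f (x - vec_of_int \<alpha>)) \<and>
        supnorm (\<lambda>x. \<Sum>\<^sub>\<infinity>\<alpha>. c \<alpha> * f (x - vec_of_int \<alpha>)) \<le> C2 * supnorm c))"

definition continuous_test_function :: "(real ^ 's \<Rightarrow> real) \<Rightarrow> bool" where
  "continuous_test_function f \<longleftrightarrow>
     continuous_on UNIV f \<and> compact (closure {x. f x \<noteq> 0}) \<and>
     fourier f 0 = 1 \<and> (\<forall>\<alpha> :: int ^ 's. \<alpha> \<noteq> 0 \<longrightarrow> fourier f (vec_of_int \<alpha>) = 0) \<and>
     stable f"

definition C0_convergent :: "int ^ 's ^ 's \<Rightarrow> (nat \<Rightarrow> int ^ 's \<Rightarrow> real) \<Rightarrow> bool" where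
  "C0_convergent M a \<longleftrightarrow>
     (\<forall>c. bounded (range c) \<longrightarrow>
       (\<exists>g :: real ^ 's \<Rightarrow> real. continuous_on UNIV g \<and>
         (\<forall>f. continuous_test_function f \<longrightarrow>
           uniform_limit UNIV
             (\<lambda>k x. \<Sum>\<^sub>\<infinity>\<alpha>. subdivision_iter M a k c \<alpha>
                        * f (((*v) (real_mat M) ^^ k) x - vec_of_int \<alpha>))
             g sequentially)))"

end

theory Submission
  imports Defs "HOL-Computational_Algebra.Fundamental_Theorem_Algebra"
begin

text \<open>
  A finitely supported functional on level \<open>k + n\<close> of the scheme is a functional on level \<open>k\<close>
  transported by a product of \<open>n\<close> transition matrices. Such a product first moves supports into \<open>K\<close>,
  and there the products over the limit masks contract the zero-sum functionals because the joint
  spectral radius is less than 1. For large \<open>k\<close> the actual masks are close to limit masks, and they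
  preserve the sum of a functional up to the summable defect of the sum rules. With \<open>y k\<close> the local
  oscillation and \<open>X k\<close> the supremum norm of the \<open>k\<close>-th sequence this gives
  \<open>y (k + L) \<le> y k / 2 + H k * X k\<close> and \<open>X (k + 1) \<le> (1 + \<eta> k) * X k + C * y k\<close> with summable \<open>H\<close>, \<open>\<eta>\<close>.
  A Lyapunov argument then bounds \<open>X\<close> and makes \<open>y\<close> summable, so the step functions with values
  \<open>c\<^sub>k (floor (M\<^sup>k x))\<close> converge uniformly. Their oscillation tends to 0, so the limit is continuous, and
  every test function reproduces it because its integer translates sum to 1.

  The defect of the sum rules is computed by Fourier inversion on the quotient lattice, which needs
  that \<open>\<bar>det M\<bar>\<close> is the lattice index; this follows by comparing the volumes of two fundamental domains.
\<close>

section \<open>The lattice index of an integer matrix\<close>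

text \<open>The spectral hypothesis concerns only functionals supported in \<open>K\<close>, whereas
  the differences that a test function sees reach as far as its support. This forces a larger finite
  invariant set \<open>F\<close>, found as a ball of an adapted norm because \<open>A\<close> need
  not contract the Euclidean one. The masks \<open>a k\<close> need not converge. Their uniform
  bound gives every subsequence a convergent further subsequence, so late masks lie near limit masks
  that may differ from level to level, and only products of a fixed length \<open>L\<close> can be
  compared. This is the origin of the delay \<open>L\<close> in the recursion for \<open>y\<close>.
  Under the actual masks a zero-sum functional acquires a small total mass. That mass multiplies a
  value of the sequence rather than a difference, so \<open>X\<close> enters the recursion for
  \<open>y\<close> and the two must be controlled together. The factor 1/2 is (1/8 + 1/8) * 2:
  contraction along limit masks, perturbation, and the l1 norm of a difference of two unit
  masses.\<close>

lemma det_matrix_shear: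
  assumes "m \<noteq> n"
  shows "det (matrix (\<lambda>v::real^'n. \<chi> i. if i = m then v $ m + v $ n else v $ i)) = 1"
proof -
  have "matrix (\<lambda>v::real^'n. \<chi> i. if i = m then v $ m + v $ n else v $ i)
      = (\<chi> k. if k = m then row m (mat 1) + 1 *s row n (mat 1) else row k (mat 1))"
    by (auto simp: matrix_def vec_eq_iff row_def mat_def axis_def)
  then show ?thesis
    using det_row_operation[OF assms, where c = 1 and A = "mat 1 :: real^'n^'n"] by simp
qed

text \<open>The property passes to compositions, so elementary maps suffice. Singular maps have null
  images, and for swaps and shears it is enough to compare the measures of boxes.\<close>

lemma linear_image_lmeasurable_finite:
  fixes f :: "real^'n \<Rightarrow> real^'n"
  assumes "linear f"
  shows "\<forall>S \<in> lmeasurable. f ` S \<in> lmeasurable \<and>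
           measure lebesgue (f ` S) = \<bar>det (matrix f)\<bar> * measure lebesgue S"
proof (induct rule: induct_linear_elementary[OF assms, case_names 1 2 3 4 5])
  case (1 f g)
  have "\<bar>det (matrix (f \<circ> g))\<bar> = \<bar>det (matrix f)\<bar> * \<bar>det (matrix g)\<bar>"
    using 1 by (simp add: matrix_compose det_mul abs_mult)
  then have "measure lebesgue (f ` g ` S) = \<bar>det (matrix (f \<circ> g))\<bar> * measure lebesgue S"
    if "S \<in> lmeasurable" for S
    using that 1(3,4) by auto
  with 1(3,4) show ?case
    unfolding image_comp[symmetric] by blast
next
  case (2 f i)
  have ninj: "\<not> inj f"
    using 2 by (metis linear_injective_imp_surjective one_neq_zero surjE vec_component)
  then have "det (matrix f) = 0"
    using det_nz_iff_inj 2 by blast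
  moreover have "negligible (f ` S)" for S
    using negligible_linear_singular_image 2(1) ninj by blast
  ultimately show ?case
    by (simp add: negligible_iff_measure)
next
  case (3 c)
  then show ?case
    by (simp add: measurable_stretch measure_stretch axis_def matrix_def det_diagonal)
next
  case (4 m n)
  let ?h = "\<lambda>v::real^'n. \<chi> i. v $ Transposition.transpose m n i"
  have lin: "linear ?h"
    by (rule linearI) (simp_all add: plus_vec_def scaleR_vec_def)
  have meq: "measure lebesgue (?h ` cbox a b) = measure lebesgue (cbox a b)" for a b
  proof (cases "cbox a b = {}")
    case False
    have eq: "?h ` cbox a b = cbox (?h a) (?h b)"
      by (auto simp: image_iff lambda_swap_Galois mem_box_cart) (metis transpose_involutory)+
    with False have "cbox (?h a) (?h b) \<noteq> {}"
      by blast
    then show ?thesis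
      using prod.permute[OF permutes_swap_id, where S=UNIV and g="\<lambda>i. (b - a)$i", symmetric]
      by (simp add: eq content_cbox_cart False)
  qed simp
  \<comment> \<open>A swap is an involution, so its determinant squares to 1 and no sign has to be
    computed.\<close>
  have "?h \<circ> ?h = id"
    by (auto simp: vec_eq_iff)
  then have "det (matrix ?h) * det (matrix ?h) = 1"
    by (metis lin det_I det_mul matrix_compose matrix_id_mat_1)
  then have det1: "\<bar>det (matrix ?h)\<bar> = 1"
    by (metis abs_1 abs_mult_self_eq abs_square_eq_1 power2_eq_square)
  show ?case
  proof
    fix S :: "(real^'n) set"
    assume S: "S \<in> lmeasurable"
    have "?h ` S \<in> lmeasurable \<and> 1 * measure lebesgue S = measure lebesgue (?h ` S)"
      by (rule measure_linear_sufficient[OF lin S]) (simp only: meq mult_1_left)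
    then show "?h ` S \<in> lmeasurable \<and> measure lebesgue (?h ` S) = \<bar>det (matrix ?h)\<bar> * measure lebesgue S"
      by (simp only: det1 mult_1_left)
  qed
next
  case (5 m n)
  let ?h = "\<lambda>v::real^'n. \<chi> i. if i = m then v $ m + v $ n else v $ i"
  have lin: "linear ?h"
    by (rule linearI) (auto simp: algebra_simps plus_vec_def scaleR_vec_def vec_eq_iff)
  have meq: "measure lebesgue (?h ` cbox a b) = measure lebesgue (cbox a b)" for a b
  proof (cases "cbox a b = {}")
    case False
    \<comment> \<open>Moving the lower corner to 0 meets the requirement of
      \<open>measure_shear_interval\<close> that the lower \<open>n\<close>-th coordinate be
      nonnegative.\<close>
    have ab: "cbox a b = (+) a ` cbox 0 (b - a)"
      using cbox_translation[of a 0 "b - a"] by simp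
    have "?h ` cbox a b = (+) (?h a) ` ?h ` cbox 0 (b - a)"
      by (simp only: ab image_image linear_add[OF lin])
    then have "measure lebesgue (?h ` cbox a b) = measure lebesgue (?h ` cbox 0 (b - a))"
      by (simp only: measure_translation)
    also have "\<dots> = measure lebesgue (cbox 0 (b - a))"
      using False ab 5 by (intro measure_shear_interval) auto
    also have "\<dots> = measure lebesgue (cbox a b)"
      by (simp only: ab measure_translation)
    finally show ?thesis .
  qed simp
  show ?case
  proof
    fix S :: "(real^'n) set"
    assume S: "S \<in> lmeasurable"
    have "?h ` S \<in> lmeasurable \<and> 1 * measure lebesgue S = measure lebesgue (?h ` S)"
      by (rule measure_linear_sufficient[OF lin S]) (simp only: meq mult_1_left)
    then show "?h ` S \<in> lmeasurable \<and> measure lebesgue (?h ` S) = \<bar>det (matrix ?h)\<bar> * measure lebesgue S"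
      by (simp only: det_matrix_shear[OF 5] abs_1 mult_1_left)
  qed
qed

section \<open>Integer vectors and the half-open unit cells\<close>

lemma vec_of_int_simps [simp]:
  "vec_of_int 0 = 0"
  "vec_of_int (x + y) = vec_of_int x + vec_of_int y"
  "vec_of_int (x - y) = vec_of_int x - vec_of_int y"
  "vec_of_int (- x) = - vec_of_int x"
  "vec_of_int x $ i = of_int (x $ i)"
  by (auto simp: vec_of_int_def vec_eq_iff)

lemma vec_of_int_eq_iff [simp]:
  "(vec_of_int x :: 'a::ring_char_0 ^ 's) = vec_of_int y \<longleftrightarrow> x = y"
  by (auto simp: vec_of_int_def vec_eq_iff)

lemma map_matrix_of_int_mult:
  "map_matrix of_int P *v vec_of_int x = (vec_of_int (P *v x) :: 'a::comm_ring_1 ^ 's)"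
  by (auto simp: vec_of_int_def vec_eq_iff matrix_vector_mult_def map_matrix_def)

lemma det_map_matrix_of_int: "det (map_matrix of_int P) = (of_int (det P) :: 'a::comm_ring_1)"
  by (simp add: det_def map_matrix_def)

definition vec_floor :: "real ^ 's \<Rightarrow> int ^ 's" where
  "vec_floor x = (\<chi> i. \<lfloor>x $ i\<rfloor>)"

lemma vec_floor_nth [simp]: "vec_floor x $ i = \<lfloor>x $ i\<rfloor>"
  by (simp add: vec_floor_def)

lemma vec_floor_add [simp]: "vec_floor (x + vec_of_int k) = vec_floor x + k"
  and vec_floor_diff [simp]: "vec_floor (x - vec_of_int k) = vec_floor x - k"
  by (simp_all add: vec_eq_iff)

lemma norm_diff_vec_floor_le: "norm (x - vec_of_int (vec_floor x)) \<le> CARD('s)"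
  for x :: "real ^ 's"
proof -
  have "norm (x - vec_of_int (vec_floor x)) \<le> (\<Sum>i\<in>UNIV. \<bar>(x - vec_of_int (vec_floor x)) $ i\<bar>)"
    by (rule norm_le_l1_cart)
  also have "\<dots> \<le> (\<Sum>i\<in>(UNIV::'s set). 1)"
    by (intro sum_mono) (simp, linarith)
  finally show ?thesis by simp
qed

lemma measurable_vec_floor [measurable]: "vec_floor \<in> borel \<rightarrow>\<^sub>M count_space UNIV"
proof (subst measurable_count_space_eq_countable)
  show "countable (UNIV :: (int ^ 's) set)" by simp
  have "vec_floor -` {k} \<inter> space borel \<in> sets borel" for k :: "int ^ 's"
  proof -
    have "vec_floor -` {k} = (\<Inter>i. {x. \<lfloor>x $ i\<rfloor> = k $ i})"
      by (auto simp: vec_eq_iff)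
    also have "\<dots> \<in> sets borel"
      by (intro sets.countable_INT) (auto intro!: borel_measurable_pred_less)
    finally show ?thesis by simp
  qed
  then show "vec_floor \<in> space borel \<rightarrow> UNIV \<and>
      (\<forall>k\<in>UNIV. vec_floor -` {k} \<inter> space borel \<in> sets (borel :: (real ^ 's) measure))"
    by auto
qed


lemma One_vec_nth: "(One :: real ^ 's) $ i = 1"
proof -
  have "(One :: real ^ 's) \<bullet> axis i 1 = 1"
    by (rule inner_sum_Basis) (auto simp: Basis_vec_def)
  then show ?thesis by (simp only: inner_axis inner_real_def mult_1_right)
qed

lemma mem_box_0_One_cart:
  "x \<in> cbox 0 (One :: real ^ 's) \<longleftrightarrow> (\<forall>i. 0 \<le> x $ i \<and> x $ i \<le> 1)"
  "x \<in> box 0 (One :: real ^ 's) \<longleftrightarrow> (\<forall>i. 0 < x $ i \<and> x $ i < 1)"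
  unfolding mem_box_cart by (simp_all only: One_vec_nth zero_index)

lemma emeasure_vec_floor_eq_0: "emeasure lborel {x :: real ^ 's. vec_floor x = 0} = 1"
proof (rule antisym)
  have sub: "{x :: real ^ 's. vec_floor x = 0} \<subseteq> cbox 0 One"
    by (auto simp: vec_eq_iff mem_box_0_One_cart floor_eq_iff less_imp_le)
  have one: "emeasure lborel (cbox 0 (One :: real ^ 's)) = 1" "emeasure lborel (box 0 (One :: real ^ 's)) = 1"
    by (simp_all add: emeasure_lborel_cbox emeasure_lborel_box)
  show "emeasure lborel {x :: real ^ 's. vec_floor x = 0} \<le> 1"
    using emeasure_mono[OF sub, of lborel] one by simp
  have "box 0 One \<subseteq> {x :: real ^ 's. vec_floor x = 0}"
    by (auto simp: vec_eq_iff mem_box_0_One_cart floor_eq_iff less_imp_le)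
  then show "1 \<le> emeasure lborel {x :: real ^ 's. vec_floor x = 0}"
    using emeasure_mono[of "box 0 One" "{x :: real ^ 's. vec_floor x = 0}" lborel] one by simp
qed

lemma matrix_inv_vec_mult:
  fixes A :: "'a::field ^ 'n ^ 'n"
  assumes "invertible A"
  shows "matrix_inv A *v (A *v x) = x" "A *v (matrix_inv A *v x) = x"
proof -
  have "A ** matrix_inv A = mat 1 \<and> matrix_inv A ** A = mat 1"
    using assms unfolding invertible_def matrix_inv_def by (rule someI_ex)
  then show "matrix_inv A *v (A *v x) = x" "A *v (matrix_inv A *v x) = x"
    by (simp_all add: matrix_vector_mul_assoc)
qed

lemma range_mult_int_iff:
  fixes P :: "int ^ 's ^ 's"
  assumes "invertible (real_mat P)"
  shows "\<alpha> \<in> range ((*v) P) \<longleftrightarrow> matrix_inv (real_mat P) *v vec_of_int \<alpha> \<in> range vec_of_int"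
proof
  assume "\<alpha> \<in> range ((*v) P)"
  then show "matrix_inv (real_mat P) *v vec_of_int \<alpha> \<in> range vec_of_int"
    using assms by (auto simp flip: map_matrix_of_int_mult simp: matrix_inv_vec_mult)
next
  assume "matrix_inv (real_mat P) *v vec_of_int \<alpha> \<in> range vec_of_int"
  then obtain \<beta> where "matrix_inv (real_mat P) *v vec_of_int \<alpha> = vec_of_int \<beta>" by blast
  then have "vec_of_int \<alpha> = (vec_of_int (P *v \<beta>) :: real ^ 's)"
    by (metis assms matrix_inv_vec_mult(2) map_matrix_of_int_mult)
  then show "\<alpha> \<in> range ((*v) P)" by simp
qed

lemma inj_mult_int:
  fixes P :: "int ^ 's ^ 's"
  assumes "invertible (real_mat P)"
  shows "P *v x = P *v y \<longleftrightarrow> x = y"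
  by (metis assms matrix_inv_vec_mult(1) map_matrix_of_int_mult vec_of_int_eq_iff)

text \<open>The union \<open>?F\<close> of the unit cells at \<open>E\<close> and the image
  \<open>?PQ\<close> of the unit cell are both fundamental domains of the lattice of all
  \<open>P *v \<beta>\<close>. Cutting \<open>?F\<close> along the translates of \<open>?PQ\<close>
  and moving the pieces back covers \<open>?PQ\<close> exactly once, so the volumes, the number of
  residues and \<open>\<bar>det P\<bar>\<close>, agree.\<close>

theorem card_complete_residues:
  fixes P :: "int ^ 's ^ 's"
  assumes E: "complete_residues P E" and inv: "invertible (real_mat P)"
  shows "finite E" "int (card E) = \<bar>det P\<bar>"
proof -
  let ?R = "real_mat P" and ?A = "matrix_inv (real_mat P)"
  let ?F = "{x :: real ^ 's. vec_floor x \<in> E}"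
  let ?Q = "{x :: real ^ 's. vec_floor x = 0}"
  let ?PQ = "{x :: real ^ 's. vec_floor (?A *v x) = 0}"
  let ?I = "\<lambda>\<beta> x. indicator ?F x * indicator ?PQ (x - vec_of_int (P *v \<beta>)) :: ennreal"
  let ?J = "\<lambda>\<beta> x. indicator ?F (x + vec_of_int (P *v \<beta>)) * indicator ?PQ x :: ennreal"
  note [simp] = matrix_inv_vec_mult[OF inv]
  have meas: "(\<lambda>x. ?A *v x) \<in> borel_measurable borel"
    by (intro borel_measurable_continuous_onI matrix_vector_mult_linear_continuous_on)
  have PQ_image: "?PQ = (*v) ?R ` ?Q"
    by (force simp: image_iff)
  have F_sets: "?F \<in> sets borel"
    using measurable_sets[OF measurable_vec_floor, of E] by (simp add: vimage_def)
  have PQ_sets: "?PQ \<in> sets borel"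
    using measurable_sets[OF measurable_comp[OF meas measurable_vec_floor], of "{0}"]
    by (simp add: vimage_def)
  have Q_sets: "{x. vec_floor x = k} \<in> sets borel" for k :: "int ^ 's"
    using measurable_sets[OF measurable_vec_floor, of "{k}"] by (simp add: vimage_def)
  note meas_ind = borel_measurable_indicator[of _ borel]
  have det: "det ?R = of_int (det P)"
    by (rule det_map_matrix_of_int)
  have PQ: "emeasure lborel ?PQ = ennreal (\<bar>of_int (det P)\<bar>)"
  proof -
    have "?Q \<in> lmeasurable"
      using Q_sets[of 0] emeasure_vec_floor_eq_0[where 's='s]
      by (intro lmeasurable_iff_integrable[THEN iffD2]) (simp add: integrable_indicator_iff)
    moreover have "measure lebesgue ?Q = 1"
      using Q_sets[of 0] emeasure_vec_floor_eq_0[where 's='s] by (simp add: measure_def)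
    ultimately have "?PQ \<in> lmeasurable" "measure lebesgue ?PQ = \<bar>of_int (det P)\<bar>"
      using linear_image_lmeasurable_finite[of "(*v) ?R"]
      unfolding PQ_image by (auto simp: matrix_of_matrix_vector_mul det)
    then have "emeasure lebesgue ?PQ = ennreal \<bar>of_int (det P)\<bar>"
      by (metis emeasure_eq_measure2 fmeasurableD fmeasurableD2 )
    then show ?thesis
      using PQ_sets by simp
  qed
  have "emeasure lborel ?F = (\<integral>\<^sup>+x. indicator ?F x \<partial>lborel)"
    using F_sets by simp
  also have "\<dots> = (\<integral>\<^sup>+x. (\<integral>\<^sup>+\<beta>. ?I \<beta> x \<partial>count_space UNIV) \<partial>lborel)"
  proof (rule nn_integral_cong)
    fix x :: "real ^ 's"
    \<comment> \<open>The translates of \<open>?PQ\<close> tile space: the one containing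
      \<open>x\<close> has index \<open>vec_floor (?A *v x)\<close>.\<close>
    have "vec_floor (?A *v (x - vec_of_int (P *v \<beta>))) = vec_floor (?A *v x) - \<beta>" for \<beta>
      by (simp add: matrix_vector_mult_diff_distrib flip: map_matrix_of_int_mult)
    then have "(\<lambda>\<beta>. ?I \<beta> x) =
       (\<lambda>\<beta>. indicator ?F x * indicator {vec_floor (?A *v x)} \<beta>)"
      by (auto simp: indicator_def fun_eq_iff)
    then show "indicator ?F x = (\<integral>\<^sup>+\<beta>. ?I \<beta> x \<partial>count_space UNIV)"
      by simp
  qed
  also have "\<dots> = (\<integral>\<^sup>+\<beta>. (\<integral>\<^sup>+x. ?I \<beta> x \<partial>lborel) \<partial>count_space UNIV)"
    using F_sets PQ_sets
    by (intro nn_integral_count_space_nn_integral)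
      (auto intro!: borel_measurable_times_ennreal measurable_compose[OF _ meas_ind])
  also have "\<dots> = (\<integral>\<^sup>+\<beta>. (\<integral>\<^sup>+x. ?J \<beta> x \<partial>lborel) \<partial>count_space UNIV)"
  proof (rule nn_integral_cong)
    fix \<beta>
    let ?h = "?I \<beta>"
    have "?h \<in> borel_measurable borel"
      using F_sets PQ_sets
      by (auto intro!: borel_measurable_times_ennreal measurable_compose[OF _ meas_ind])
    then have "(\<integral>\<^sup>+x. ?h x \<partial>lborel) = (\<integral>\<^sup>+x. ?h (vec_of_int (P *v \<beta>) + x) \<partial>lborel)"
      by (subst lborel_distr_plus[of "vec_of_int (P *v \<beta>)", symmetric], subst nn_integral_distr) auto
    then show "(\<integral>\<^sup>+x. ?h x \<partial>lborel) = (\<integral>\<^sup>+x. ?J \<beta> x \<partial>lborel)"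
      by (simp add: add.commute)
  qed
  also have "\<dots> = (\<integral>\<^sup>+x. (\<integral>\<^sup>+\<beta>. ?J \<beta> x \<partial>count_space UNIV) \<partial>lborel)"
    using F_sets PQ_sets
    by (intro nn_integral_count_space_nn_integral[symmetric])
      (auto intro!: borel_measurable_times_ennreal measurable_compose[OF _ meas_ind])
  also have "\<dots> = (\<integral>\<^sup>+x. indicator ?PQ x \<partial>lborel)"
  proof (rule nn_integral_cong)
    fix x :: "real ^ 's"
    obtain \<epsilon> where \<epsilon>: "\<epsilon> \<in> E" "vec_floor x - \<epsilon> \<in> range ((*v) P)"
      "\<And>\<epsilon>'. \<epsilon>' \<in> E \<Longrightarrow> vec_floor x - \<epsilon>' \<in> range ((*v) P) \<Longrightarrow> \<epsilon>' = \<epsilon>"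
      using E unfolding complete_residues_def by metis
    then obtain \<delta> where \<delta>: "vec_floor x - \<epsilon> = P *v \<delta>" by blast
    \<comment> \<open>The translates of \<open>?F\<close> tile space too, because \<open>E\<close>
      meets the coset of \<open>vec_floor x\<close> exactly once.\<close>
    have "vec_floor x + P *v \<beta> \<in> E \<longleftrightarrow> \<beta> = - \<delta>" for \<beta>
    proof
      assume *: "vec_floor x + P *v \<beta> \<in> E"
      have "vec_floor x - (vec_floor x + P *v \<beta>) = P *v (- \<beta>)"
        by (simp add: matrix_vector_mult_diff_distrib[of P 0, simplified])
      then have "vec_floor x + P *v \<beta> = \<epsilon>"
        using \<epsilon>(3)[OF *] by (metis rangeI)
      then have "P *v (- \<beta>) = P *v \<delta>"
        using \<delta> by (simp add: matrix_vector_mult_diff_distrib[of P 0, simplified] algebra_simps neg_eq_iff_add_eq_0)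
      then show "\<beta> = - \<delta>"
        using inj_mult_int[OF inv] by (metis minus_minus)
    next
      assume "\<beta> = - \<delta>"
      then have "vec_floor x + P *v \<beta> = \<epsilon>"
        using \<delta> by (simp add: matrix_vector_mult_diff_distrib[of P 0, simplified] algebra_simps)
      then show "vec_floor x + P *v \<beta> \<in> E" using \<epsilon>(1) by simp
    qed
    then have "(\<lambda>\<beta>. ?J \<beta> x) =
       (\<lambda>\<beta>. indicator ?PQ x * indicator {- \<delta>} \<beta>)"
      by (auto simp: indicator_def fun_eq_iff)
    then show "(\<integral>\<^sup>+\<beta>. ?J \<beta> x \<partial>count_space UNIV) = indicator ?PQ x"
      by simp
  qed
  also have "\<dots> = ennreal \<bar>of_int (det P)\<bar>"
    using PQ PQ_sets by simp
  finally have F: "emeasure lborel ?F = ennreal \<bar>of_int (det P)\<bar>" .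
  have cell: "emeasure lborel {x :: real ^ 's. vec_floor x = k} = 1" for k
  proof -
    have "emeasure lborel {x :: real ^ 's. vec_floor x = k}
        = emeasure lborel ((\<lambda>x. vec_of_int (-k) + x) -` ?Q \<inter> space lborel)"
      by (rule arg_cong[where f = "emeasure lborel"]) (auto simp: add.commute[of _ "x::real^'s" for x])
    also have "\<dots> = emeasure (distr lborel borel ((+) (vec_of_int (-k)))) ?Q"
      using Q_sets[of 0] by (subst emeasure_distr) auto
    also have "\<dots> = 1"
      by (simp only: lborel_distr_plus emeasure_vec_floor_eq_0)
    finally show ?thesis .
  qed
  have fin: "emeasure lborel {x :: real ^ 's. vec_floor x \<in> E'} = of_nat (card E')" if "finite E'" for E'
    using that
  proof (induction E')
    case (insert k E')
    have disj: "{x :: real ^ 's. vec_floor x = k} \<inter> {x. vec_floor x \<in> E'} = {}"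
      using insert by auto
    have "{x :: real ^ 's. vec_floor x \<in> insert k E'} = {x. vec_floor x = k} \<union> {x. vec_floor x \<in> E'}"
      by auto
    moreover have "{x :: real ^ 's. vec_floor x \<in> E'} \<in> sets borel"
      using measurable_sets[OF measurable_vec_floor, of E'] by (simp add: vimage_def)
    ultimately show ?case
      using insert Q_sets[of k]
        plus_emeasure[of "{x. vec_floor x = k}" lborel "{x :: real ^ 's. vec_floor x \<in> E'}", OF _ _ disj]
      by (auto simp: cell)
  qed simp
  \<comment> \<open>The finite measure of \<open>?F\<close> leaves no room for
    \<open>\<bar>det P\<bar> + 1\<close> disjoint unit cells.\<close>
  show "finite E"
  proof (rule ccontr)
    assume "infinite E"
    then obtain E' where E': "E' \<subseteq> E" "finite E'" "card E' = Suc (nat \<bar>det P\<bar>)"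
      using infinite_arbitrarily_large by metis
    then have "emeasure lborel {x :: real ^ 's. vec_floor x \<in> E'} \<le> emeasure lborel ?F"
      using F_sets by (intro emeasure_mono) auto
    then have "ennreal (Suc (nat \<bar>det P\<bar>)) \<le> ennreal \<bar>of_int (det P)\<bar>"
      unfolding F fin[OF E'(2)] E'(3) by (simp add: ennreal_of_nat_eq_real_of_nat)
    then show False
      by (subst (asm) ennreal_le_iff) (auto simp: of_nat_nat)
  qed
  then have "ennreal (card E) = ennreal \<bar>of_int (det P)\<bar>"
    using F fin by (simp add: ennreal_of_nat_eq_real_of_nat)
  then have "real (card E) = \<bar>of_int (det P)\<bar>"
    by (subst (asm) ennreal_inj) auto
  then show "int (card E) = \<bar>det P\<bar>" by linarith
qed

section \<open>Dilation matrices\<close>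

text \<open>Summing the recursion bounds each partial sum by \<open>l\<close> times the preceding
  one plus a constant; \<open>?B\<close> is the fixed point of this affine map.\<close>

lemma summable_of_affine_recursion:
  fixes u w :: "nat \<Rightarrow> real"
  assumes u0: "\<And>r. 0 \<le> u r" and w: "summable w" "\<And>r. 0 \<le> w r"
    and l: "0 \<le> l" "l < 1" and step: "\<And>r. u (Suc r) \<le> l * u r + w r"
  shows "summable u"
proof (rule summableI_nonneg_bounded[OF u0])
  let ?B = "(u 0 + suminf w) / (1 - l)"
  have B: "u 0 + suminf w + l * ?B = ?B"
    using l by (simp add: field_simps)
  have B0: "0 \<le> ?B"
    using l u0[of 0] suminf_nonneg[OF w] by simp
  show "sum u {..<n} \<le> ?B" for n
  proof (induction n)
    case (Suc n)
    have "sum u {..<Suc n} = u 0 + (\<Sum>r<n. u (Suc r))"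
      by (rule sum.lessThan_Suc_shift)
    also have "\<dots> \<le> u 0 + (\<Sum>r<n. l * u r + w r)"
      by (intro add_left_mono sum_mono step)
    also have "\<dots> = u 0 + l * sum u {..<n} + sum w {..<n}"
      by (simp add: sum.distrib sum_distrib_left)
    also have "\<dots> \<le> u 0 + l * ?B + suminf w"
      using Suc l w by (intro add_mono mult_left_mono sum_le_suminf) auto
    finally show ?case using B by simp
  qed (use B0 in simp)
qed

section \<open>Matrix orbits and annihilating polynomials\<close>

lemma linear_funpow: "linear f \<Longrightarrow> linear (f ^^ n)" for f :: "'a::real_vector \<Rightarrow> 'a"
  by (induction n) (auto simp: linear_id intro: linear_compose)

lemma matrix_vector_mult_sum: "A *v (\<Sum>i\<in>S. f i) = (\<Sum>i\<in>S. A *v f i)"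
  for A :: "'a::comm_ring_1 ^ 'n ^ 'm"
  by (induction S rule: infinite_finite_induct) (auto simp: matrix_vector_right_distrib)

definition poly_act :: "complex ^ 'n ^ 'n \<Rightarrow> complex poly \<Rightarrow> complex ^ 'n \<Rightarrow> complex ^ 'n" where
  "poly_act A p v = (\<Sum>i\<le>degree p. coeff p i *s ((*v) A ^^ i) v)"

lemma poly_act_eq:
  assumes "degree p \<le> n"
  shows "poly_act A p v = (\<Sum>i\<le>n. coeff p i *s ((*v) A ^^ i) v)"
  unfolding poly_act_def using assms
  by (intro sum.mono_neutral_left) (auto simp: coeff_eq_0)

text \<open>The factor can be taken out on either side. Outside, it makes
  \<open>poly_act A q v\<close> zero or an eigenvector once the product annihilates
  \<open>v\<close>; inside, it lowers the degree and replaces \<open>v\<close> by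
  \<open>A *v v - l *s v\<close>.\<close>

lemma poly_act_linear_factor:
  "poly_act A ([:-l, 1:] * q) v = A *v poly_act A q v - l *s poly_act A q v"
  "poly_act A ([:-l, 1:] * q) v = poly_act A q (A *v v - l *s v)"
proof -
  have p: "[:-l, 1:] * q = pCons 0 q - smult l q"
    by simp
  define n where "n = degree q"
  have "degree (pCons 0 q - smult l q) \<le> Suc n"
    unfolding n_def by (intro degree_diff_le) (auto simp: degree_pCons_le intro: order_trans[OF degree_smult_le])
  then have "poly_act A ([:-l, 1:] * q) v = (\<Sum>i\<le>Suc n. coeff (pCons 0 q) i *s ((*v) A ^^ i) v)
      - (\<Sum>i\<le>Suc n. (l * coeff q i) *s ((*v) A ^^ i) v)"
    by (simp only: p poly_act_eq coeff_diff coeff_smult vec.scale_left_diff_distrib sum_subtractf)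
  also have "(\<Sum>i\<le>Suc n. coeff (pCons 0 q) i *s ((*v) A ^^ i) v) = (\<Sum>i\<le>n. coeff q i *s (A *v ((*v) A ^^ i) v))"
    by (simp add: sum.atMost_Suc_shift del: sum.atMost_Suc)
  also have "(\<Sum>i\<le>Suc n. (l * coeff q i) *s ((*v) A ^^ i) v) = l *s poly_act A q v"
    by (simp add: poly_act_def n_def vec.scale_sum_right coeff_eq_0 del: sum.atMost_Suc add: sum.atMost_Suc[of _ "degree q"])
  finally have *: "poly_act A ([:-l, 1:] * q) v = (\<Sum>i\<le>n. coeff q i *s (A *v ((*v) A ^^ i) v)) - l *s poly_act A q v" .
  have "(\<Sum>i\<le>n. coeff q i *s (A *v ((*v) A ^^ i) v)) = A *v poly_act A q v"
    by (simp add: poly_act_def n_def matrix_vector_mult_sum vector_scalar_commute)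
  with * show 1: "poly_act A ([:-l, 1:] * q) v = A *v poly_act A q v - l *s poly_act A q v"
    by simp
  have pow: "((*v) A ^^ i) (A *v v - l *s v) = A *v ((*v) A ^^ i) v - l *s ((*v) A ^^ i) v" for i
    by (induction i) (simp_all add: matrix_vector_mult_diff_distrib vector_scalar_commute)
  show "poly_act A ([:-l, 1:] * q) v = poly_act A q (A *v v - l *s v)"
    unfolding * by (simp add: poly_act_def n_def pow vec.scale_right_diff_distrib sum_subtractf
       vec.scale_sum_right mult.commute)
qed

text \<open>One orbit vector more than the real dimension forces a real linear relation, whose
  coefficients are those of the polynomial.\<close>

lemma ex_annihilating_poly:
  fixes A :: "complex ^ 'n ^ 'n"
  shows "\<exists>p. p \<noteq> 0 \<and> poly_act A p v = 0"
proof -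
  define f where "f i = ((*v) A ^^ i) v" for i
  let ?n = "DIM(complex ^ 'n)"
  have "\<exists>c::nat \<Rightarrow> real. (\<exists>i\<le>?n. c i \<noteq> 0) \<and> (\<Sum>i\<le>?n. c i *\<^sub>R f i) = 0"
  \<comment> \<open>\<open>dependent\<close> speaks of sets, in which repeated orbit vectors
    collapse; a repetition is already a relation by itself.\<close>
  proof (cases "inj_on f {..?n}")
    case True
    then have "card (f ` {..?n}) = Suc ?n" by (simp add: card_image)
    then have "dependent (f ` {..?n})"
      using independent_bound[of "f ` {..?n}"] by auto
    then obtain u where u: "\<exists>w\<in>f ` {..?n}. u w \<noteq> 0" "(\<Sum>w\<in>f ` {..?n}. u w *\<^sub>R w) = 0"
      by (subst (asm) dependent_finite) auto
    then show ?thesis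
      using True by (intro exI[of _ "u \<circ> f"]) (auto simp: sum.reindex)
  next
    case False
    then obtain i j where ij: "i \<le> ?n" "j \<le> ?n" "i \<noteq> j" "f i = f j"
      by (auto simp: inj_on_def)
    let ?c = "\<lambda>k. (if k = i then 1 else 0) - (if k = j then 1 else 0) :: real"
    have "(\<Sum>k\<le>?n. ?c k *\<^sub>R f k) = (\<Sum>k\<le>?n. if k = i then f k else 0) - (\<Sum>k\<le>?n. if k = j then f k else 0)"
      by (simp only: scaleR_left_diff_distrib sum_subtractf if_distrib[of "\<lambda>t. t *\<^sub>R _"] scaleR_one scaleR_zero_left)
    then have "(\<Sum>k\<le>?n. ?c k *\<^sub>R f k) = 0"
      using ij by simp
    then show ?thesis
      using ij by (intro exI[of _ ?c]) auto
  qed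
  then obtain c i where c: "i \<le> ?n" "c i \<noteq> (0::real)" "(\<Sum>i\<le>?n. c i *\<^sub>R f i) = 0"
    by blast
  define p where "p = (\<Sum>i\<le>?n. monom (complex_of_real (c i)) i)"
  have cf: "coeff p k = (if k \<le> ?n then complex_of_real (c k) else 0)" for k
    by (simp add: p_def coeff_sum)
  have "p \<noteq> 0"
    using c cf[of i] by auto
  moreover have "poly_act A p v = (\<Sum>i\<le>?n. c i *\<^sub>R f i)"
  proof -
    have "degree p \<le> ?n"
      by (rule degree_le) (simp add: cf)
    then show ?thesis
      unfolding poly_act_eq[OF \<open>degree p \<le> ?n\<close>]
      by (intro sum.cong) (auto simp: cf f_def vec_eq_iff scaleR_conv_of_real[of _ "_ :: complex"])
  qed
  ultimately show ?thesis using c(3) by auto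
qed

lemma matrix_orbit_diff:
  fixes A :: "complex ^ 'n ^ 'n"
  shows "((*v) A ^^ r) (A *v v - l *s v) = ((*v) A ^^ Suc r) v - l *s ((*v) A ^^ r) v"
  by (induction r) (simp_all add: matrix_vector_mult_diff_distrib vector_scalar_commute)

lemma norm_scale_complex_vec: "norm (l *s (v :: complex ^ 'n)) = cmod l * norm v"
  by (simp add: norm_vec_def norm_mult L2_set_right_distrib)

text \<open>The vectors with summable orbit form a subspace containing \<open>v\<close> as soon as it contains
  \<open>A v - l v\<close> with \<open>cmod l < 1\<close>; a factorised annihilating polynomial does the rest.\<close>

lemma summable_orbit_if_annihilated:
  fixes A :: "complex ^ 'n ^ 'n"
  assumes eig: "\<And>l v. v \<noteq> 0 \<Longrightarrow> A *v v = l *s v \<Longrightarrow> cmod l < 1"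
  shows "p \<noteq> 0 \<Longrightarrow> poly_act A p v = 0 \<Longrightarrow> summable (\<lambda>r. norm (((*v) A ^^ r) v))"
proof (induction "degree p" arbitrary: p v rule: less_induct)
  case less
  show ?case
  proof (cases "degree p = 0")
    case True
    then obtain a where "p = [:a:]" "a \<noteq> 0"
      using less by (metis degree_eq_zeroE pCons_eq_0_iff)
    with less have "v = 0"
      by (simp add: poly_act_def)
    moreover have "((*v) A ^^ r) 0 = 0" for r
      by (induction r) auto
    ultimately show ?thesis by simp
  next
    case False
    then obtain l where "poly p l = 0"
      using fundamental_theorem_of_algebra[of p] by (auto simp: constant_degree)
    then obtain q where p: "p = [:-l, 1:] * q"
      using poly_eq_0_iff_dvd by blast
    have q: "q \<noteq> 0" "degree q < degree p"
      using less(2) degree_mult_eq[of "[:-l, 1:]" q] unfolding p by (auto simp del: mult_pCons_left)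
    show ?thesis
    proof (cases "cmod l < 1")
      case True
      let ?w = "A *v v - l *s v"
      have "summable (\<lambda>r. norm (((*v) A ^^ r) ?w))"
        using less(1)[OF q(2,1)] less(3) by (simp add: p poly_act_linear_factor(2) del: mult_pCons_left)
      moreover have "norm (((*v) A ^^ Suc r) v) \<le> cmod l * norm (((*v) A ^^ r) v) + norm (((*v) A ^^ r) ?w)" for r
      proof -
        have "((*v) A ^^ Suc r) v = l *s ((*v) A ^^ r) v + ((*v) A ^^ r) ?w"
          by (simp add: matrix_orbit_diff)
        then show ?thesis
          by (metis norm_triangle_ineq norm_scale_complex_vec)
      qed
      ultimately show ?thesis
        by (rule summable_of_affine_recursion[OF norm_ge_zero _ norm_ge_zero norm_ge_zero True])
    next
      case False
      have "A *v poly_act A q v = l *s poly_act A q v"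
        using less(3) by (simp add: p poly_act_linear_factor(1) del: mult_pCons_left)
      then have "poly_act A q v = 0"
        using eig False by blast
      then show ?thesis
        using less(1)[OF q(2,1)] by blast
    qed
  qed
qed

lemma map_matrix_of_real_mult:
  "map_matrix complex_of_real A *v (\<chi> i. of_real (x $ i)) = (\<chi> i. of_real ((A *v x) $ i))"
  by (simp add: vec_eq_iff matrix_vector_mult_def map_matrix_def)

lemma map_matrix_of_real_matrix_mult:
  "map_matrix complex_of_real (A ** B) = map_matrix of_real A ** map_matrix of_real B"
  by (simp add: vec_eq_iff matrix_matrix_mult_def map_matrix_def)

lemma map_matrix_of_real_of_int: "map_matrix complex_of_real (map_matrix of_int M) = map_matrix of_int M"
  by (simp add: vec_eq_iff map_matrix_def)

lemma dilation_matrix_invertible: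
  assumes "dilation_matrix M"
  shows "invertible (real_mat M)"
proof -
  have "x = 0" if "real_mat M *v x = 0" for x
  proof (rule ccontr)
    assume "x \<noteq> 0"
    then have "(\<chi> i. complex_of_real (x $ i)) \<noteq> 0"
      by (auto simp: vec_eq_iff)
    moreover have "map_matrix complex_of_int M *v (\<chi> i. complex_of_real (x $ i)) = 0 *s (\<chi> i. complex_of_real (x $ i))"
      using that by (simp flip: map_matrix_of_real_of_int add: map_matrix_of_real_mult) (simp add: vec_eq_iff)
    ultimately have "cmod 0 > 1"
      using assms unfolding dilation_matrix_def by blast
    then show False by simp
  qed
  then show ?thesis
    by (metis invertible_left_inverse matrix_left_invertible_ker)
qed

text \<open>The eigenvalues of the inverse are reciprocals of eigenvalues of \<open>M\<close>, hence
  lie inside the unit disc. Embedding real vectors into complex ones preserves orbits and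
  norms.\<close>

lemma dilation_matrix_summable_orbit:
  fixes M :: "int ^ 's ^ 's"
  assumes "dilation_matrix M"
  shows "summable (\<lambda>r. norm (((*v) (matrix_inv (real_mat M)) ^^ r) x))"
proof -
  let ?A = "matrix_inv (real_mat M)"
  let ?B = "map_matrix complex_of_real ?A"
  let ?c = "\<lambda>x. \<chi> i. complex_of_real (x $ i)"
  note inv = dilation_matrix_invertible[OF assms]
  have id: "map_matrix complex_of_int M *v (?B *v v) = v" for v
  proof -
    have "real_mat M ** ?A = mat 1"
      using matrix_inv_vec_mult(2)[OF inv] by (simp add: matrix_eq flip: matrix_vector_mul_assoc)
    then have "map_matrix complex_of_int M ** ?B = mat 1"
      by (simp flip: map_matrix_of_real_of_int map_matrix_of_real_matrix_mult)
         (simp add: map_matrix_def mat_def vec_eq_iff)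
    then show ?thesis by (simp add: matrix_vector_mul_assoc)
  qed
  have eig: "cmod l < 1" if "v \<noteq> 0" "?B *v v = l *s v" for l v
  proof -
    have v: "v = l *s (map_matrix complex_of_int M *v v)"
      using id[of v] that by (simp add: vector_scalar_commute)
    then have "l \<noteq> 0" using that by auto
    then have "map_matrix complex_of_int M *v v = inverse l *s v"
      by (subst (2) v) simp
    then have "cmod (inverse l) > 1"
      using assms that unfolding dilation_matrix_def by blast
    then show ?thesis
      using \<open>l \<noteq> 0\<close> by (simp add: norm_inverse one_less_inverse_iff)
  qed
  obtain p where "p \<noteq> 0" "poly_act ?B p (?c x) = 0"
    using ex_annihilating_poly by blast
  then have "summable (\<lambda>r. norm (((*v) ?B ^^ r) (?c x)))"
    using eig by (rule summable_orbit_if_annihilated[rotated])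
  moreover have "((*v) ?B ^^ r) (?c x) = ?c (((*v) ?A ^^ r) x)" for r
    by (induction r) (simp_all add: map_matrix_of_real_mult)
  moreover have "norm (?c y) = norm y" for y :: "real ^ 's"
    by (simp add: norm_vec_def)
  ultimately show ?thesis by (simp only:)
qed

section \<open>A norm adapted to the inverse dilation\<close>

locale dilation =
  fixes M :: "int ^ 's ^ 's"
  assumes dilation: "dilation_matrix M"
begin

abbreviation R where "R \<equiv> real_mat M"
abbreviation A where "A \<equiv> matrix_inv (real_mat M)"

lemma invertible_R: "invertible R"
  by (rule dilation_matrix_invertible[OF dilation])

lemmas A_R [simp] = matrix_inv_vec_mult(1)[OF invertible_R]
lemmas R_A [simp] = matrix_inv_vec_mult(2)[OF invertible_R]

text \<open>Summing the Euclidean norm along the orbit gives an equivalent norm, from which one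
  application of \<open>A\<close> removes exactly the first term.\<close>

definition anorm :: "real ^ 's \<Rightarrow> real" where
  "anorm x = (\<Sum>r. norm (((*v) A ^^ r) x))"

lemma summable_orbit: "summable (\<lambda>r. norm (((*v) A ^^ r) x))"
  by (rule dilation_matrix_summable_orbit[OF dilation])

lemma linear_orbit: "linear ((*v) A ^^ r)"
  by (intro linear_funpow matrix_vector_mul_linear)

lemma anorm_nonneg: "0 \<le> anorm x"
  unfolding anorm_def by (intro suminf_nonneg summable_orbit) auto

lemma anorm_mult: "anorm (A *v x) = anorm x - norm x"
  using suminf_split_head[OF summable_orbit[of x]] by (simp add: anorm_def funpow_swap1)

lemma norm_le_anorm: "norm x \<le> anorm x"
  using anorm_mult[of x] anorm_nonneg[of "A *v x"] by simp

lemma anorm_add_le: "anorm (x + y) \<le> anorm x + anorm y"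
proof -
  have "norm (((*v) A ^^ r) (x + y)) \<le> norm (((*v) A ^^ r) x) + norm (((*v) A ^^ r) y)" for r
    using linear_add[OF linear_orbit] norm_triangle_ineq by metis
  then show ?thesis
    unfolding anorm_def by (subst suminf_add) (intro suminf_le summable_add summable_orbit | assumption)+
qed

lemma anorm_scaleR: "anorm (c *\<^sub>R x) = \<bar>c\<bar> * anorm x"
  unfolding anorm_def by (simp add: linear_scale[OF linear_orbit] suminf_mult summable_orbit)

text \<open>The summand 1 makes \<open>1 - 1 / anorm_const\<close> a nonnegative contraction
  factor.\<close>

definition anorm_const :: real where
  "anorm_const = 1 + (\<Sum>b\<in>Basis. anorm b)"

lemma anorm_const_ge_1: "anorm_const \<ge> 1"
  by (simp add: anorm_const_def sum_nonneg anorm_nonneg)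

lemma anorm_le: "anorm x \<le> anorm_const * norm x"
proof -
  have *: "anorm (\<Sum>b\<in>B. f b) \<le> (\<Sum>b\<in>B. anorm (f b))" if "finite B" for B and f :: "real ^ 's \<Rightarrow> real ^ 's"
    using that
  proof (induction B)
    case empty
    then show ?case using anorm_scaleR[of 0 0] by simp
  next
    case (insert b B)
    then show ?case using anorm_add_le[of "f b" "sum f B"] by simp
  qed
  have "anorm x = anorm (\<Sum>b\<in>Basis. (x \<bullet> b) *\<^sub>R b)"
    by (simp only: euclidean_representation)
  also have "\<dots> \<le> (\<Sum>b\<in>Basis. anorm ((x \<bullet> b) *\<^sub>R b))"
    by (intro *) simp
  also have "\<dots> \<le> (\<Sum>b\<in>Basis. norm x * anorm b)"
    unfolding anorm_scaleR by (intro sum_mono mult_right_mono Basis_le_norm anorm_nonneg)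
  also have "\<dots> = norm x * (\<Sum>b\<in>Basis. anorm b)"
    by (simp only: sum_distrib_left)
  also have "\<dots> \<le> anorm_const * norm x"
    by (simp add: anorm_const_def algebra_simps)
  finally show ?thesis .
qed

text \<open>As \<open>norm x\<close> is at least \<open>anorm x / anorm_const\<close>, the map
  \<open>A\<close> shrinks \<open>anorm\<close> by the factor \<open>1 - 1 / anorm_const\<close>.
  The gain \<open>\<rho> / anorm_const\<close> pays for the displacement once it exceeds
  \<open>anorm_const * D\<close>, which is the second assumption.\<close>

lemma anorm_contraction:
  assumes "norm d \<le> D" "anorm_const ^ 2 * D \<le> \<rho>" "anorm x \<le> \<rho>"
  shows "anorm (A *v (x + d)) \<le> \<rho>"
proof -
  have C: "anorm_const \<ge> 1" "anorm_const > 0" using anorm_const_ge_1 by auto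
  have "anorm (A *v (x + d)) \<le> anorm (x + d) - anorm (x + d) / anorm_const"
    using anorm_le[of "x + d"] C by (simp add: anorm_mult field_simps)
  also have "\<dots> = (1 - 1 / anorm_const) * anorm (x + d)"
    by (simp add: algebra_simps)
  also have "\<dots> \<le> (1 - 1 / anorm_const) * (\<rho> + anorm_const * D)"
  proof (rule mult_left_mono)
    have "anorm d \<le> anorm_const * D"
      using anorm_le[of d] assms(1) C by (meson mult_left_mono order_trans less_imp_le)
    then show "anorm (x + d) \<le> \<rho> + anorm_const * D"
      using anorm_add_le[of x d] assms by linarith
  qed (use C in simp)
  also have "\<dots> = \<rho> + anorm_const * D - D - \<rho> / anorm_const"
    using C by (simp add: field_simps)
  also have "\<dots> \<le> \<rho>"
  proof -
    have "anorm_const * D \<le> \<rho> / anorm_const"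
      using assms(2) C by (simp add: field_simps power2_eq_square)
    moreover have "0 \<le> D" using assms(1) norm_ge_zero order_trans by blast
    ultimately show ?thesis by simp
  qed
  finally show ?thesis .
qed

end

lemma finite_int_vec_bounded: "finite {\<alpha> :: int ^ 's. norm (vec_of_int \<alpha> :: real ^ 's) \<le> r}"
proof (rule finite_subset)
  let ?k = "\<lceil>r\<rceil>"
  show "{\<alpha> :: int ^ 's. norm (vec_of_int \<alpha> :: real ^ 's) \<le> r} \<subseteq> vec_lambda ` (UNIV \<rightarrow>\<^sub>E {- ?k..?k})"
  proof
    fix \<alpha> :: "int ^ 's"
    assume "\<alpha> \<in> {\<alpha>. norm (vec_of_int \<alpha> :: real ^ 's) \<le> r}"
    then have "\<bar>of_int (\<alpha> $ i)\<bar> \<le> r" for i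
      using component_le_norm_cart[of "vec_of_int \<alpha> :: real ^ 's" i] by simp
    then have "\<bar>\<alpha> $ i\<bar> \<le> ?k" for i
      by (metis le_ceiling_iff of_int_abs of_int_le_iff ceiling_mono ceiling_of_int)
    then have "\<alpha> = vec_lambda (vec_nth \<alpha>)" "vec_nth \<alpha> \<in> UNIV \<rightarrow>\<^sub>E {- ?k..?k}"
      by (auto simp: abs_le_iff) (metis minus_le_iff)
    then show "\<alpha> \<in> vec_lambda ` (UNIV \<rightarrow>\<^sub>E {- ?k..?k})" by blast
  qed
  show "finite (vec_lambda ` (UNIV \<rightarrow>\<^sub>E {- ?k..?k}) :: (int ^ 's) set)"
    by (intro finite_imageI finite_PiE) auto
qed

section \<open>The sum rules and the characters of the quotient lattice\<close>

lemma finite_int_box [simp]: "finite (int_box l u :: (int ^ 's) set)"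
proof (rule finite_subset)
  show "int_box l u \<subseteq> vec_lambda ` (UNIV \<rightarrow>\<^sub>E {l..u} :: ('s \<Rightarrow> int) set)"
  proof
    fix \<alpha> :: "int ^ 's"
    assume "\<alpha> \<in> int_box l u"
    then have "\<alpha> = vec_lambda (vec_nth \<alpha>)" "vec_nth \<alpha> \<in> UNIV \<rightarrow>\<^sub>E {l..u}"
      by (auto simp: int_box_def)
    then show "\<alpha> \<in> vec_lambda ` (UNIV \<rightarrow>\<^sub>E {l..u})" by blast
  qed
qed (auto intro!: finite_imageI finite_PiE)

text \<open>Needed for \<open>transpose M\<close>, whose residues enumerate the dual roots. The
  choice \<open>sel\<close> is constant on cosets because the predicate it chooses from is.\<close>

lemma ex_complete_residues: "\<exists>E. complete_residues P E"
proof -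
  let ?c = "\<lambda>\<alpha> \<beta>. \<alpha> - \<beta> \<in> range ((*v) P)"
  define sel where "sel \<alpha> = (SOME \<beta>. ?c \<alpha> \<beta>)" for \<alpha>
  have refl: "?c \<alpha> \<alpha>" for \<alpha>
    by (auto intro!: image_eqI[of _ _ 0])
  have sym: "?c \<beta> \<alpha>" if "?c \<alpha> \<beta>" for \<alpha> \<beta>
  proof -
    from that obtain \<gamma> where "\<alpha> - \<beta> = P *v \<gamma>" by blast
    then have "\<beta> - \<alpha> = P *v (0 - \<gamma>)" by (simp only: matrix_vector_mult_diff_distrib) (simp add: algebra_simps)
    then show ?thesis by blast
  qed
  have trans: "?c \<alpha> \<gamma>" if "?c \<alpha> \<beta>" "?c \<beta> \<gamma>" for \<alpha> \<beta> \<gamma>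
  proof -
    from that obtain x y where "\<alpha> - \<beta> = P *v x" "\<beta> - \<gamma> = P *v y" by blast
    then have "\<alpha> - \<gamma> = P *v (x + y)" by (simp only: matrix_vector_right_distrib) (simp add: algebra_simps)
    then show ?thesis by blast
  qed
  have sel: "?c \<alpha> (sel \<alpha>)" for \<alpha>
    unfolding sel_def using refl by (rule someI)
  have eq: "sel \<alpha> = sel \<beta>" if "?c \<alpha> \<beta>" for \<alpha> \<beta>
  proof -
    have "?c \<alpha> \<gamma> \<longleftrightarrow> ?c \<beta> \<gamma>" for \<gamma>
      using trans[OF that, of \<gamma>] trans[OF sym[OF that], of \<gamma>] by argo
    then show ?thesis by (simp add: sel_def)
  qed
  have "\<exists>!\<epsilon>. \<epsilon> \<in> range sel \<and> ?c \<alpha> \<epsilon>" for \<alpha>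
  proof (rule ex1I[of _ "sel \<alpha>"])
    fix \<epsilon> assume "\<epsilon> \<in> range sel \<and> ?c \<alpha> \<epsilon>"
    then obtain \<beta> where "\<epsilon> = sel \<beta>" "?c \<alpha> (sel \<beta>)" by blast
    moreover from this have "?c \<alpha> \<beta>" using sel sym trans by blast
    ultimately show "\<epsilon> = sel \<alpha>" using eq by metis
  qed (use sel in auto)
  then show ?thesis unfolding complete_residues_def by blast
qed

section \<open>Characters and the monomials at the dual roots\<close>

definition char_e :: "real \<Rightarrow> complex" where
  "char_e t = exp (2 * of_real pi * \<i> * of_real t)"

lemma char_e_add: "char_e (s + t) = char_e s * char_e t"
  by (simp add: char_e_def ring_distribs exp_add)

lemma char_e_eq_1_iff: "char_e t = 1 \<longleftrightarrow> t \<in> \<int>"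
  by (auto simp: char_e_def exp_eq_1 Ints_def)

lemma char_e_0 [simp]: "char_e 0 = 1"
  by (simp add: char_e_def)

lemma char_e_nonzero [simp]: "char_e t \<noteq> 0"
  by (simp add: char_e_def)

lemma norm_char_e [simp]: "cmod (char_e t) = 1"
  by (simp add: char_e_def)

lemma char_e_eq_iff: "char_e s = char_e t \<longleftrightarrow> s - t \<in> \<int>"
proof -
  have "char_e s = char_e (s - t) * char_e t"
    by (simp flip: char_e_add)
  then show ?thesis by (simp add: char_e_eq_1_iff[symmetric])
qed

lemma prod_char_e: "(\<Prod>i\<in>S. char_e (f i)) = char_e (\<Sum>i\<in>S. f i)"
  by (induction S rule: infinite_finite_induct) (simp_all add: char_e_add)

lemma char_e_powi: "char_e t powi n = char_e (of_int n * t)"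
  by (simp add: char_e_def exp_power_int mult_ac)

definition zpow :: "complex ^ 's \<Rightarrow> int ^ 's \<Rightarrow> complex" where
  "zpow z \<alpha> = (\<Prod>i\<in>UNIV. (z $ i) powi (\<alpha> $ i))"

lemma zpow_mult: "zpow (z * w) \<alpha> = zpow z \<alpha> * zpow w \<alpha>"
  by (simp add: zpow_def power_int_mult_distrib prod.distrib)

lemma symbol_mask:
  assumes "is_mask N a"
  shows "symbol a z = (\<Sum>\<alpha>\<in>int_box 0 (int N). of_real (a \<alpha>) * zpow z \<alpha>)"
proof -
  have "symbol a z = (\<Sum>\<^sub>\<infinity>\<alpha>\<in>int_box 0 (int N). of_real (a \<alpha>) * zpow z \<alpha>)"
    unfolding symbol_def zpow_def using assms
    by (intro infsum_cong_neutral) (auto simp: is_mask_def)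
  then show ?thesis by simp
qed

lemma range_vec_of_int_iff: "x \<in> range vec_of_int \<longleftrightarrow> (\<forall>i. x $ i \<in> \<int>)"
proof
  assume "\<forall>i. x $ i \<in> \<int>"
  then have "\<forall>i. \<exists>n. x $ i = of_int n" by (auto simp: Ints_def)
  then obtain f where "\<And>i. x $ i = of_int (f i)" by metis
  then have "x = vec_of_int (vec_lambda f)" by (simp add: vec_eq_iff)
  then show "x \<in> range vec_of_int" by blast
qed auto

lemma inner_vec_of_int_Ints: "vec_of_int \<xi> \<bullet> (vec_of_int \<alpha> :: real ^ 's) \<in> \<int>"
  by (auto simp: inner_vec_def intro!: Ints_sum Ints_mult)

context dilation
begin

lemma real_mat_transpose: "real_mat (transpose M) = transpose R"
  by (simp add: vec_eq_iff transpose_def map_matrix_def)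

lemma invertible_transpose_R: "invertible (transpose R)"
  using invertible_R by (simp add: invertible_det_nz det_transpose)

abbreviation At where "At \<equiv> matrix_inv (transpose R)"

lemma inner_At: "(At *v x) \<bullet> y = x \<bullet> (A *v y)"
proof -
  have "(At *v x) \<bullet> (R *v (A *v y)) = (transpose R *v (At *v x)) \<bullet> (A *v y)"
    by (simp only: dot_lmul_matrix transpose_matrix_vector)
  then show ?thesis
    by (simp only: matrix_inv_vec_mult(2)[OF invertible_transpose_R] R_A)
qed

definition dual_root :: "int ^ 's \<Rightarrow> complex ^ 's" where
  "dual_root \<xi> = (\<chi> i. char_e ((At *v vec_of_int \<xi>) $ i))"

lemma dual_roots_eq: "dual_roots M = range dual_root"
  by (simp add: dual_roots_def dual_root_def char_e_def)

lemma zpow_dual_root: "zpow (dual_root \<xi>) \<alpha> = char_e (vec_of_int \<xi> \<bullet> (A *v vec_of_int \<alpha>))"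
proof -
  have "zpow (dual_root \<xi>) \<alpha> = char_e ((At *v vec_of_int \<xi>) \<bullet> vec_of_int \<alpha>)"
    by (simp add: zpow_def dual_root_def char_e_powi prod_char_e inner_vec_def mult.commute)
  then show ?thesis by (simp only: inner_At)
qed

lemma dual_root_add: "dual_root (\<xi> + \<xi>') = dual_root \<xi> * dual_root \<xi>'"
  by (simp add: dual_root_def vec_eq_iff matrix_vector_right_distrib char_e_add)

lemma dual_root_0: "dual_root 0 = 1"
  by (simp add: dual_root_def vec_eq_iff)

lemma dual_root_eq_iff: "dual_root \<xi> = dual_root \<xi>' \<longleftrightarrow> \<xi> - \<xi>' \<in> range ((*v) (transpose M))"
proof -
  have "dual_root \<xi> = dual_root \<xi>' \<longleftrightarrow> (\<forall>i. (At *v vec_of_int (\<xi> - \<xi>')) $ i \<in> \<int>)"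
    by (simp add: dual_root_def vec_eq_iff char_e_eq_iff matrix_vector_mult_diff_distrib)
  also have "\<dots> \<longleftrightarrow> \<xi> - \<xi>' \<in> range ((*v) (transpose M))"
    using range_mult_int_iff[of "transpose M" "\<xi> - \<xi>'"] invertible_transpose_R
    by (simp only: real_mat_transpose range_vec_of_int_iff)
  finally show ?thesis .
qed

text \<open>\<open>dual_root\<close> identifies exactly the vectors congruent modulo
  \<open>transpose M\<close>, so dual roots are counted by residues, and transposing keeps the
  determinant.\<close>

lemma card_dual_roots: "finite (dual_roots M)" "int (card (dual_roots M)) = \<bar>det M\<bar>"
proof -
  obtain E where E: "complete_residues (transpose M) E"
    using ex_complete_residues by blast
  have fin: "finite E" "int (card E) = \<bar>det M\<bar>"
    using card_complete_residues[OF E] invertible_transpose_R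
    by (simp_all add: real_mat_transpose det_transpose)
  have "inj_on dual_root E"
  proof
    fix x y assume xy: "x \<in> E" "y \<in> E" "dual_root x = dual_root y"
    have "x - x \<in> range ((*v) (transpose M))" by (metis dual_root_eq_iff)
    with xy show "x = y"
      using E unfolding complete_residues_def by (metis dual_root_eq_iff)
  qed
  moreover have "dual_roots M = dual_root ` E"
  proof -
    have "dual_root \<xi> \<in> dual_root ` E" for \<xi>
    proof -
      obtain \<epsilon> where "\<epsilon> \<in> E" "\<xi> - \<epsilon> \<in> range ((*v) (transpose M))"
        using E unfolding complete_residues_def by meson
      then have "dual_root \<xi> = dual_root \<epsilon>" by (simp only: dual_root_eq_iff)
      with \<open>\<epsilon> \<in> E\<close> show ?thesis by (simp only: image_eqI)
    qed
    then show ?thesis unfolding dual_roots_eq by auto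
  qed
  ultimately show "finite (dual_roots M)" "int (card (dual_roots M)) = \<bar>det M\<bar>"
    using fin by (simp_all only: card_image finite_imageI)
qed

lemma one_in_dual_roots: "1 \<in> dual_roots M"
  by (metis dual_roots_eq rangeI dual_root_0)

lemma zpow_dual_root_add: "z \<in> dual_roots M \<Longrightarrow> zpow z (\<alpha> + \<beta>) = zpow z \<alpha> * zpow z \<beta>"
  by (auto simp: dual_roots_eq zpow_dual_root matrix_vector_right_distrib inner_add_right char_e_add)

lemma norm_zpow_dual_root: "z \<in> dual_roots M \<Longrightarrow> cmod (zpow z \<alpha>) = 1"
  by (auto simp: dual_roots_eq zpow_dual_root)

text \<open>Orthogonality of characters. If some dual root has a value other than 1 at
  \<open>\<alpha>\<close>, multiplying by it permutes the roots and multiplies the sum by that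
  value, so the sum is 0.\<close>

lemma sum_zpow_dual_roots:
  "(\<Sum>z\<in>dual_roots M. zpow z \<alpha>) = (if \<alpha> \<in> range ((*v) M) then of_int \<bar>det M\<bar> else 0)"
proof (cases "\<alpha> \<in> range ((*v) M)")
  case True
  then obtain \<beta> where \<beta>: "\<alpha> = M *v \<beta>" by blast
  have "zpow z \<alpha> = 1" if "z \<in> dual_roots M" for z
    using that inner_vec_of_int_Ints
    by (auto simp: dual_roots_eq zpow_dual_root \<beta> char_e_eq_1_iff simp flip: map_matrix_of_int_mult)
  then have "(\<Sum>z\<in>dual_roots M. zpow z \<alpha>) = of_int (int (card (dual_roots M)))"
    by simp
  then show ?thesis
    using True unfolding card_dual_roots(2) by simp
next
  case False
  then obtain i where i: "(A *v vec_of_int \<alpha>) $ i \<notin> \<int>"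
    using range_mult_int_iff[OF invertible_R, of \<alpha>] by (auto simp: range_vec_of_int_iff)
  have ax: "vec_of_int (axis i 1) = (axis i 1 :: real ^ 's)"
    by (simp add: vec_eq_iff axis_def)
  \<comment> \<open>The monomial of this root at \<open>\<alpha>\<close> is \<open>char_e\<close> of
    the non-integral coordinate found above, hence not 1.\<close>
  let ?z = "dual_root (axis i 1)"
  have z1: "zpow ?z \<alpha> \<noteq> 1"
    using i by (simp add: zpow_dual_root char_e_eq_1_iff ax inner_axis_axis inner_axis' )
  have bij: "bij_betw (\<lambda>z. ?z * z) (dual_roots M) (dual_roots M)"
  proof -
    have "inj_on (\<lambda>z. ?z * z) (dual_roots M)"
      by (rule inj_onI) (simp add: vec_eq_iff dual_root_def)
    moreover have "(\<lambda>z. ?z * z) ` dual_roots M \<subseteq> dual_roots M"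
      unfolding dual_roots_eq by (auto simp flip: dual_root_add)
    ultimately show ?thesis
      using card_dual_roots(1) by (simp add: bij_betw_def endo_inj_surj)
  qed
  have "(\<Sum>z\<in>dual_roots M. zpow z \<alpha>) = (\<Sum>z\<in>dual_roots M. zpow (?z * z) \<alpha>)"
    by (rule sum.reindex_bij_betw[OF bij, symmetric])
  also have "\<dots> = zpow ?z \<alpha> * (\<Sum>z\<in>dual_roots M. zpow z \<alpha>)"
    by (simp add: zpow_mult sum_distrib_left)
  finally show ?thesis
    using z1 False by simp
qed

text \<open>The substitution \<open>\<gamma> = \<alpha> - M *v \<beta>\<close> turns the series into
  the sum of the mask over the coset of \<open>\<alpha>\<close>.\<close>

lemma subdivision_one_mask:
  assumes "is_mask N a"
  shows "subdivision M a (\<lambda>_. 1) \<alpha>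
       = (\<Sum>\<gamma>\<in>int_box 0 (int N). if \<gamma> - \<alpha> \<in> range ((*v) M) then a \<gamma> else 0)"
proof -
  have inj: "inj (\<lambda>\<beta>. \<alpha> - M *v \<beta>)"
    by (rule injI) (simp add: inj_mult_int[OF invertible_R])
  have rng: "\<gamma> \<in> range (\<lambda>\<beta>. \<alpha> - M *v \<beta>) \<longleftrightarrow> \<gamma> - \<alpha> \<in> range ((*v) M)" for \<gamma>
  proof
    assume "\<gamma> \<in> range (\<lambda>\<beta>. \<alpha> - M *v \<beta>)"
    then obtain \<beta> where "\<gamma> = \<alpha> - M *v \<beta>" by blast
    then have "\<gamma> - \<alpha> = M *v (0 - \<beta>)" by (simp only: matrix_vector_mult_diff_distrib) simp
    then show "\<gamma> - \<alpha> \<in> range ((*v) M)" by blast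
  next
    assume "\<gamma> - \<alpha> \<in> range ((*v) M)"
    then obtain \<beta> where "\<gamma> - \<alpha> = M *v \<beta>" by blast
    then have "\<gamma> = \<alpha> - M *v (0 - \<beta>)" by (simp only: matrix_vector_mult_diff_distrib) (simp add: algebra_simps)
    then show "\<gamma> \<in> range (\<lambda>\<beta>. \<alpha> - M *v \<beta>)" by blast
  qed
  have "subdivision M a (\<lambda>_. 1) \<alpha> = infsum a (range (\<lambda>\<beta>. \<alpha> - M *v \<beta>))"
    unfolding subdivision_def by (subst infsum_reindex[OF inj]) (simp add: o_def)
  also have "\<dots> = (\<Sum>\<^sub>\<infinity>\<gamma>\<in>int_box 0 (int N). if \<gamma> - \<alpha> \<in> range ((*v) M) then a \<gamma> else 0)"
    using assms by (intro infsum_cong_neutral) (auto simp: is_mask_def simp flip: rng)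
  finally show ?thesis by simp
qed

text \<open>Summing over the dual roots keeps only the coefficients in the coset of
  \<open>\<alpha>\<close>, each with weight \<open>\<bar>det M\<bar>\<close>.\<close>

lemma subdivision_one_inversion:
  assumes "is_mask N a"
  shows "of_int \<bar>det M\<bar> * complex_of_real (subdivision M a (\<lambda>_. 1) \<alpha>)
       = (\<Sum>z\<in>dual_roots M. symbol a z * zpow z (- \<alpha>))"
proof -
  have "(\<Sum>z\<in>dual_roots M. symbol a z * zpow z (- \<alpha>))
      = (\<Sum>z\<in>dual_roots M. \<Sum>\<gamma>\<in>int_box 0 (int N). of_real (a \<gamma>) * zpow z (\<gamma> - \<alpha>))"
    unfolding symbol_mask[OF assms] sum_distrib_right
    by (intro sum.cong refl) (use zpow_dual_root_add[of _ _ "- \<alpha>"] in \<open>simp add: mult.assoc\<close>)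
  also have "\<dots> = (\<Sum>\<gamma>\<in>int_box 0 (int N). of_real (a \<gamma>) * (\<Sum>z\<in>dual_roots M. zpow z (\<gamma> - \<alpha>)))"
    by (subst sum.swap) (simp add: sum_distrib_left)
  also have "\<dots> = of_int \<bar>det M\<bar> * complex_of_real (subdivision M a (\<lambda>_. 1) \<alpha>)"
    unfolding sum_zpow_dual_roots subdivision_one_mask[OF assms] of_real_sum sum_distrib_left
    by (intro sum.cong refl) auto
  finally show ?thesis by simp
qed

lemma det_M_nonzero: "\<bar>det M\<bar> \<ge> 1"
  using invertible_R by (auto simp: invertible_det_nz det_map_matrix_of_int)

text \<open>In the inversion formula the root 1 yields the main term and the first defect; each of
  the at most \<open>\<bar>det M\<bar>\<close> other roots adds at most the maximum. The absolute
  value around \<open>Max\<close> covers an empty set of other roots, where \<open>Max\<close> is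
  unspecified.\<close>

lemma subdivision_one_bound:
  assumes "is_mask N a"
  shows "\<bar>subdivision M a (\<lambda>_. 1) \<alpha> - 1\<bar> \<le> cmod (symbol a 1 - of_int \<bar>det M\<bar>)
     + of_int \<bar>det M\<bar> * \<bar>Max ((\<lambda>\<epsilon>. cmod (symbol a \<epsilon>)) ` (dual_roots M - {1}))\<bar>"
proof -
  let ?D = "dual_roots M - {1}" and ?m = "\<bar>det M\<bar>"
  let ?\<delta> = "Max ((\<lambda>\<epsilon>. cmod (symbol a \<epsilon>)) ` ?D)"
  have z1: "zpow 1 (- \<alpha>) = 1"
    by (simp add: zpow_def)
  have "of_int ?m * complex_of_real (subdivision M a (\<lambda>_. 1) \<alpha> - 1)
      = (symbol a 1 - of_int ?m) + (\<Sum>z\<in>?D. symbol a z * zpow z (- \<alpha>))"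
    using subdivision_one_inversion[OF assms, of \<alpha>]
    by (simp add: sum.remove[OF card_dual_roots(1) one_in_dual_roots] z1 algebra_simps)
  moreover have nm: "cmod (of_int ?m * complex_of_real t) = of_int ?m * \<bar>t\<bar>" for t
    by (simp add: norm_mult)
  ultimately have "of_int ?m * \<bar>subdivision M a (\<lambda>_. 1) \<alpha> - 1\<bar>
      = cmod ((symbol a 1 - of_int ?m) + (\<Sum>z\<in>?D. symbol a z * zpow z (- \<alpha>)))"
    by (metis nm)
  also have "\<dots> \<le> cmod (symbol a 1 - of_int ?m) + (\<Sum>z\<in>?D. cmod (symbol a z * zpow z (- \<alpha>)))"
    by (intro order_trans[OF norm_triangle_ineq] add_left_mono norm_sum)
  also have "(\<Sum>z\<in>?D. cmod (symbol a z * zpow z (- \<alpha>))) \<le> (\<Sum>z\<in>?D. \<bar>?\<delta>\<bar>)"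
  proof (rule sum_mono)
    fix z assume z: "z \<in> ?D"
    then have "cmod (symbol a z) \<le> ?\<delta>"
      using card_dual_roots(1) by (intro Max_ge) auto
    then show "cmod (symbol a z * zpow z (- \<alpha>)) \<le> \<bar>?\<delta>\<bar>"
      using z by (simp add: norm_mult norm_zpow_dual_root)
  qed
  also have "(\<Sum>z\<in>?D. \<bar>?\<delta>\<bar>) \<le> of_int ?m * \<bar>?\<delta>\<bar>"
  proof -
    have "card ?D \<le> card (dual_roots M)"
      using card_dual_roots(1) by (intro card_mono) auto
    then have "real (card ?D) \<le> of_int ?m"
      using card_dual_roots(2) by linarith
    then show ?thesis by (simp add: mult_right_mono)
  qed
  finally have "of_int ?m * \<bar>subdivision M a (\<lambda>_. 1) \<alpha> - 1\<bar>
      \<le> cmod (symbol a 1 - of_int ?m) + of_int ?m * \<bar>?\<delta>\<bar>" by simp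
  \<comment> \<open>The factor \<open>\<bar>det M\<bar>\<close> on the left is at least 1 and is
    simply discarded.\<close>
  moreover have "1 * \<bar>subdivision M a (\<lambda>_. 1) \<alpha> - 1\<bar> \<le> of_int ?m * \<bar>subdivision M a (\<lambda>_. 1) \<alpha> - 1\<bar>"
    using det_M_nonzero by (intro mult_right_mono) (simp_all flip: of_int_abs)
  ultimately show ?thesis by linarith
qed

lemma approx_sum_rules_defect:
  assumes "approx_sum_rules_1 M a" and "\<And>k. k \<ge> 1 \<Longrightarrow> is_mask N (a k)"
  obtains \<eta> :: "nat \<Rightarrow> real" where "summable \<eta>" "\<And>k. 0 \<le> \<eta> k"
    "\<And>k \<alpha>. \<bar>subdivision M (a (Suc k)) (\<lambda>_. 1) \<alpha> - 1\<bar> \<le> \<eta> k"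
proof -
  let ?\<mu> = "\<lambda>k. cmod (symbol (a (Suc k)) 1 - of_int \<bar>det M\<bar>)"
  let ?\<delta> = "\<lambda>k. Max ((\<lambda>\<epsilon>. cmod (symbol (a (Suc k)) \<epsilon>)) ` (dual_roots M - {1}))"
  have s: "summable ?\<mu>" "summable ?\<delta>"
    using assms(1) by (auto simp: approx_sum_rules_1_def)
  have "summable (\<lambda>k. \<bar>?\<delta> k\<bar>)"
  \<comment> \<open>Without other roots, \<open>Max\<close> is the same unspecified number for every
    \<open>k\<close>; being summable, it is 0.\<close>
  proof (cases "dual_roots M - {1} = {}")
    case True
    then have "?\<delta> = (\<lambda>k. ?\<delta> 0)" by (simp only: True image_empty)
    then have "?\<delta> \<longlonglongrightarrow> ?\<delta> 0" by (rule ssubst) (rule tendsto_const)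
    then have "?\<delta> 0 = 0"
      using summable_LIMSEQ_zero[OF s(2)] LIMSEQ_unique by blast
    then have "?\<delta> k = 0" for k by (simp only: True image_empty)
    then show ?thesis by (simp only: abs_zero summable_zero)
  next
    case False
    have "0 \<le> ?\<delta> k" for k
    proof -
      from False obtain z where "z \<in> dual_roots M - {1}" by (meson ex_in_conv)
      then have "cmod (symbol (a (Suc k)) z) \<le> ?\<delta> k"
        using card_dual_roots(1) by (intro Max_ge) auto
      then show ?thesis using norm_ge_zero order_trans by blast
    qed
    then show ?thesis using s(2) by simp
  qed
  then have "summable (\<lambda>k. ?\<mu> k + of_int \<bar>det M\<bar> * \<bar>?\<delta> k\<bar>)"
    using s(1) by (intro summable_add summable_mult)
  then show ?thesis
    using that[of "\<lambda>k. ?\<mu> k + of_int \<bar>det M\<bar> * \<bar>?\<delta> k\<bar>"] subdivision_one_bound[OF assms(2)]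
    by auto
qed

end

section \<open>Partition of unity for test functions\<close>

lemma continuous_on_char_e [continuous_intros]:
  "continuous_on S f \<Longrightarrow> continuous_on S (\<lambda>x. char_e (f x))"
  unfolding char_e_def by (intro continuous_intros)

text \<open>The test functions \<open>u\<close> annihilated together with all their modulations form a module over the
  trigonometric polynomials, which Stone--Weierstrass makes dense on the torus.\<close>

lemma fourier_uniqueness:
  fixes h :: "real ^ 's \<Rightarrow> real"
  assumes cont: "continuous_on UNIV h"
    and per: "\<And>x \<alpha>. h (x + vec_of_int \<alpha>) = h x"
    and orth: "\<And>\<xi>. integral (cbox 0 One) (\<lambda>x. of_real (h x) * char_e (- (x \<bullet> vec_of_int \<xi>))) = 0"
  shows "h x = 0"
proof -
  let ?e = "\<lambda>\<xi> x. char_e (- (x \<bullet> vec_of_int \<xi>))"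
  let ?Q = "cbox 0 (One :: real ^ 's)"
  define U where "U = {u :: real ^ 's \<Rightarrow> complex. continuous_on UNIV u \<and>
     (\<forall>\<xi>. integral ?Q (\<lambda>x. of_real (h x) * u x * ?e \<xi> x) = 0)}"
  define torus where "torus = (\<lambda>x :: real ^ 's. (\<chi> i. char_e (x $ i)) :: complex ^ 's)"
  define T where "T = torus ` ?Q"
  have cont_torus: "continuous_on UNIV torus"
    unfolding torus_def by (intro continuous_on_vec_lambda continuous_intros)
  have int: "(\<lambda>x. of_real (h x) * u x * ?e \<xi> x) integrable_on ?Q"
    if "continuous_on UNIV u" for u \<xi>
    using that cont by (intro integrable_continuous continuous_intros) (auto intro: continuous_on_subset)
  have U_cont: "continuous_on UNIV u" if "u \<in> U" for u
    using that by (simp add: U_def)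
  have U_add: "(\<lambda>x. u x + v x) \<in> U" if "u \<in> U" "v \<in> U" for u v
  proof -
    have "integral ?Q (\<lambda>x. of_real (h x) * (u x + v x) * ?e \<xi> x) = 0" for \<xi>
      using that integral_add[OF int int, of u v \<xi> \<xi>] unfolding U_def
      by (simp add: algebra_simps)
    then show ?thesis
      using that by (simp add: U_def continuous_on_add)
  qed
  have U_mult: "(\<lambda>x. c * u x) \<in> U" if "u \<in> U" for u c
  proof -
    have "integral ?Q (\<lambda>x. of_real (h x) * (c * u x) * ?e \<xi> x) = 0" for \<xi>
    proof -
      have "integral ?Q (\<lambda>x. of_real (h x) * (c * u x) * ?e \<xi> x)
          = integral ?Q (\<lambda>x. c * (of_real (h x) * u x * ?e \<xi> x))"
        by (simp add: mult_ac)
      also have "\<dots> = c * integral ?Q (\<lambda>x. of_real (h x) * u x * ?e \<xi> x)"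
        by (rule integral_mult_right)
      finally show ?thesis using that by (simp add: U_def)
    qed
    then show ?thesis
      using that by (auto simp: U_def intro!: continuous_on_mult continuous_on_const)
  qed
  have U_mod: "(\<lambda>x. char_e (x \<bullet> vec_of_int \<zeta>) * u x) \<in> U" if "u \<in> U" for u \<zeta>
  proof -
    have "integral ?Q (\<lambda>x. of_real (h x) * (char_e (x \<bullet> vec_of_int \<zeta>) * u x) * ?e \<xi> x) = 0" for \<xi>
    proof -
      have "of_real (h x) * (char_e (x \<bullet> vec_of_int \<zeta>) * u x) * ?e \<xi> x
         = of_real (h x) * u x * ?e (\<xi> - \<zeta>) x" for x
      proof -
        have "?e (\<xi> - \<zeta>) x = char_e (x \<bullet> vec_of_int \<zeta>) * ?e \<xi> x"
          by (simp add: inner_diff_right flip: char_e_add)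
        then show ?thesis by (simp only: mult_ac)
      qed
      then show ?thesis using that by (simp only: U_def mem_Collect_eq)
    qed
    then show ?thesis
      using that by (auto simp: U_def intro!: continuous_intros)
  qed
  have ax: "vec_of_int (axis i 1) = (axis i 1 :: real ^ 's)" for i
    by (simp add: vec_eq_iff axis_def)
  have U_coord: "(\<lambda>x. char_e (x $ i) * u x) \<in> U" "(\<lambda>x. char_e (- (x $ i)) * u x) \<in> U" if "u \<in> U" for u i
    using U_mod[OF that, of "axis i 1"] U_mod[OF that, of "- axis i 1"]
    by (simp_all add: ax inner_axis)
  \<comment> \<open>The multipliers that map \<open>U\<close> into itself, taken real-valued because
    Stone--Weierstrass is applied to real functions. Real and imaginary parts of the coordinates
    belong to it and separate points.\<close>
  define Rg where "Rg = {p :: complex ^ 's \<Rightarrow> real. continuous_on UNIV p \<and>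
     (\<forall>u\<in>U. (\<lambda>x. of_real (p (torus x)) * u x) \<in> U)}"
  have Re_Rg: "(\<lambda>z. Re (z $ i)) \<in> Rg" and Im_Rg: "(\<lambda>z. Im (z $ i)) \<in> Rg" for i
  proof -
    have cnj: "char_e (- t) = cnj (char_e t)" for t
      by (simp add: char_e_def exp_cnj)
    have "(\<lambda>x. of_real (Re (torus x $ i)) * u x) \<in> U" if "u \<in> U" for u
    proof -
      have "(\<lambda>x. (1/2) * (char_e (x $ i) * u x) + (1/2) * (char_e (- (x $ i)) * u x)) \<in> U"
        by (intro U_add U_mult U_coord that)
      moreover have "(\<lambda>x. (1/2) * (char_e (x $ i) * u x) + (1/2) * (char_e (- (x $ i)) * u x))
         = (\<lambda>x. of_real (Re (torus x $ i)) * u x)"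
      proof
        fix x
        have "(char_e (x $ i) + char_e (- (x $ i))) = 2 * of_real (Re (torus x $ i))"
          by (simp add: torus_def cnj complex_add_cnj)
        then show "(1/2) * (char_e (x $ i) * u x) + (1/2) * (char_e (- (x $ i)) * u x) = of_real (Re (torus x $ i)) * u x"
          by (simp flip: distrib_left distrib_right add: add_divide_distrib[symmetric])
      qed
      ultimately show ?thesis by (simp only:)
    qed
    then show "(\<lambda>z. Re (z $ i)) \<in> Rg"
      by (auto simp: Rg_def intro!: continuous_intros)
    have "(\<lambda>x. of_real (Im (torus x $ i)) * u x) \<in> U" if "u \<in> U" for u
    proof -
      have "(\<lambda>x. (1/(2*\<i>)) * (char_e (x $ i) * u x) + (-1/(2*\<i>)) * (char_e (- (x $ i)) * u x)) \<in> U"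
        by (intro U_add U_mult U_coord that)
      moreover have "(\<lambda>x. (1/(2*\<i>)) * (char_e (x $ i) * u x) + (-1/(2*\<i>)) * (char_e (- (x $ i)) * u x))
         = (\<lambda>x. of_real (Im (torus x $ i)) * u x)"
      proof
        fix x
        have *: "(char_e (x $ i) - char_e (- (x $ i))) = 2 * \<i> * of_real (Im (torus x $ i))"
          by (simp add: torus_def cnj complex_diff_cnj mult_ac)
        have "(1/(2*\<i>)) * (char_e (x $ i) * u x) + (-1/(2*\<i>)) * (char_e (- (x $ i)) * u x)
          = (1/(2*\<i>)) * (char_e (x $ i) - char_e (- (x $ i))) * u x"
          by (simp add: algebra_simps diff_divide_distrib)
        then show "(1/(2*\<i>)) * (char_e (x $ i) * u x) + (-1/(2*\<i>)) * (char_e (- (x $ i)) * u x) = of_real (Im (torus x $ i)) * u x"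
          unfolding * by simp
      qed
      ultimately show ?thesis by (simp only:)
    qed
    then show "(\<lambda>z. Im (z $ i)) \<in> Rg"
      by (auto simp: Rg_def intro!: continuous_intros)
  qed
  have compact_T: "compact T"
    unfolding T_def using cont_torus by (intro compact_continuous_image) (auto intro: continuous_on_subset)
  interpret SW: function_ring_on Rg T
  proof
    show "compact T" by (rule compact_T)
    show "continuous_on T p" if "p \<in> Rg" for p
      using that by (auto simp: Rg_def intro: continuous_on_subset)
    show "(\<lambda>z. p z + q z) \<in> Rg" if "p \<in> Rg" "q \<in> Rg" for p q
      using that U_add[of "\<lambda>x. of_real (p (torus x)) * u x" "\<lambda>x. of_real (q (torus x)) * u x" for u]
      unfolding Rg_def by (auto simp: distrib_right intro!: continuous_on_add)
    show "(\<lambda>z. p z * q z) \<in> Rg" if "p \<in> Rg" "q \<in> Rg" for p q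
    proof -
      have "(\<lambda>x. of_real (p (torus x)) * (of_real (q (torus x)) * u x)) \<in> U" if "u \<in> U" for u
      proof -
        have "(\<lambda>x. of_real (q (torus x)) * u x) \<in> U"
          using \<open>q \<in> Rg\<close> that by (simp add: Rg_def)
        moreover have "\<forall>v\<in>U. (\<lambda>x. of_real (p (torus x)) * v x) \<in> U"
          using \<open>p \<in> Rg\<close> by (simp add: Rg_def)
        ultimately show ?thesis by (rule bspec[rotated])
      qed
      then show ?thesis
        using that unfolding Rg_def by (auto simp: mult.assoc intro!: continuous_on_mult)
    qed
    show "(\<lambda>_. c) \<in> Rg" for c
      unfolding Rg_def using U_mult by auto
    show "\<exists>p\<in>Rg. p z \<noteq> p w" if "z \<noteq> w" for z w
    proof -
      from that obtain i where "z $ i \<noteq> w $ i" by (auto simp: vec_eq_iff)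
      then consider "Re (z $ i) \<noteq> Re (w $ i)" | "Im (z $ i) \<noteq> Im (w $ i)"
        using complex_eqI by blast
      then show ?thesis
      proof cases
        case 1
        then show ?thesis by (intro bexI[OF _ Re_Rg[of i]])
      next
        case 2
        then show ?thesis by (intro bexI[OF _ Im_Rg[of i]])
      qed
    qed
  qed
  have torus_eq: "h x = h y" if "torus x = torus y" for x y
  proof -
    have "\<forall>i. (x - y) $ i \<in> \<int>"
      using that by (simp add: torus_def vec_eq_iff char_e_eq_iff)
    then obtain \<alpha> where "x - y = vec_of_int \<alpha>"
      unfolding range_vec_of_int_iff[symmetric] by blast
    then have "x = y + vec_of_int \<alpha>" by (simp add: algebra_simps)
    then show ?thesis by (simp only: per)
  qed
  \<comment> \<open>The periodic \<open>h\<close> descends to the torus; by \<open>torus_eq\<close>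
    the chosen preimage does not matter.\<close>
  define H where "H z = h (SOME x. x \<in> ?Q \<and> torus x = z)" for z
  have H: "H (torus x) = h x" if "x \<in> ?Q" for x
  proof -
    have "(SOME y. y \<in> ?Q \<and> torus y = torus x) \<in> ?Q \<and> torus (SOME y. y \<in> ?Q \<and> torus y = torus x) = torus x"
      by (rule someI[of _ x]) (use that in simp)
    then show ?thesis unfolding H_def by (intro torus_eq) blast
  qed
  \<comment> \<open>Preimages of closed sets are images of compact sets under \<open>torus\<close>,
    hence closed; no local inverse of \<open>torus\<close> is required.\<close>
  have cont_H: "continuous_on T H"
    unfolding continuous_on_closed_vimage[OF compact_imp_closed[OF compact_T]]
  proof (intro allI impI)
    fix C :: "real set" assume "closed C"
    have "H -` C \<inter> T = torus ` (?Q \<inter> h -` C)"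
      by (auto simp: T_def H)
    moreover have "closed (h -` C)"
      using \<open>closed C\<close> cont by (rule closed_vimage)
    then have "compact (torus ` (?Q \<inter> h -` C))"
      using cont_torus by (intro compact_continuous_image compact_Int_closed) (auto intro: continuous_on_subset)
    ultimately show "closed (H -` C \<inter> T)"
      by (simp add: compact_imp_closed)
  qed
  have cont_Q: "continuous_on ?Q h"
    using cont continuous_on_subset by blast
  have one_U: "(\<lambda>_. 1) \<in> U"
    using orth by (simp add: U_def)
  have sq: "integral ?Q (\<lambda>x. h x * h x) = 0"
  proof (rule ccontr)
    assume ne: "integral ?Q (\<lambda>x. h x * h x) \<noteq> 0"
    have "integral ?Q (\<lambda>x. h x * h x) \<ge> 0"
      by (rule integral_nonneg) (auto intro!: integrable_continuous continuous_on_mult cont_Q)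
    with ne have pos: "integral ?Q (\<lambda>x. h x * h x) > 0" by simp
    let ?I = "integral ?Q (\<lambda>x. \<bar>h x\<bar>)"
    have I0: "?I \<ge> 0"
      by (rule integral_nonneg) (auto intro!: integrable_continuous continuous_intros cont_Q)
    \<comment> \<open>Since \<open>h\<close> is orthogonal to the approximant, the integral of
      \<open>h * h\<close> is at most \<open>e * ?I\<close>; this value of \<open>e\<close> makes
      that smaller than the integral itself. The added 1 gives a positive denominator.\<close>
    define e where "e = integral ?Q (\<lambda>x. h x * h x) / (?I + 1)"
    have "e > 0" using pos I0 by (simp add: e_def)
    then obtain p where p: "p \<in> Rg" "\<forall>z\<in>T. \<bar>H z - p z\<bar> < e"
      using SW.Stone_Weierstrass_basic[OF cont_H] by blast
    have cont_p: "continuous_on ?Q (\<lambda>x. p (torus x))"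
      using p(1) cont_torus unfolding Rg_def
      by (auto intro!: continuous_on_compose2[of UNIV p] intro: continuous_on_subset)
    have "\<forall>v\<in>U. (\<lambda>x. of_real (p (torus x)) * v x) \<in> U"
      using p(1) by (simp add: Rg_def)
    from bspec[OF this one_U] have "(\<lambda>x. of_real (p (torus x)) * 1) \<in> U" .
    then have "integral ?Q (\<lambda>x. of_real (h x) * (of_real (p (torus x)) * 1) * ?e 0 x) = 0"
      unfolding U_def by blast
    then have 0: "integral ?Q (\<lambda>x. complex_of_real (h x * p (torus x))) = 0"
      by simp
    have hp_int: "(\<lambda>x. h x * p (torus x)) integrable_on ?Q"
      by (intro integrable_continuous continuous_on_mult cont_Q cont_p)
    have "integral ?Q (Re \<circ> (\<lambda>x. complex_of_real (h x * p (torus x)))) = Re 0"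
      by (subst 0[symmetric], rule integral_linear)
         (intro integrable_continuous continuous_on_of_real continuous_on_mult cont_Q cont_p, rule bounded_linear_Re)
    then have hp: "integral ?Q (\<lambda>x. h x * p (torus x)) = 0"
      by (simp add: o_def)
    have "integral ?Q (\<lambda>x. h x * h x) = integral ?Q (\<lambda>x. h x * h x - h x * p (torus x))"
      using hp by (subst integral_diff) (auto intro!: integrable_continuous continuous_on_mult cont_Q cont_p)
    also have "\<dots> \<le> integral ?Q (\<lambda>x. e * \<bar>h x\<bar>)"
    proof (rule integral_le)
      fix x assume x: "x \<in> ?Q"
      then have "\<bar>h x - p (torus x)\<bar> < e"
        using p(2) H[OF x] by (auto simp: T_def)
      then have "\<bar>h x\<bar> * \<bar>h x - p (torus x)\<bar> \<le> \<bar>h x\<bar> * e"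
        by (intro mult_left_mono) auto
      then show "h x * h x - h x * p (torus x) \<le> e * \<bar>h x\<bar>"
        by (metis abs_ge_self abs_mult mult.commute order_trans right_diff_distrib)
    qed (auto intro!: integrable_continuous continuous_intros cont_Q cont_p)
    also have "\<dots> = e * ?I" by (rule integral_mult_right)
    also have "\<dots> < e * (?I + 1)" using \<open>e > 0\<close> by simp
    also have "\<dots> = integral ?Q (\<lambda>x. h x * h x)" using I0 by (simp add: e_def)
    finally show False by simp
  qed
  have "h x * h x = 0" if "x \<in> ?Q" for x
  proof -
    have "(\<chi> i. 1/2) \<in> box 0 (One :: real ^ 's)"
      by (simp add: mem_box_0_One_cart)
    then have "box 0 (One :: real ^ 's) \<noteq> {}" by blast
    then show ?thesis
      using sq that by (subst (asm) integral_cbox_eq_0_iff) (auto intro!: continuous_on_mult cont_Q)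
  qed
  moreover have "x - vec_of_int (vec_floor x) \<in> ?Q"
    by (auto simp: mem_box_0_One_cart; linarith)
  ultimately have "h (x - vec_of_int (vec_floor x)) = 0"
    by auto
  then show ?thesis
    using per[of "x - vec_of_int (vec_floor x)" "vec_floor x"] by simp
qed


section \<open>Periodization and its Fourier coefficients\<close>

lemma integral_lborel_shift:
  fixes g :: "'a::euclidean_space \<Rightarrow> 'b::{banach, second_countable_topology}"
  assumes "g \<in> borel_measurable borel"
  shows "integral\<^sup>L lborel (\<lambda>x. g (x + c)) = integral\<^sup>L lborel g"
proof -
  have "integral\<^sup>L (distr lborel borel ((+) c)) g = integral\<^sup>L lborel (\<lambda>x. g (c + x))"
    using assms by (intro integral_distr) auto
  then show ?thesis by (simp add: lborel_distr_plus add.commute)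
qed

context
  fixes f :: "real ^ 's \<Rightarrow> real" and r :: real
  assumes cont_f: "continuous_on UNIV f" and support: "\<forall>x. f x \<noteq> 0 \<longrightarrow> norm x \<le> r"
begin

definition periodization :: "real ^ 's \<Rightarrow> real" where
  "periodization x = (\<Sum>\<^sub>\<infinity>\<alpha>. f (x - vec_of_int \<alpha>))"

abbreviation shifts :: "real \<Rightarrow> (int ^ 's) set" where
  "shifts B \<equiv> {\<alpha>. norm (vec_of_int \<alpha> :: real ^ 's) \<le> r + B}"

lemma periodization_eq:
  assumes "norm x \<le> B"
  shows "periodization x = (\<Sum>\<alpha>\<in>shifts B. f (x - vec_of_int \<alpha>))"
proof -
  have "f (x - vec_of_int \<alpha>) = 0" if "\<alpha> \<notin> shifts B" for \<alpha>
  proof (rule ccontr)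
    assume "f (x - vec_of_int \<alpha>) \<noteq> 0"
    then have "norm (x - vec_of_int \<alpha>) \<le> r" using support by blast
    then show False
      using that assms norm_triangle_ineq2[of "vec_of_int \<alpha>" x] by (simp add: norm_minus_commute)
  qed
  then have "periodization x = (\<Sum>\<^sub>\<infinity>\<alpha>\<in>shifts B. f (x - vec_of_int \<alpha>))"
    unfolding periodization_def by (intro infsum_cong_neutral) auto
  then show ?thesis
    by (simp only: infsum_finite[OF finite_int_vec_bounded])
qed

lemma continuous_periodization: "continuous_on UNIV periodization"
proof (rule continuous_at_imp_continuous_on, rule ballI)
  fix x :: "real ^ 's"
  let ?B = "norm x + 1"
  have "continuous_on (ball 0 ?B) periodization"
  proof (rule continuous_on_eq)
    show "continuous_on (ball 0 ?B) (\<lambda>x. \<Sum>\<alpha>\<in>shifts ?B. f (x - vec_of_int \<alpha>))"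
      by (intro continuous_intros continuous_on_compose2[OF cont_f]) auto
  qed (simp add: periodization_eq[of _ ?B] less_imp_le)
  then show "isCont periodization x"
    by (rule continuous_on_interior) simp
qed

lemma periodization_add: "periodization (x + vec_of_int \<beta>) = periodization x"
proof -
  have "bij_betw (\<lambda>\<alpha>. \<alpha> + \<beta>) UNIV (UNIV :: (int ^ 's) set)"
    by (rule bij_betwI[of _ _ _ "\<lambda>\<alpha>. \<alpha> - \<beta>"]) auto
  from infsum_reindex_bij_betw[OF this, of "\<lambda>\<alpha>. f (x + vec_of_int \<beta> - vec_of_int \<alpha>)"]
  show ?thesis by (simp add: periodization_def algebra_simps)
qed

text \<open>Unfolding: integer translates of the cell tile space and leave the exponential
  unchanged, so the cell integrals of all shifts of \<open>f\<close> add up to one integral over the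
  whole space.\<close>

lemma integral_periodization:
  "integral (cbox 0 One) (\<lambda>x. of_real (periodization x) * char_e (- (x \<bullet> vec_of_int \<xi>)))
     = fourier f (vec_of_int \<xi>)"
proof -
  let ?e = "\<lambda>x. char_e (- (x \<bullet> vec_of_int \<xi>))"
  \<comment> \<open>The half-open cell tiles without overlap and differs from the closed cube
    \<open>?C\<close> only by a null set.\<close>
  let ?Q = "{x :: real ^ 's. vec_floor x = 0}"
  let ?C = "cbox 0 (One :: real ^ 's)"
  let ?L = "integral\<^sup>L lborel" and ?q = "indicat_real ?Q" and ?c = "indicat_real ?C"
  define g where "g = (\<lambda>x. of_real (f x) * ?e x)"
  \<comment> \<open>Points of the cell have norm at most \<open>CARD('s)\<close>, so on the cell
    every nonzero term of the periodization has its index in \<open>S\<close>.\<close>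
  define S where "S = shifts (CARD('s))"
  have finS: "finite S" unfolding S_def by (rule finite_int_vec_bounded)
  have cont_g: "continuous_on UNIV g"
    unfolding g_def by (intro continuous_intros cont_f)
  have g_meas: "g \<in> borel_measurable borel"
    by (rule borel_measurable_continuous_onI[OF cont_g])
  have Q_sets: "?Q \<in> sets borel"
    using measurable_sets[OF measurable_vec_floor, of "{0}"] by (simp add: vimage_def)
  have norm_Q: "norm x \<le> CARD('s)" if "x \<in> ?Q" for x
    using norm_diff_vec_floor_le[of x] that by simp
  have ind: "(\<Sum>\<alpha>\<in>S. ?q (x + vec_of_int \<alpha>) *\<^sub>R g x) = g x" for x
  proof (cases "f x = 0")
    case True
    then show ?thesis by (simp add: g_def)
  next
    case False
    have mem: "- vec_floor x \<in> S"
    proof -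
      have "norm (vec_of_int (vec_floor x) :: real ^ 's) \<le> norm x + norm (x - vec_of_int (vec_floor x))"
        using norm_triangle_ineq4[of x "x - vec_of_int (vec_floor x)"] by simp
      then show ?thesis
        using support[rule_format, OF False] norm_diff_vec_floor_le[of x] by (simp add: S_def)
    qed
    have "?q (x + vec_of_int \<alpha>) = (if \<alpha> = - vec_floor x then 1 else 0)" for \<alpha>
      by (auto simp: indicator_def eq_neg_iff_add_eq_0 add.commute)
    then have "(\<Sum>\<alpha>\<in>S. ?q (x + vec_of_int \<alpha>) *\<^sub>R g x)
       = (\<Sum>\<alpha>\<in>S. if \<alpha> = - vec_floor x then g x else 0)"
      by (intro sum.cong) auto
    then show ?thesis using mem finS by simp
  qed
  have int_C: "integrable lborel (\<lambda>x. indicator ?C x *\<^sub>R u x)"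
    if "continuous_on UNIV u" for u :: "real ^ 's \<Rightarrow> complex"
    using that by (intro borel_integrable_compact) (auto intro: continuous_on_subset)
  have QC: "AE x in lborel. ?q x = ?c x"
  proof (rule AE_I')
    have "emeasure lborel (?C - box 0 One) = 0"
      by (subst emeasure_Diff) (auto simp: box_subset_cbox emeasure_lborel_cbox emeasure_lborel_box)
    then show "?C - box 0 One \<in> null_sets lborel" by auto
    show "{x \<in> space lborel. ?q x \<noteq> ?c x} \<subseteq> ?C - box 0 One"
      by (auto simp: indicator_def mem_box_0_One_cart vec_eq_iff floor_eq_iff less_imp_le split: if_splits)
  qed
  have int_Q: "integrable lborel (\<lambda>x. ?q x *\<^sub>R u x)"
      "?L (\<lambda>x. ?q x *\<^sub>R u x) = integral ?C u"
    if "continuous_on UNIV u" for u :: "real ^ 's \<Rightarrow> complex"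
  proof -
    have u_meas: "u \<in> borel_measurable borel"
      by (rule borel_measurable_continuous_onI[OF that])
    have AE: "AE x in lborel. ?q x *\<^sub>R u x = ?c x *\<^sub>R u x"
      using QC by eventually_elim simp
    have m: "(\<lambda>x. ?q x *\<^sub>R u x) \<in> borel_measurable lborel"
      "(\<lambda>x. ?c x *\<^sub>R u x) \<in> borel_measurable lborel"
      using u_meas Q_sets by auto
    show "integrable lborel (\<lambda>x. ?q x *\<^sub>R u x)"
      using integrable_cong_AE[OF m AE] int_C[OF that] by simp
    have "?L (\<lambda>x. ?q x *\<^sub>R u x) = ?L (\<lambda>x. ?c x *\<^sub>R u x)"
      by (rule integral_cong_AE[OF m AE])
    also have "\<dots> = integral ?C u"
      using set_borel_integral_eq_integral(2)[of ?C u] int_C[OF that]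
      by (simp add: set_integrable_def set_lebesgue_integral_def)
    finally show "?L (\<lambda>x. ?q x *\<^sub>R u x) = integral ?C u" .
  qed
  have shift: "g (x - vec_of_int \<alpha>) = of_real (f (x - vec_of_int \<alpha>)) * ?e x" for x \<alpha>
  proof -
    have "char_e (- ((x - vec_of_int \<alpha>) \<bullet> vec_of_int \<xi>)) = ?e x"
      using inner_vec_of_int_Ints[of \<alpha> \<xi>] by (simp add: char_e_eq_iff inner_diff_left)
    then show ?thesis by (simp add: g_def)
  qed
  have cont_shift: "continuous_on UNIV (\<lambda>x. g (x - vec_of_int \<alpha>))" for \<alpha>
    by (intro continuous_on_compose2[OF cont_g] continuous_intros) auto
  have term_eq: "?L (\<lambda>x. ?q (x + vec_of_int \<alpha>) *\<^sub>R g x)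
      = ?L (\<lambda>x. ?q x *\<^sub>R g (x - vec_of_int \<alpha>))" for \<alpha>
  proof -
    have "(\<lambda>x. ?q x *\<^sub>R g (x - vec_of_int \<alpha>)) \<in> borel_measurable borel"
      using borel_measurable_continuous_onI[OF cont_shift] Q_sets by auto
    from integral_lborel_shift[OF this, of "vec_of_int \<alpha>"] show ?thesis by simp
  qed
  have term_int: "integrable lborel (\<lambda>x. ?q (x + vec_of_int \<alpha>) *\<^sub>R g x)" for \<alpha>
  proof -
    have "integrable (distr lborel borel ((+) (vec_of_int \<alpha>))) (\<lambda>x. ?q x *\<^sub>R g (x - vec_of_int \<alpha>))"
      unfolding lborel_distr_plus by (rule int_Q(1)[OF cont_shift])
    then have "integrable lborel (\<lambda>x. ?q (vec_of_int \<alpha> + x) *\<^sub>R g (vec_of_int \<alpha> + x - vec_of_int \<alpha>))"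
      using borel_measurable_continuous_onI[OF cont_shift] Q_sets by (subst (asm) integrable_distr_eq) auto
    then show ?thesis by (simp add: add.commute)
  qed
  have "fourier f (vec_of_int \<xi>) = ?L g"
    unfolding fourier_def g_def char_e_def by (simp add: mult_ac)
  also have "\<dots> = ?L (\<lambda>x. \<Sum>\<alpha>\<in>S. ?q (x + vec_of_int \<alpha>) *\<^sub>R g x)"
    by (simp only: ind)
  also have "\<dots> = (\<Sum>\<alpha>\<in>S. ?L (\<lambda>x. ?q (x + vec_of_int \<alpha>) *\<^sub>R g x))"
    by (rule Bochner_Integration.integral_sum) (rule term_int)
  also have "\<dots> = ?L (\<lambda>x. \<Sum>\<alpha>\<in>S. ?q x *\<^sub>R g (x - vec_of_int \<alpha>))"
    unfolding term_eq by (rule Bochner_Integration.integral_sum[symmetric]) (rule int_Q(1)[OF cont_shift])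
  also have "\<dots> = ?L (\<lambda>x. ?q x *\<^sub>R (of_real (periodization x) * ?e x))"
  proof (rule arg_cong[where f = ?L], rule ext)
    fix x
    show "(\<Sum>\<alpha>\<in>S. ?q x *\<^sub>R g (x - vec_of_int \<alpha>)) = ?q x *\<^sub>R (of_real (periodization x) * ?e x)"
    proof (cases "x \<in> ?Q")
      case True
      then have "periodization x = (\<Sum>\<alpha>\<in>S. f (x - vec_of_int \<alpha>))"
        unfolding S_def using norm_Q by (intro periodization_eq) blast
      then show ?thesis
        by (simp add: shift sum_distrib_right scaleR_sum_right)
    qed simp
  qed
  also have "\<dots> = integral ?C (\<lambda>x. of_real (periodization x) * ?e x)"
    by (intro int_Q(2) continuous_intros continuous_periodization)
  finally show ?thesis by simp
qed

end

lemma fourier_shift: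
  assumes cont_f: "continuous_on UNIV f"
  shows "fourier (\<lambda>x. f (x + y)) \<omega> = char_e (y \<bullet> \<omega>) * fourier f \<omega>"
proof -
  let ?g = "\<lambda>x. of_real (f x) * char_e (- ((x - y) \<bullet> \<omega>))"
  have "?g \<in> borel_measurable borel"
    by (intro borel_measurable_continuous_onI continuous_intros cont_f)
  from integral_lborel_shift[OF this, of y]
  have "fourier (\<lambda>x. f (x + y)) \<omega> = integral\<^sup>L lborel ?g"
    by (simp add: fourier_def char_e_def mult_ac)
  also have "?g = (\<lambda>x. char_e (y \<bullet> \<omega>) * (of_real (f x) * char_e (- (x \<bullet> \<omega>))))"
  proof
    fix x
    have "char_e (- ((x - y) \<bullet> \<omega>)) = char_e (y \<bullet> \<omega>) * char_e (- (x \<bullet> \<omega>))"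
      by (simp add: inner_diff_left flip: char_e_add)
    then show "?g x = char_e (y \<bullet> \<omega>) * (of_real (f x) * char_e (- (x \<bullet> \<omega>)))"
      by (simp only: mult_ac)
  qed
  also have "integral\<^sup>L lborel \<dots> = char_e (y \<bullet> \<omega>) * fourier f \<omega>"
    by (simp only: integral_mult_right_zero fourier_def char_e_def) (simp add: mult_ac)
  finally show ?thesis .
qed

text \<open>Shifting \<open>f\<close> multiplies each Fourier coefficient by a character value. At
  nonzero integer frequencies both sides are 0 and at frequency 0 the factor is 1, so the
  periodization equals all its translates. It is therefore constant, with mean
  \<open>fourier f 0\<close>.\<close>

theorem partition_of_unity:
  fixes f :: "real ^ 's \<Rightarrow> real"
  assumes f: "continuous_test_function f"
  shows "(\<Sum>\<^sub>\<infinity>\<alpha>. f (x - vec_of_int \<alpha>)) = 1"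
proof -
  let ?Q = "cbox 0 (One :: real ^ 's)"
  have cont: "continuous_on UNIV f" and comp: "compact (closure {x. f x \<noteq> 0})"
    and f0: "fourier f 0 = 1" and f\<alpha>: "\<And>\<alpha>. \<alpha> \<noteq> 0 \<Longrightarrow> fourier f (vec_of_int \<alpha>) = 0"
    using f unfolding continuous_test_function_def by blast+
  obtain r where r: "\<forall>x. f x \<noteq> 0 \<longrightarrow> norm x \<le> r"
  proof -
    have "bounded {x. f x \<noteq> 0}"
      using compact_imp_bounded[OF comp] closure_subset bounded_subset by blast
    then show ?thesis using that unfolding bounded_iff by blast
  qed
  let ?P = "periodization f"
  have const: "?P (x + y) = ?P x" for x y
  proof -
    let ?f = "\<lambda>x. f (x + y)"
    have cont': "continuous_on UNIV ?f"
      by (intro continuous_on_compose2[OF cont] continuous_intros) auto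
    have r': "\<forall>x. ?f x \<noteq> 0 \<longrightarrow> norm x \<le> r + norm y"
    proof (intro allI impI)
      fix x assume "?f x \<noteq> 0"
      then have "norm (x + y) \<le> r" using r by blast
      then show "norm x \<le> r + norm y" using norm_triangle_ineq4[of "x + y" y] by simp
    qed
    have P': "periodization ?f = (\<lambda>x. ?P (x + y))"
      by (simp add: periodization_def[OF cont r] periodization_def[OF cont' r'] fun_eq_iff algebra_simps)
    have cP: "continuous_on UNIV ?P" "continuous_on UNIV (\<lambda>x. ?P (x + y))"
      using continuous_periodization[OF cont r] continuous_periodization[OF cont' r'] by (simp_all add: P')
    have "?P (x + y) - ?P x = 0" for x
    proof (rule fourier_uniqueness)
      show "continuous_on UNIV (\<lambda>x. ?P (x + y) - ?P x)"
        by (intro continuous_on_diff cP)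
      show "?P (x + vec_of_int \<alpha> + y) - ?P (x + vec_of_int \<alpha>) = ?P (x + y) - ?P x" for x \<alpha>
        using periodization_add[OF cont r, of x \<alpha>] periodization_add[OF cont r, of "x + y" \<alpha>]
        by (simp add: add_ac)
      show "integral ?Q (\<lambda>x. of_real (?P (x + y) - ?P x) * char_e (- (x \<bullet> vec_of_int \<xi>))) = 0" for \<xi>
      proof -
        have "integral ?Q (\<lambda>x. of_real (?P (x + y) - ?P x) * char_e (- (x \<bullet> vec_of_int \<xi>)))
            = integral ?Q (\<lambda>x. of_real (?P (x + y)) * char_e (- (x \<bullet> vec_of_int \<xi>)))
              - integral ?Q (\<lambda>x. of_real (?P x) * char_e (- (x \<bullet> vec_of_int \<xi>)))"
          unfolding of_real_diff left_diff_distrib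
          by (intro integral_diff integrable_continuous continuous_intros continuous_on_subset[OF cP(1)] continuous_on_subset[OF cP(2)]) auto
        also have "\<dots> = fourier ?f (vec_of_int \<xi>) - fourier f (vec_of_int \<xi>)"
          using integral_periodization[OF cont r, of \<xi>] integral_periodization[OF cont' r', of \<xi>]
          by (simp add: P')
        also have "\<dots> = 0"
          using f\<alpha>[of \<xi>] by (cases "\<xi> = 0") (simp_all add: fourier_shift[OF cont])
        finally show ?thesis .
      qed
    qed
    then show ?thesis by simp
  qed
  have "?P y = ?P x" for y
    using const[of x "y - x"] by simp
  then have "(\<lambda>y. complex_of_real (?P y)) = (\<lambda>_. complex_of_real (?P x))"
    by (intro ext arg_cong[where f = complex_of_real])
  moreover have "integral ?Q (\<lambda>y. complex_of_real (?P y)) = 1"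
    using integral_periodization[OF cont r, of 0] f0 by simp
  ultimately have "integral ?Q (\<lambda>_. complex_of_real (?P x)) = 1"
    by (simp only:)
  then have "complex_of_real (?P x) = 1"
    by simp
  then have "?P x = 1" by simp
  then show ?thesis
    by (simp add: periodization_def[OF cont r])
qed

section \<open>Joint spectral radius\<close>

text \<open>The limit is the infimum of the quotients, finite by nonnegativity; large
  \<open>n\<close> are compared with a nearly optimal \<open>m\<close> by division with
  remainder.\<close>

lemma fekete_nonneg:
  fixes x :: "nat \<Rightarrow> real"
  assumes nonneg: "\<And>n. n \<ge> 1 \<Longrightarrow> 0 \<le> x n"
    and sub: "\<And>m n. m \<ge> 1 \<Longrightarrow> n \<ge> 1 \<Longrightarrow> x (m + n) \<le> x m + x n"
  shows "\<exists>L\<ge>0. (\<lambda>n. x n / n) \<longlonglongrightarrow> L"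
proof -
  define L where "L = (INF n\<in>{1..}. x n / n)"
  have bdd: "bdd_below ((\<lambda>n. x n / n) ` {1..})"
    using nonneg by (intro bdd_belowI[of _ 0]) auto
  have L_le: "L \<le> x n / n" if "n \<ge> 1" for n
    unfolding L_def using bdd that by (intro cINF_lower) auto
  have L0: "0 \<le> L"
    unfolding L_def using nonneg by (intro cINF_greatest) auto
  have "(\<lambda>n. x n / n) \<longlonglongrightarrow> L"
  proof (rule LIMSEQ_I)
    fix e :: real assume "0 < e"
    then obtain m where m: "m \<ge> 1" "x m / m < L + e / 2"
      using cINF_less_iff[OF _ bdd, of "L + e / 2"] unfolding L_def[symmetric] by auto
    define C where "C = (\<Sum>r\<le>m. \<bar>x r\<bar>)"
    have C: "x r \<le> C" if "r \<le> m" for r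
      using member_le_sum[of r "{..m}" "\<lambda>r. \<bar>x r\<bar>"] that unfolding C_def by auto
    have iter: "x (k * m + r) \<le> k * x m + x r" if "r \<ge> 1" for k r
    proof (induction k)
      case (Suc k)
      have "x (Suc k * m + r) = x (m + (k * m + r))" by (simp add: algebra_simps)
      also have "\<dots> \<le> x m + x (k * m + r)" using m that by (intro sub) auto
      finally show ?case using Suc by (simp add: algebra_simps)
    qed simp
    have bound: "x n / n \<le> x m / m + C / n" if "n \<ge> 1" for n
    proof -
      \<comment> \<open>The remainder runs through 1..m instead of 0..m-1, because subadditivity is
        available for positive indices only.\<close>
      define k where "k = (n - 1) div m"
      define r where "r = (n - 1) mod m + 1"
      have n: "n = k * m + r" using that by (simp add: k_def r_def)
      have r: "1 \<le> r" "r \<le> m" using m by (auto simp: r_def Suc_le_eq)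
      have "x n \<le> k * x m + x r"
        unfolding n by (rule iter[OF r(1)])
      also have "\<dots> \<le> k * x m + C"
        using C[OF r(2)] by simp
      also have "k * x m \<le> n * (x m / m)"
      proof -
        have "real k * x m = (k * m) * (x m / m)" using m by simp
        also have "\<dots> \<le> n * (x m / m)"
          using nonneg[OF m(1)] n by (intro mult_right_mono) auto
        finally show ?thesis .
      qed
      finally have "x n / n \<le> (n * (x m / m) + C) / n"
        using that by (intro divide_right_mono) auto
      then show ?thesis using that by (simp add: add_divide_distrib)
    qed
    obtain N :: nat where N: "N \<ge> 1" "C / N < e / 2"
    proof -
      obtain N where "C / (e / 2) < real N" using reals_Archimedean2 by blast
      then have "C < (e / 2) * Suc N" using \<open>0 < e\<close> by (simp add: field_simps)
      then have "C / Suc N < e / 2" by (simp add: field_simps)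
      then show ?thesis using that[of "Suc N"] by simp
    qed
    have "norm (x n / n - L) < e" if "n \<ge> N" for n
    proof -
      have "n \<ge> 1" using that N by simp
      have "0 \<le> C" unfolding C_def by (intro sum_nonneg) auto
      then have "C / n \<le> C / N" using that N by (intro divide_left_mono) auto
      then show ?thesis
        using bound[OF \<open>n \<ge> 1\<close>] L_le[OF \<open>n \<ge> 1\<close>] m(2) N(2) by (simp only: real_norm_def abs_less_iff) linarith
    qed
    then show "\<exists>no. \<forall>n\<ge>no. norm (x n / n - L) < e" by blast
  qed
  with L0 show ?thesis by blast
qed

section \<open>Norms of products of operators\<close>

lemma L2_set_scale: "L2_set (\<lambda>i. c * v i) K = \<bar>c\<bar> * L2_set v K"
  unfolding L2_set_def power_mult_distrib sum_distrib_left[symmetric] real_sqrt_mult by simp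

lemma L2_set_zero: "L2_set (\<lambda>_. 0) K = 0"
  by (simp add: L2_set_def)

text \<open>The product from \<open>joint_spectral_radius\<close>; the last element of the list acts
  first.\<close>

definition word_op :: "('a \<Rightarrow> 'a) list \<Rightarrow> 'a \<Rightarrow> 'a" where
  "word_op Ts = foldr (\<circ>) Ts id"

lemma word_op_simps [simp]: "word_op [] = id" "word_op (T # Ts) = T \<circ> word_op Ts"
  by (simp_all add: word_op_def)

lemma word_op_append: "word_op (Ts @ Us) = word_op Ts \<circ> word_op Us"
  by (induction Ts) auto

text \<open>The common bound \<open>C\<close> ensures that the suprema over the unit ball and over
  words are taken of bounded sets; homogeneity extends estimates from the unit ball to all of
  \<open>V\<close>.\<close>

locale bounded_operator_family =
  fixes K :: "'i set" and V :: "('i \<Rightarrow> real) set" and Ms :: "(('i \<Rightarrow> real) \<Rightarrow> 'i \<Rightarrow> real) set" and C :: real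
  assumes zero_V: "(\<lambda>_. 0) \<in> V"
    and scale_V: "v \<in> V \<Longrightarrow> (\<lambda>i. c * v i) \<in> V"
    and V_invariant: "T \<in> Ms \<Longrightarrow> v \<in> V \<Longrightarrow> T v \<in> V"
    and homogeneous: "T \<in> Ms \<Longrightarrow> v \<in> V \<Longrightarrow> T (\<lambda>i. c * v i) = (\<lambda>i. c * T v i)"
    and bound: "T \<in> Ms \<Longrightarrow> v \<in> V \<Longrightarrow> L2_set (T v) K \<le> C * L2_set v K"
    and C_nonneg: "0 \<le> C"
    and nonempty: "Ms \<noteq> {}"
begin

lemma word_V: "set Ts \<subseteq> Ms \<Longrightarrow> v \<in> V \<Longrightarrow> word_op Ts v \<in> V"
  by (induction Ts) (auto intro: V_invariant)

lemma word_homogeneous: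
  "set Ts \<subseteq> Ms \<Longrightarrow> v \<in> V \<Longrightarrow> word_op Ts (\<lambda>i. c * v i) = (\<lambda>i. c * word_op Ts v i)"
  by (induction Ts) (auto simp: homogeneous word_V)

lemma word_bound: "set Ts \<subseteq> Ms \<Longrightarrow> v \<in> V \<Longrightarrow> L2_set (word_op Ts v) K \<le> C ^ length Ts * L2_set v K"
proof (induction Ts)
  case (Cons T Ts)
  have "L2_set (word_op (T # Ts) v) K \<le> C * L2_set (word_op Ts v) K"
    using Cons by (auto intro!: bound word_V)
  also have "\<dots> \<le> C * (C ^ length Ts * L2_set v K)"
    using Cons C_nonneg by (intro mult_left_mono) auto
  finally show ?case by (simp add: mult.assoc)
qed simp

abbreviation word_norm where "word_norm Ts \<equiv> restricted_onorm K V (word_op Ts)"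

lemma word_norm_bdd:
  assumes "set Ts \<subseteq> Ms"
  shows "bdd_above ((\<lambda>v. L2_set (word_op Ts v) K) ` {v \<in> V. L2_set v K \<le> 1})"
proof (rule bdd_aboveI[of _ "C ^ length Ts"])
  fix y assume "y \<in> (\<lambda>v. L2_set (word_op Ts v) K) ` {v \<in> V. L2_set v K \<le> 1}"
  then obtain v where "v \<in> V" "L2_set v K \<le> 1" "y = L2_set (word_op Ts v) K" by blast
  moreover from this have "C ^ length Ts * L2_set v K \<le> C ^ length Ts * 1"
    using C_nonneg by (intro mult_left_mono) auto
  ultimately show "y \<le> C ^ length Ts"
    using word_bound[OF assms] by fastforce
qed

lemma word_norm_upper:
  assumes "set Ts \<subseteq> Ms" "v \<in> V" "L2_set v K \<le> 1"
  shows "L2_set (word_op Ts v) K \<le> word_norm Ts"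
  unfolding restricted_onorm_def using assms by (intro cSUP_upper word_norm_bdd) auto

lemma word_norm_nonneg: "set Ts \<subseteq> Ms \<Longrightarrow> 0 \<le> word_norm Ts"
  using order_trans[OF L2_set_nonneg word_norm_upper[OF _ zero_V]] by (simp add: L2_set_zero)

lemma word_norm_le:
  assumes "\<And>v. v \<in> V \<Longrightarrow> L2_set v K \<le> 1 \<Longrightarrow> L2_set (word_op Ts v) K \<le> B"
  shows "word_norm Ts \<le> B"
  unfolding restricted_onorm_def using assms zero_V by (intro cSUP_least) (auto simp: L2_set_zero)

lemma word_norm_mult:
  assumes "set Ts \<subseteq> Ms" "v \<in> V"
  shows "L2_set (word_op Ts v) K \<le> word_norm Ts * L2_set v K"
proof (cases "L2_set v K = 0")
  case True
  then show ?thesis using word_bound[OF assms] by simp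
next
  case False
  let ?l = "L2_set v K"
  have l: "?l > 0" using False L2_set_nonneg[of v K] by linarith
  have "L2_set (word_op Ts (\<lambda>i. inverse ?l * v i)) K \<le> word_norm Ts"
    using assms l by (intro word_norm_upper scale_V) (auto simp: L2_set_scale)
  then have "inverse ?l * L2_set (word_op Ts v) K \<le> word_norm Ts"
    using assms l by (simp add: word_homogeneous L2_set_scale)
  then show ?thesis using l by (simp add: field_simps)
qed

definition words :: "nat \<Rightarrow> (('i \<Rightarrow> real) \<Rightarrow> 'i \<Rightarrow> real) list set" where
  "words n = {Ts. length Ts = n \<and> set Ts \<subseteq> Ms}"

definition max_norm :: "nat \<Rightarrow> real" where
  "max_norm n = (SUP Ts\<in>words n. word_norm Ts)"

lemma words_nonempty: "words n \<noteq> {}"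
proof -
  obtain T where "T \<in> Ms" using nonempty by blast
  then have "replicate n T \<in> words n" by (auto simp: words_def)
  then show ?thesis by blast
qed

lemma word_norm_le_max:
  assumes "Ts \<in> words n"
  shows "word_norm Ts \<le> max_norm n"
  unfolding max_norm_def
proof (rule cSUP_upper[OF assms], rule bdd_aboveI[of _ "C ^ n"])
  fix y assume "y \<in> (\<lambda>Ts. word_norm Ts) ` words n"
  then obtain Us where Us: "Us \<in> words n" "y = word_norm Us" by blast
  have "word_norm Us \<le> C ^ n"
  proof (rule word_norm_le)
    fix v assume "v \<in> V" "L2_set v K \<le> 1"
    moreover from this have "C ^ n * L2_set v K \<le> C ^ n * 1"
      using C_nonneg by (intro mult_left_mono) auto
    ultimately show "L2_set (word_op Us v) K \<le> C ^ n"
      using word_bound[of Us v] Us by (auto simp: words_def)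
  qed
  with Us show "y \<le> C ^ n" by simp
qed

lemma max_norm_add: "max_norm (m + n) \<le> max_norm m * max_norm n"
  unfolding max_norm_def[of "m + n"]
proof (rule cSUP_least[OF words_nonempty])
  fix Ts assume Ts: "Ts \<in> words (m + n)"
  define Us Ws where "Us = take m Ts" and "Ws = drop m Ts"
  have TU: "Ts = Us @ Ws" by (simp add: Us_def Ws_def)
  have Us: "Us \<in> words m" and Ws: "Ws \<in> words n"
    using Ts set_take_subset[of m Ts] set_drop_subset[of m Ts] by (auto simp: words_def Us_def Ws_def)
  have sets: "set Us \<subseteq> Ms" "set Ws \<subseteq> Ms" using Us Ws by (auto simp: words_def)
  show "word_norm Ts \<le> max_norm m * max_norm n"
  proof (rule word_norm_le)
    fix v assume v: "v \<in> V" "L2_set v K \<le> 1"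
    have "L2_set (word_op Ts v) K \<le> word_norm Us * L2_set (word_op Ws v) K"
      unfolding TU word_op_append o_apply using sets v by (intro word_norm_mult word_V)
    also have "\<dots> \<le> max_norm m * max_norm n"
    proof (rule mult_mono)
      show "word_norm Us \<le> max_norm m" by (rule word_norm_le_max[OF Us])
      show "L2_set (word_op Ws v) K \<le> max_norm n"
        using word_norm_upper[OF sets(2) v] word_norm_le_max[OF Ws] by simp
      show "0 \<le> max_norm m"
        using word_norm_le_max[OF Us] word_norm_nonneg[OF sets(1)] by simp
    qed (rule L2_set_nonneg)
    finally show "L2_set (word_op Ts v) K \<le> max_norm m * max_norm n" .
  qed
qed

lemma joint_spectral_radius_eq: "joint_spectral_radius K V Ms = lim (\<lambda>n. root n (max_norm n))"
  by (simp add: joint_spectral_radius_def max_norm_def words_def word_op_def)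

text \<open>If every \<open>max_norm n\<close> is at least 1, then Fekete's lemma for \<open>ln (max_norm n)\<close> shows that the limit
  defining the joint spectral radius exists and is at least 1.\<close>

theorem contracting_word_length:
  assumes "joint_spectral_radius K V Ms < 1"
  shows "\<exists>n q. n \<ge> 1 \<and> 0 \<le> q \<and> q < 1 \<and>
    (\<forall>Ts v. length Ts = n \<longrightarrow> set Ts \<subseteq> Ms \<longrightarrow> v \<in> V \<longrightarrow> L2_set (word_op Ts v) K \<le> q * L2_set v K)"
proof -
  have "\<exists>n\<ge>1. max_norm n < 1"
  proof (rule ccontr)
    assume "\<not> ?thesis"
    then have ge: "max_norm n \<ge> 1" if "n \<ge> 1" for n using that by force
    have "\<exists>L\<ge>0. (\<lambda>n. ln (max_norm n) / n) \<longlonglongrightarrow> L"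
    proof (rule fekete_nonneg)
      fix m n :: nat assume mn: "m \<ge> 1" "n \<ge> 1"
      have "0 < max_norm m" "0 < max_norm n" "0 < max_norm (m + n)"
        using ge[of m] ge[of n] ge[of "m + n"] mn by linarith+
      then show "ln (max_norm (m + n)) \<le> ln (max_norm m) + ln (max_norm n)"
        using max_norm_add[of m n] by (simp flip: ln_mult_pos)
    qed (simp add: ge)
    then obtain L where L: "L \<ge> 0" "(\<lambda>n. ln (max_norm n) / n) \<longlonglongrightarrow> L" by blast
    have "(\<lambda>n. exp (ln (max_norm n) / n)) \<longlonglongrightarrow> exp L"
      by (intro tendsto_exp L)
    moreover have "\<forall>\<^sub>F n in sequentially. exp (ln (max_norm n) / n) = root n (max_norm n)"
    proof (rule eventually_sequentiallyI[of 1])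
      fix n :: nat assume n: "1 \<le> n"
      then have "0 < max_norm n" using ge[of n] by linarith
      then show "exp (ln (max_norm n) / n) = root n (max_norm n)"
        using n by (simp add: root_powr_inverse powr_def)
    qed
    ultimately have "(\<lambda>n. root n (max_norm n)) \<longlonglongrightarrow> exp L"
      by (rule Lim_transform_eventually)
    then have "joint_spectral_radius K V Ms = exp L"
      unfolding joint_spectral_radius_eq by (rule limI)
    then show False using assms L(1) by simp
  qed
  then obtain n where n: "n \<ge> 1" "max_norm n < 1" by blast
  have bound: "L2_set (word_op Ts v) K \<le> max_norm n * L2_set v K"
    if "length Ts = n" "set Ts \<subseteq> Ms" "v \<in> V" for Ts v
  proof -
    have "Ts \<in> words n" using that by (simp add: words_def)
    have "L2_set (word_op Ts v) K \<le> word_norm Ts * L2_set v K"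
      by (rule word_norm_mult) (use that in auto)
    also have "\<dots> \<le> max_norm n * L2_set v K"
      by (intro mult_right_mono word_norm_le_max[OF \<open>Ts \<in> words n\<close>] L2_set_nonneg)
    finally show ?thesis .
  qed
  obtain Ts where "Ts \<in> words n" using words_nonempty by blast
  then have "0 \<le> max_norm n"
    using word_norm_le_max word_norm_nonneg by (fastforce simp: words_def)
  with n bound show ?thesis by blast
qed

end

section \<open>The index set of the transition matrices\<close>

locale dilation_residues = dilation M for M :: "int ^ 's ^ 's" +
  fixes N :: nat and E :: "(int ^ 's) set"
  assumes residues: "complete_residues M E"
begin

abbreviation mask_box where "mask_box \<equiv> int_box 0 (int N) :: (int ^ 's) set"

lemma finite_E: "finite E"
  using card_complete_residues(1)[OF residues invertible_R] .

lemma E_nonempty: "E \<noteq> {}"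
  using residues unfolding complete_residues_def by blast

lemma residue_decomposition:
  obtains \<epsilon> q where "\<epsilon> \<in> E" "p = \<epsilon> + M *v q"
proof -
  obtain \<epsilon> where "\<epsilon> \<in> E" "p - \<epsilon> \<in> range ((*v) M)"
    using residues unfolding complete_residues_def by meson
  then obtain q where "p - \<epsilon> = M *v q" by blast
  then have "p = \<epsilon> + M *v q" by (simp add: algebra_simps)
  then show ?thesis using that \<open>\<epsilon> \<in> E\<close> by blast
qed

text \<open>The indices to which one transition step can carry a support \<open>X\<close>, over all
  digits in \<open>E\<close> and all masks supported in the box.\<close>

definition successors :: "(int ^ 's) set \<Rightarrow> (int ^ 's) set" where
  "successors X = {\<alpha>. \<exists>\<beta>\<in>X. \<exists>\<epsilon>\<in>E. \<epsilon> + M *v \<alpha> - \<beta> \<in> mask_box}"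

lemma successors_mono: "X \<subseteq> Y \<Longrightarrow> successors X \<subseteq> successors Y"
  by (auto simp: successors_def)

lemma successorsE:
  assumes "\<alpha> \<in> successors X"
  obtains \<beta> \<epsilon> \<gamma> where "\<beta> \<in> X" "\<epsilon> \<in> E" "\<gamma> \<in> mask_box" "vec_of_int \<alpha> = A *v (vec_of_int \<beta> + vec_of_int (\<gamma> - \<epsilon>))"
proof -
  from assms obtain \<beta> \<epsilon> where *: "\<beta> \<in> X" "\<epsilon> \<in> E" "\<epsilon> + M *v \<alpha> - \<beta> \<in> mask_box"
    by (auto simp: successors_def)
  define \<gamma> where "\<gamma> = \<epsilon> + M *v \<alpha> - \<beta>"
  have "M *v \<alpha> = \<beta> + (\<gamma> - \<epsilon>)" by (simp add: \<gamma>_def)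
  then have "R *v vec_of_int \<alpha> = (vec_of_int \<beta> + vec_of_int (\<gamma> - \<epsilon>))"
    by (simp only: map_matrix_of_int_mult vec_of_int_simps(2))
  then have "vec_of_int \<alpha> = A *v (vec_of_int \<beta> + vec_of_int (\<gamma> - \<epsilon>))"
    by (metis A_R)
  then show ?thesis using that * \<gamma>_def by blast
qed

text \<open>A successor is \<open>A\<close> applied to a point displaced by one of finitely many
  vectors, so a large ball of \<open>anorm\<close> is invariant by
  \<open>anorm_contraction\<close>.\<close>

lemma ex_large_invariant_set:
  assumes "finite X"
  obtains F where "finite F" "X \<subseteq> F" "successors F \<subseteq> F"
    "\<And>\<beta>. norm (vec_of_int \<beta> :: real ^ 's) \<le> r \<Longrightarrow> \<beta> \<in> F"
proof -
  let ?v = "vec_of_int :: int ^ 's \<Rightarrow> real ^ 's"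
  define D where "D = (\<Sum>\<gamma>\<in>mask_box. \<Sum>\<epsilon>\<in>E. norm (?v (\<gamma> - \<epsilon>)))"
  have D: "norm (?v (\<gamma> - \<epsilon>)) \<le> D" if "\<gamma> \<in> mask_box" "\<epsilon> \<in> E" for \<gamma> \<epsilon>
  proof -
    have "norm (?v (\<gamma> - \<epsilon>)) \<le> (\<Sum>\<epsilon>\<in>E. norm (?v (\<gamma> - \<epsilon>)))"
      using that finite_E by (intro member_le_sum) auto
    also have "\<dots> \<le> D"
      unfolding D_def using that by (intro member_le_sum[of \<gamma> mask_box "\<lambda>\<gamma>. \<Sum>\<epsilon>\<in>E. norm (?v (\<gamma> - \<epsilon>))"]) (auto intro: sum_nonneg)
    finally show ?thesis .
  qed
  \<comment> \<open>The three summands serve, in order, invariance, the inclusion of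
    \<open>X\<close>, and the inclusion of the Euclidean ball of radius \<open>r\<close>, which may
    be negative.\<close>
  define \<rho> where "\<rho> = anorm_const ^ 2 * D + (\<Sum>x\<in>X. anorm (?v x)) + anorm_const * \<bar>r\<bar>"
  define F where "F = {\<beta>. anorm (?v \<beta>) \<le> \<rho>}"
  have D0: "0 \<le> D" unfolding D_def by (intro sum_nonneg) auto
  have S0: "0 \<le> (\<Sum>x\<in>X. anorm (?v x))" by (intro sum_nonneg anorm_nonneg)
  have C1: "1 \<le> anorm_const" by (rule anorm_const_ge_1)
  have C0: "0 \<le> anorm_const * \<bar>r\<bar>" "0 \<le> anorm_const ^ 2 * D" using C1 D0 by auto
  have "F \<subseteq> {\<beta>. norm (?v \<beta>) \<le> \<rho>}"
    unfolding F_def using norm_le_anorm order_trans by blast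
  then have "finite F"
    using finite_int_vec_bounded finite_subset by blast
  moreover have "X \<subseteq> F"
  proof
    fix x assume "x \<in> X"
    then have "anorm (?v x) \<le> (\<Sum>x\<in>X. anorm (?v x))"
      using assms anorm_nonneg by (intro member_le_sum[of x X "\<lambda>x. anorm (?v x)"]) auto
    then show "x \<in> F" using C0 by (simp add: F_def \<rho>_def)
  qed
  moreover have "successors F \<subseteq> F"
  proof
    fix \<alpha> assume "\<alpha> \<in> successors F"
    then obtain \<beta> \<epsilon> \<gamma> where *: "\<beta> \<in> F" "\<epsilon> \<in> E" "\<gamma> \<in> mask_box" "?v \<alpha> = A *v (?v \<beta> + ?v (\<gamma> - \<epsilon>))"
      by (rule successorsE)
    have "anorm (A *v (?v \<beta> + ?v (\<gamma> - \<epsilon>))) \<le> \<rho>"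
    proof (rule anorm_contraction[OF D])
      show "anorm_const\<^sup>2 * D \<le> \<rho>" using S0 C0 by (simp add: \<rho>_def)
      show "anorm (?v \<beta>) \<le> \<rho>" using * by (simp add: F_def)
    qed (use * in auto)
    then show "\<alpha> \<in> F" using *(4) by (simp add: F_def)
  qed
  moreover have "\<beta> \<in> F" if "norm (?v \<beta>) \<le> r" for \<beta>
  proof -
    have "anorm (?v \<beta>) \<le> anorm_const * \<bar>r\<bar>"
      using anorm_le[of "?v \<beta>"] C1 that by (meson abs_ge_self mult_left_mono order_trans zero_le_one)
    then show ?thesis using S0 C0 by (simp add: F_def \<rho>_def)
  qed
  ultimately show ?thesis using that by blast
qed

abbreviation K where "K \<equiv> index_set M N E"

lemma index_setE:
  assumes "\<kappa> \<in> K"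
  obtains g where "range g \<subseteq> digit_set N E" "(\<lambda>r. ((*v) A ^^ Suc r) (vec_of_int (g r))) sums vec_of_int \<kappa>"
proof -
  from assms have "\<exists>g. range g \<subseteq> digit_set N E \<and> (\<lambda>r. ((*v) A ^^ Suc r) (vec_of_int (g r))) sums vec_of_int \<kappa>"
    unfolding index_set_def by (rule CollectD)
  then show thesis by (elim exE conjE) (rule that)
qed

lemma digit_mem: "\<gamma> \<in> mask_box \<Longrightarrow> \<epsilon> \<in> E \<Longrightarrow> \<gamma> - \<epsilon> \<in> digit_set N E"
  unfolding digit_set_def
  by (rule CollectI, rule exI[of _ \<gamma>], rule exI[of _ \<epsilon>], rule exI[of _ 0]) (auto simp: int_box_def)

lemma finite_digit_set: "finite (digit_set N E)"
proof -
  have "digit_set N E = (\<lambda>(\<gamma>, \<epsilon>, \<theta>). \<gamma> - \<epsilon> + \<theta>) ` (mask_box \<times> E \<times> int_box (-1) 1)"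
    by (auto simp: digit_set_def image_iff) blast+
  then show ?thesis using finite_E by simp
qed

text \<open>Every digit series is dominated by the sum, over the finitely many digits, of their
  summable orbits, so \<open>K\<close> is bounded.\<close>

lemma finite_index_set: "finite K"
proof -
  let ?b = "\<lambda>r. \<Sum>d\<in>digit_set N E. norm (((*v) A ^^ Suc r) (vec_of_int d))"
  have sb: "summable ?b"
    using summable_orbit by (intro summable_sum) (subst summable_Suc_iff)
  have "norm (vec_of_int \<kappa> :: real ^ 's) \<le> suminf ?b" if \<kappa>: "\<kappa> \<in> K" for \<kappa>
  proof -
    obtain g where g: "range g \<subseteq> digit_set N E"
      and sums: "(\<lambda>r. ((*v) A ^^ Suc r) (vec_of_int (g r))) sums vec_of_int \<kappa>"
      using \<kappa> by (rule index_setE)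
    have le: "norm (((*v) A ^^ Suc r) (vec_of_int (g r))) \<le> ?b r" for r
      using g finite_digit_set
      by (intro member_le_sum[of "g r" _ "\<lambda>d. norm (((*v) A ^^ Suc r) (vec_of_int d))"]) auto
    have "summable (\<lambda>r. norm (((*v) A ^^ Suc r) (vec_of_int (g r))))"
      using le by (intro summable_comparison_test'[OF sb, of 0]) simp
    then have "norm (\<Sum>r. ((*v) A ^^ Suc r) (vec_of_int (g r))) \<le> suminf ?b"
      using le sb by (intro order_trans[OF summable_norm] suminf_le)
    then show ?thesis using sums_unique[OF sums] by (simp only:)
  qed
  then have "K \<subseteq> {\<kappa>. norm (vec_of_int \<kappa> :: real ^ 's) \<le> suminf ?b}" by blast
  then show ?thesis using finite_int_vec_bounded finite_subset by blast
qed

text \<open>Passing to a successor prepends the digit \<open>\<gamma> - \<epsilon>\<close> to a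
  digit expansion.\<close>

lemma index_set_successors: "successors K \<subseteq> K"
proof
  fix \<alpha> assume "\<alpha> \<in> successors K"
  then obtain \<beta> \<epsilon> \<gamma> where *: "\<beta> \<in> K" "\<epsilon> \<in> E" "\<gamma> \<in> mask_box"
    "vec_of_int \<alpha> = A *v (vec_of_int \<beta> + vec_of_int (\<gamma> - \<epsilon>))"
    by (rule successorsE)
  obtain g where g: "range g \<subseteq> digit_set N E"
    and sums: "(\<lambda>r. ((*v) A ^^ Suc r) (vec_of_int (g r))) sums vec_of_int \<beta>"
    using *(1) by (rule index_setE)
  define g' where "g' = case_nat (\<gamma> - \<epsilon>) g"
  have "range g' \<subseteq> digit_set N E"
  proof
    fix x assume "x \<in> range g'"
    then obtain n where "x = g' n" by blast
    then show "x \<in> digit_set N E"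
      using g digit_mem[OF *(3,2)] by (cases n) (auto simp: g'_def)
  qed
  moreover have "(\<lambda>r. ((*v) A ^^ Suc r) (vec_of_int (g' r))) sums vec_of_int \<alpha>"
  proof -
    have "(\<lambda>r. A *v (((*v) A ^^ Suc r) (vec_of_int (g r)))) sums (A *v vec_of_int \<beta>)"
      by (rule bounded_linear.sums[OF matrix_vector_mul_bounded_linear sums])
    then have "(\<lambda>r. ((*v) A ^^ Suc (Suc r)) (vec_of_int (g' (Suc r)))) sums (A *v vec_of_int \<beta>)"
      by (simp add: g'_def)
    from sums_Suc[OF this] show ?thesis
      by (simp add: g'_def *(4) matrix_vector_right_distrib matrix_vector_mult_diff_distrib)
  qed
  ultimately show "\<alpha> \<in> K" by (auto simp: index_set_def)
qed

text \<open>The decreasing iterates of \<open>successors\<close> stabilise; a point of the stable set has an infinite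
  backward path in it, whose digits expand the point as a series \<open>\<Sum> A\<^sup>r g\<^sub>r\<close>.\<close>

lemma successors_absorbed:
  assumes F: "finite F" "successors F \<subseteq> F"
  shows "\<exists>J. (successors ^^ J) F \<subseteq> K"
proof -
  have dec: "(successors ^^ Suc J) F \<subseteq> (successors ^^ J) F" for J
    by (induction J) (use F successors_mono in auto)
  have sub: "(successors ^^ J) F \<subseteq> F" for J
    by (induction J) (use dec in auto)
  then have fin: "finite ((successors ^^ J) F)" for J
    using F(1) finite_subset by blast
  \<comment> \<open>In a decreasing chain, an iterate of least cardinality is a fixed point of
    \<open>successors\<close>.\<close>
  obtain J where J: "\<And>i. card ((successors ^^ J) F) \<le> card ((successors ^^ i) F)"
    using ex_has_least_nat[of "\<lambda>_. True" 0 "\<lambda>J. card ((successors ^^ J) F)"] by blast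
  define X where "X = (successors ^^ J) F"
  have "card X \<le> card (successors X)" "successors X \<subseteq> X" "finite X"
    using J[of "Suc J"] dec[of J] fin[of J] by (simp_all add: X_def)
  then have X: "successors X = X"
    by (metis card_seteq)
  have "X \<subseteq> K"
  proof
    fix \<alpha> assume \<alpha>: "\<alpha> \<in> X"
    let ?P = "\<lambda>x d y. d \<in> digit_set N E \<and> vec_of_int x = A *v (vec_of_int y + vec_of_int d)"
    have "\<exists>y. y \<in> X \<and> (\<exists>d. ?P x d y)" if x: "x \<in> X" for x
    proof -
      have "x \<in> successors X" using x X by simp
      then show ?thesis by (elim successorsE) (use digit_mem in blast)
    qed
    then have "\<exists>b. \<forall>n. (b n \<in> X \<and> (n = 0 \<longrightarrow> b n = \<alpha>)) \<and> (\<exists>d. ?P (b n) d (b (Suc n)))"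
      using \<alpha> by (intro dependent_nat_choice) auto
    then obtain b where b: "\<And>n. b n \<in> X" "b 0 = \<alpha>" "\<And>n. \<exists>d. ?P (b n) d (b (Suc n))"
      by blast
    obtain g where g: "\<And>n. ?P (b n) (g n) (b (Suc n))"
      using choice[of "\<lambda>n d. ?P (b n) d (b (Suc n))"] b(3) by blast
    have partial: "vec_of_int \<alpha> = (\<Sum>r<n. ((*v) A ^^ Suc r) (vec_of_int (g r))) + ((*v) A ^^ n) (vec_of_int (b n))" for n
    proof (induction n)
      case (Suc n)
      have "((*v) A ^^ n) (vec_of_int (b n)) = ((*v) A ^^ Suc n) (vec_of_int (b (Suc n)) + vec_of_int (g n))"
        using g[of n] by (simp add: funpow_swap1)
      also have "\<dots> = ((*v) A ^^ Suc n) (vec_of_int (b (Suc n))) + ((*v) A ^^ Suc n) (vec_of_int (g n))"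
        by (rule linear_add[OF linear_orbit])
      finally show ?case using Suc by (simp add: add_ac)
    qed (simp add: b)
    \<comment> \<open>The remainder starts in the finite set \<open>X\<close>, so it is bounded by a
      finite sum of orbits, each tending to 0.\<close>
    have "(\<lambda>n. ((*v) A ^^ n) (vec_of_int (b n))) \<longlonglongrightarrow> 0"
    proof (rule Lim_null_comparison)
      show "(\<lambda>n. \<Sum>x\<in>X. norm (((*v) A ^^ n) (vec_of_int x))) \<longlonglongrightarrow> 0"
        by (intro tendsto_null_sum summable_LIMSEQ_zero summable_orbit)
      show "\<forall>\<^sub>F n in sequentially. norm (((*v) A ^^ n) (vec_of_int (b n))) \<le> (\<Sum>x\<in>X. norm (((*v) A ^^ n) (vec_of_int x)))"
        using b(1) \<open>finite X\<close>
        by (intro always_eventually allI member_le_sum[of "b n" X "\<lambda>x. norm (((*v) A ^^ n) (vec_of_int x))" for n]) auto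
    qed
    then have "(\<lambda>n. vec_of_int \<alpha> - ((*v) A ^^ n) (vec_of_int (b n))) \<longlonglongrightarrow> vec_of_int \<alpha> - 0"
      by (intro tendsto_diff tendsto_const)
    moreover have "vec_of_int \<alpha> - ((*v) A ^^ n) (vec_of_int (b n)) = (\<Sum>r<n. ((*v) A ^^ Suc r) (vec_of_int (g r)))" for n
      using partial[of n] by (simp add: algebra_simps)
    ultimately have "(\<lambda>r. ((*v) A ^^ Suc r) (vec_of_int (g r))) sums vec_of_int \<alpha>"
      unfolding sums_def by simp
    moreover have "range g \<subseteq> digit_set N E" using g by blast
    ultimately show "\<alpha> \<in> K" by (auto simp: index_set_def)
  qed
  then show ?thesis unfolding X_def by blast
qed

end

section \<open>Products of transition matrices\<close>

text \<open>\<open>F\<close> remains a parameter because two instances are compared later: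
  \<open>K\<close>, where the spectral hypothesis lives, and a larger set containing
  \<open>K\<close>.\<close>

locale invariant_set = dilation_residues M N E for M :: "int ^ 's ^ 's" and N E +
  fixes F :: "(int ^ 's) set"
  assumes finite_F: "finite F" and invariant: "successors F \<subseteq> F"
begin

abbreviation supported :: "(int ^ 's) set \<Rightarrow> (int ^ 's \<Rightarrow> real) \<Rightarrow> bool" where
  "supported X v \<equiv> \<forall>i. i \<notin> X \<longrightarrow> v i = 0"

abbreviation l1 :: "(int ^ 's \<Rightarrow> real) \<Rightarrow> real" where
  "l1 v \<equiv> \<Sum>\<beta>\<in>F. \<bar>v \<beta>\<bar>"

abbreviation step :: "(int ^ 's) \<times> (int ^ 's \<Rightarrow> real) \<Rightarrow> (int ^ 's \<Rightarrow> real) \<Rightarrow> (int ^ 's \<Rightarrow> real)" where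
  "step x \<equiv> matrix_op F (transition_matrix M (fst x) (snd x))"

text \<open>The functional with weight \<open>v \<beta>\<close> at position
  \<open>p - \<beta>\<close>; the minus sign matches the index
  \<open>\<epsilon> + M *v \<alpha> - \<beta>\<close> of the transition matrices.\<close>

definition pairing :: "(int ^ 's \<Rightarrow> real) \<Rightarrow> (int ^ 's \<Rightarrow> real) \<Rightarrow> int ^ 's \<Rightarrow> real" where
  "pairing v c p = (\<Sum>\<beta>\<in>F. v \<beta> * c (p - \<beta>))"

lemma step_nth:
  "matrix_op F (transition_matrix M \<epsilon> a) v \<alpha> = (if \<alpha> \<in> F then \<Sum>\<beta>\<in>F. a (\<epsilon> + M *v \<alpha> - \<beta>) * v \<beta> else 0)"
  by (simp add: matrix_op_def transition_matrix_def)

lemma l1_nonneg: "0 \<le> l1 v"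
  by (intro sum_nonneg) auto

lemma step_supported:
  assumes "is_mask N a" "\<epsilon> \<in> E" "supported X v"
  shows "supported (successors X) (step (\<epsilon>, a) v)"
proof (intro allI impI)
  fix \<alpha> assume \<alpha>: "\<alpha> \<notin> successors X"
  have "a (\<epsilon> + M *v \<alpha> - \<beta>) * v \<beta> = 0" for \<beta>
    using assms \<alpha> unfolding successors_def is_mask_def by (cases "\<beta> \<in> X") auto
  then have "(\<Sum>\<beta>\<in>F. a (\<epsilon> + M *v \<alpha> - \<beta>) * v \<beta>) = 0" by (intro sum.neutral) blast
  then show "step (\<epsilon>, a) v \<alpha> = 0" by (simp only: step_nth fst_conv snd_conv if_cancel)
qed

lemma step_l1:
  fixes B :: real
  assumes "\<And>\<alpha>. \<bar>snd x \<alpha>\<bar> \<le> B"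
  shows "l1 (step x v) \<le> (card F * B) * l1 v"
proof -
  have "l1 (step x v) \<le> (\<Sum>\<alpha>\<in>F. \<Sum>\<beta>\<in>F. B * \<bar>v \<beta>\<bar>)"
  proof (rule sum_mono)
    fix \<alpha> assume "\<alpha> \<in> F"
    then have "\<bar>step x v \<alpha>\<bar> \<le> (\<Sum>\<beta>\<in>F. \<bar>snd x (fst x + M *v \<alpha> - \<beta>) * v \<beta>\<bar>)"
      by (simp add: step_nth sum_abs)
    also have "\<dots> \<le> (\<Sum>\<beta>\<in>F. B * \<bar>v \<beta>\<bar>)"
      using assms by (intro sum_mono) (simp add: abs_mult mult_right_mono)
    finally show "\<bar>step x v \<alpha>\<bar> \<le> (\<Sum>\<beta>\<in>F. B * \<bar>v \<beta>\<bar>)" .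
  qed
  also have "\<dots> = (card F * B) * l1 v"
    by (simp add: sum_distrib_left mult.assoc)
  finally show ?thesis .
qed

lemma step_diff_left: "step (\<epsilon>, a) v \<alpha> - step (\<epsilon>, b) v \<alpha> = step (\<epsilon>, \<lambda>\<gamma>. a \<gamma> - b \<gamma>) v \<alpha>"
  by (simp add: step_nth sum_subtractf left_diff_distrib)

lemma step_diff_right: "step x v \<alpha> - step x w \<alpha> = step x (\<lambda>\<beta>. v \<beta> - w \<beta>) \<alpha>"
  by (simp add: step_nth sum_subtractf right_diff_distrib)

text \<open>After reflecting the summation index at \<open>q\<close>, the terms outside
  \<open>F\<close> vanish: a nonzero coefficient there would be a successor of
  \<open>\<beta>\<close> that leaves \<open>F\<close>.\<close>

lemma subdivision_eq_sum:
  assumes "is_mask N a" "\<epsilon> \<in> E" "\<beta> \<in> F"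
  shows "subdivision M a c (\<epsilon> + M *v q - \<beta>) = (\<Sum>\<alpha>\<in>F. a (\<epsilon> + M *v \<alpha> - \<beta>) * c (q - \<alpha>))"
proof -
  have bij: "bij_betw (\<lambda>\<alpha>. q - \<alpha>) UNIV (UNIV :: (int ^ 's) set)"
    by (rule bij_betwI[of _ _ _ "\<lambda>\<alpha>. q - \<alpha>"]) auto
  have "subdivision M a c (\<epsilon> + M *v q - \<beta>)
      = (\<Sum>\<^sub>\<infinity>\<alpha>. a (\<epsilon> + M *v q - \<beta> - M *v (q - \<alpha>)) * c (q - \<alpha>))"
    unfolding subdivision_def by (rule infsum_reindex_bij_betw[OF bij, symmetric])
  also have "\<dots> = (\<Sum>\<^sub>\<infinity>\<alpha>. a (\<epsilon> + M *v \<alpha> - \<beta>) * c (q - \<alpha>))"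
    by (simp add: matrix_vector_mult_diff_distrib algebra_simps)
  also have "\<dots> = (\<Sum>\<^sub>\<infinity>\<alpha>\<in>F. a (\<epsilon> + M *v \<alpha> - \<beta>) * c (q - \<alpha>))"
  proof (rule infsum_cong_neutral)
    fix \<alpha> assume "\<alpha> \<in> UNIV - F"
    then have "\<alpha> \<notin> successors F" using invariant by blast
    then have "a (\<epsilon> + M *v \<alpha> - \<beta>) = 0"
      using assms unfolding successors_def is_mask_def by blast
    then show "a (\<epsilon> + M *v \<alpha> - \<beta>) * c (q - \<alpha>) = 0" by simp
  qed auto
  also have "\<dots> = (\<Sum>\<alpha>\<in>F. a (\<epsilon> + M *v \<alpha> - \<beta>) * c (q - \<alpha>))"
    by (rule infsum_finite[OF finite_F])
  finally show ?thesis .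
qed

text \<open>Transition matrices are the adjoints of subdivision: the residue of the position selects
  the matrix and the quotient \<open>q\<close> is the new position.\<close>

lemma pairing_subdivision:
  assumes "is_mask N a" "\<epsilon> \<in> E"
  shows "pairing v (subdivision M a c) (\<epsilon> + M *v q) = pairing (step (\<epsilon>, a) v) c q"
proof -
  have "pairing v (subdivision M a c) (\<epsilon> + M *v q)
      = (\<Sum>\<beta>\<in>F. \<Sum>\<alpha>\<in>F. v \<beta> * (a (\<epsilon> + M *v \<alpha> - \<beta>) * c (q - \<alpha>)))"
    unfolding pairing_def by (intro sum.cong) (simp_all add: subdivision_eq_sum assms sum_distrib_left)
  also have "\<dots> = (\<Sum>\<alpha>\<in>F. \<Sum>\<beta>\<in>F. v \<beta> * (a (\<epsilon> + M *v \<alpha> - \<beta>) * c (q - \<alpha>)))"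
    by (rule sum.swap)
  also have "\<dots> = pairing (step (\<epsilon>, a) v) c q"
    unfolding pairing_def by (intro sum.cong) (simp_all add: step_nth sum_distrib_right sum_distrib_left mult_ac)
  finally show ?thesis .
qed

text \<open>The total mass is the pairing with the constant sequence 1, to which the adjoint
  relation applies.\<close>

lemma sum_step:
  assumes "is_mask N a" "\<epsilon> \<in> E"
  shows "(\<Sum>\<alpha>\<in>F. step (\<epsilon>, a) v \<alpha>) = (\<Sum>\<beta>\<in>F. v \<beta> * subdivision M a (\<lambda>_. 1) (\<epsilon> - \<beta>))"
proof -
  have "(\<Sum>\<alpha>\<in>F. step (\<epsilon>, a) v \<alpha>) = pairing (step (\<epsilon>, a) v) (\<lambda>_. 1) 0"
    by (simp only: pairing_def mult_1_right)
  also have "\<dots> = pairing v (subdivision M a (\<lambda>_. 1)) (\<epsilon> + M *v 0)"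
    by (rule pairing_subdivision[OF assms, symmetric])
  also have "\<dots> = (\<Sum>\<beta>\<in>F. v \<beta> * subdivision M a (\<lambda>_. 1) (\<epsilon> - \<beta>))"
    by (simp add: pairing_def)
  finally show ?thesis .
qed

lemma sum_step_diff_le:
  assumes "is_mask N a" "\<epsilon> \<in> E" "\<And>\<alpha>. \<bar>subdivision M a (\<lambda>_. 1) \<alpha> - 1\<bar> \<le> \<eta>"
  shows "\<bar>sum (step (\<epsilon>, a) v) F - sum v F\<bar> \<le> \<eta> * l1 v"
proof -
  have "sum (step (\<epsilon>, a) v) F - sum v F = (\<Sum>\<beta>\<in>F. v \<beta> * (subdivision M a (\<lambda>_. 1) (\<epsilon> - \<beta>) - 1))"
    using sum_step[OF assms(1,2), of v] by (simp add: right_diff_distrib sum_subtractf)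
  also have "\<bar>\<dots>\<bar> \<le> (\<Sum>\<beta>\<in>F. \<bar>v \<beta> * (subdivision M a (\<lambda>_. 1) (\<epsilon> - \<beta>) - 1)\<bar>)"
    by (rule sum_abs)
  also have "\<dots> \<le> (\<Sum>\<beta>\<in>F. \<eta> * \<bar>v \<beta>\<bar>)"
  proof (rule sum_mono)
    fix \<beta>
    have "\<bar>v \<beta>\<bar> * \<bar>subdivision M a (\<lambda>_. 1) (\<epsilon> - \<beta>) - 1\<bar> \<le> \<bar>v \<beta>\<bar> * \<eta>"
      by (intro mult_left_mono assms) auto
    then show "\<bar>v \<beta> * (subdivision M a (\<lambda>_. 1) (\<epsilon> - \<beta>) - 1)\<bar> \<le> \<eta> * \<bar>v \<beta>\<bar>"
      by (simp add: abs_mult mult.commute)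
  qed
  finally show ?thesis by (simp add: sum_distrib_left)
qed

abbreviation steps :: "((int ^ 's) \<times> (int ^ 's \<Rightarrow> real)) list \<Rightarrow> (int ^ 's \<Rightarrow> real) \<Rightarrow> (int ^ 's \<Rightarrow> real)" where
  "steps xs \<equiv> word_op (map step xs)"

lemma steps_supported:
  assumes "\<And>x. x \<in> set xs \<Longrightarrow> fst x \<in> E \<and> is_mask N (snd x)" "supported X v"
  shows "supported ((successors ^^ length xs) X) (steps xs v)"
  using assms
proof (induction xs)
  case (Cons x xs)
  then have "supported ((successors ^^ length xs) X) (steps xs v)" by auto
  then show ?case
    using step_supported[of "snd x" "fst x"] Cons.prems(1)[of x] by simp
qed simp

lemma steps_l1:
  fixes B :: real
  assumes "\<And>x \<alpha>. x \<in> set xs \<Longrightarrow> \<bar>snd x \<alpha>\<bar> \<le> B" "0 \<le> B"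
  shows "l1 (steps xs v) \<le> (card F * B) ^ length xs * l1 v"
  using assms
proof (induction xs)
  case (Cons x xs)
  have "l1 (steps (x # xs) v) \<le> (card F * B) * l1 (steps xs v)"
    using step_l1[of x B "steps xs v"] Cons by simp
  also have "\<dots> \<le> (card F * B) * ((card F * B) ^ length xs * l1 v)"
    using Cons by (intro mult_left_mono) auto
  finally show ?case by (simp add: mult.assoc)
qed simp

text \<open>Letters are exchanged one at a time. The constant \<open>c\<close> dominates the l1
  growth of a step and also \<open>card F\<close>, so each exchange costs at most
  \<open>c ^ length xs * \<tau>\<close> times the initial norm.\<close>

lemma steps_perturbation:
  fixes B c :: real
  defines "c \<equiv> card F * (1 + \<bar>B\<bar>)"
  assumes "length xs = length ys" "0 \<le> \<tau>"
    "\<And>x y. (x, y) \<in> set (zip xs ys) \<Longrightarrow> fst x = fst y \<and> (\<forall>\<alpha>. \<bar>snd x \<alpha> - snd y \<alpha>\<bar> \<le> \<tau> \<and> \<bar>snd x \<alpha>\<bar> \<le> B \<and> \<bar>snd y \<alpha>\<bar> \<le> B)"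
  shows "l1 (\<lambda>\<alpha>. steps xs v \<alpha> - steps ys v \<alpha>) \<le> length xs * c ^ length xs * \<tau> * l1 v"
  using assms(2-)
proof (induction xs ys rule: list_induct2)
  case (Cons x xs y ys)
  have c0: "0 \<le> c" by (simp add: c_def)
  have xy: "fst x = fst y" "\<And>\<alpha>. \<bar>snd x \<alpha> - snd y \<alpha>\<bar> \<le> \<tau>" "\<And>\<alpha>. \<bar>snd x \<alpha>\<bar> \<le> B"
    using Cons.prems(2)[of x y] by auto
  have IH: "l1 (\<lambda>\<alpha>. steps xs v \<alpha> - steps ys v \<alpha>) \<le> length xs * c ^ length xs * \<tau> * l1 v"
    by (rule Cons.IH[OF Cons.prems(1)], rule Cons.prems(2)) simp
  have ysB: "\<bar>snd y' \<alpha>\<bar> \<le> \<bar>B\<bar>" if "y' \<in> set ys" for y' \<alpha>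
  proof -
    obtain i where "i < length ys" "y' = ys ! i" using \<open>y' \<in> set ys\<close> by (auto simp: in_set_conv_nth)
    then have "(xs ! i, y') \<in> set (zip xs ys)" using Cons.hyps by (auto simp: set_zip)
    then have "\<bar>snd y' \<alpha>\<bar> \<le> B" using Cons.prems(2)[of "xs ! i" y'] by auto
    then show ?thesis by linarith
  qed
  have ys: "l1 (steps ys v) \<le> c ^ length xs * l1 v"
  proof -
    have "l1 (steps ys v) \<le> (card F * \<bar>B\<bar>) ^ length ys * l1 v"
      using ysB by (intro steps_l1) auto
    also have "\<dots> \<le> c ^ length ys * l1 v"
      unfolding c_def by (intro mult_right_mono power_mono mult_left_mono l1_nonneg) auto
    finally show ?thesis using Cons.hyps by simp
  qed
  have split: "steps (x # xs) v \<alpha> - steps (y # ys) v \<alpha>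
      = step x (\<lambda>\<beta>. steps xs v \<beta> - steps ys v \<beta>) \<alpha> + step (fst x, \<lambda>\<gamma>. snd x \<gamma> - snd y \<gamma>) (steps ys v) \<alpha>" for \<alpha>
    using step_diff_left[of "fst x" "snd x" "steps ys v" \<alpha> "snd y"] xy(1)
      step_diff_right[of x "steps xs v" \<alpha> "steps ys v"]
    by simp
  have "l1 (\<lambda>\<alpha>. steps (x # xs) v \<alpha> - steps (y # ys) v \<alpha>)
     \<le> (\<Sum>\<alpha>\<in>F. \<bar>step x (\<lambda>\<beta>. steps xs v \<beta> - steps ys v \<beta>) \<alpha>\<bar> + \<bar>step (fst x, \<lambda>\<gamma>. snd x \<gamma> - snd y \<gamma>) (steps ys v) \<alpha>\<bar>)"
    unfolding split by (intro sum_mono abs_triangle_ineq)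
  also have "\<dots> = l1 (step x (\<lambda>\<beta>. steps xs v \<beta> - steps ys v \<beta>)) + l1 (step (fst x, \<lambda>\<gamma>. snd x \<gamma> - snd y \<gamma>) (steps ys v))"
    by (rule sum.distrib)
  also have "\<dots> \<le> (card F * B) * l1 (\<lambda>\<beta>. steps xs v \<beta> - steps ys v \<beta>) + (card F * \<tau>) * l1 (steps ys v)"
    using xy by (intro add_mono step_l1) auto
  also have "\<dots> \<le> c * (length xs * c ^ length xs * \<tau> * l1 v) + (c * \<tau>) * (c ^ length xs * l1 v)"
  proof (rule add_mono)
    have "card F * B \<le> c" by (simp add: c_def mult_left_mono)
    then show "(card F * B) * l1 (\<lambda>\<beta>. steps xs v \<beta> - steps ys v \<beta>) \<le> c * (length xs * c ^ length xs * \<tau> * l1 v)"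
      by (rule mult_mono[OF _ IH c0 l1_nonneg])
    have "card F * \<tau> * 1 \<le> card F * \<tau> * (1 + \<bar>B\<bar>)"
      using Cons.prems(1) by (intro mult_left_mono) auto
    then have "card F * \<tau> \<le> c * \<tau>" by (simp add: c_def mult_ac)
    moreover have "0 \<le> c * \<tau>" using c0 Cons.prems(1) by simp
    ultimately show "(card F * \<tau>) * l1 (steps ys v) \<le> (c * \<tau>) * (c ^ length xs * l1 v)"
      by (intro mult_mono[OF _ ys _ l1_nonneg])
  qed
  also have "\<dots> = length (x # xs) * c ^ length (x # xs) * \<tau> * l1 v"
    by (simp add: algebra_simps)
  finally show ?case .
qed simp

text \<open>Each letter changes the total mass by its defect times the current l1 norm. The base
  \<open>1 + card F * B\<close> bounds the growth of that norm and is at least 1, so all powers can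
  be raised to a common exponent.\<close>

lemma steps_sum:
  fixes B :: real
  assumes "0 \<le> B"
    "\<And>x. x \<in> set xs \<Longrightarrow> fst x \<in> E \<and> is_mask N (snd x) \<and> (\<forall>\<alpha>. \<bar>snd x \<alpha>\<bar> \<le> B)"
    "\<And>x \<alpha>. x \<in> set xs \<Longrightarrow> \<bar>subdivision M (snd x) (\<lambda>_. 1) \<alpha> - 1\<bar> \<le> \<eta> x"
  shows "\<bar>sum (steps xs v) F - sum v F\<bar> \<le> (\<Sum>x\<leftarrow>xs. \<eta> x) * (1 + card F * B) ^ length xs * l1 v"
  using assms(2-)
proof (induction xs)
  case (Cons x xs)
  let ?c = "1 + card F * B"
  have c1: "1 \<le> ?c" using assms(1) by simp
  have \<eta>0: "0 \<le> \<eta> y" if "y \<in> set (x # xs)" for y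
    using Cons.prems(2)[of y 0] that by (meson abs_ge_zero order_trans)
  have IH: "\<bar>sum (steps xs v) F - sum v F\<bar> \<le> (\<Sum>x\<leftarrow>xs. \<eta> x) * ?c ^ length xs * l1 v"
    using Cons by auto
  have "l1 (steps xs v) \<le> (card F * B) ^ length xs * l1 v"
    using Cons.prems(1) assms(1) by (intro steps_l1) auto
  also have "\<dots> \<le> ?c ^ Suc (length xs) * l1 v"
  proof (intro mult_right_mono l1_nonneg)
    have "(card F * B) ^ length xs \<le> ?c ^ length xs" using assms(1) by (intro power_mono) auto
    also have "\<dots> \<le> ?c ^ Suc (length xs)" using c1 by (intro power_increasing) auto
    finally show "(card F * B) ^ length xs \<le> ?c ^ Suc (length xs)" .
  qed
  finally have l: "l1 (steps xs v) \<le> ?c ^ Suc (length xs) * l1 v" .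
  have "\<bar>sum (step x (steps xs v)) F - sum (steps xs v) F\<bar> \<le> \<eta> x * l1 (steps xs v)"
    using sum_step_diff_le[of "snd x" "fst x" "\<eta> x" "steps xs v"] Cons.prems by simp
  also have "\<dots> \<le> \<eta> x * (?c ^ Suc (length xs) * l1 v)"
    using l \<eta>0 by (intro mult_left_mono) auto
  finally have 1: "\<bar>sum (step x (steps xs v)) F - sum (steps xs v) F\<bar> \<le> \<eta> x * ?c ^ Suc (length xs) * l1 v"
    by (simp only: mult.assoc)
  have "(\<Sum>x\<leftarrow>xs. \<eta> x) * ?c ^ length xs * l1 v \<le> (\<Sum>x\<leftarrow>xs. \<eta> x) * ?c ^ Suc (length xs) * l1 v"
    using c1 \<eta>0 by (intro mult_right_mono mult_left_mono power_increasing l1_nonneg sum_list_nonneg) auto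
  with 1 IH have "\<bar>sum (step x (steps xs v)) F - sum v F\<bar>
      \<le> \<eta> x * ?c ^ Suc (length xs) * l1 v + (\<Sum>x\<leftarrow>xs. \<eta> x) * ?c ^ Suc (length xs) * l1 v"
    by linarith
  then show ?case by (simp add: distrib_right)
qed simp

text \<open>Each induction step peels off the finest level. Its mask stands last in
  \<open>xs\<close> and so acts first, leaving the masks in increasing order of level.\<close>

lemma pairing_iterate:
  assumes "\<And>k. k \<ge> 1 \<Longrightarrow> is_mask N (a k)"
  shows "\<exists>xs q. map snd xs = map a [Suc k..<Suc (k + n)] \<and> fst ` set xs \<subseteq> E \<and>
     pairing v (subdivision_iter M a (k + n) c) p = pairing (steps xs v) (subdivision_iter M a k c) q"
proof (induction n arbitrary: v p)
  case 0
  show ?case by (rule exI[of _ "[]"]) auto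
next
  case (Suc n)
  obtain \<epsilon> q where \<epsilon>: "\<epsilon> \<in> E" "p = \<epsilon> + M *v q" by (rule residue_decomposition)
  let ?x = "(\<epsilon>, a (Suc (k + n)))"
  obtain xs q' where xs: "map snd xs = map a [Suc k..<Suc (k + n)]" "fst ` set xs \<subseteq> E"
    "pairing (step ?x v) (subdivision_iter M a (k + n) c) q = pairing (steps xs (step ?x v)) (subdivision_iter M a k c) q'"
    using Suc by blast
  have "pairing v (subdivision_iter M a (k + Suc n) c) p = pairing (step ?x v) (subdivision_iter M a (k + n) c) q"
    using pairing_subdivision[OF assms \<epsilon>(1), of "Suc (k + n)"] by (simp add: \<epsilon>(2))
  also have "\<dots> = pairing (steps (xs @ [?x]) v) (subdivision_iter M a k c) q'"
    by (simp only: xs(3) word_op_append map_append list.map word_op_simps o_apply id_apply)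
  finally have "pairing v (subdivision_iter M a (k + Suc n) c) p = pairing (steps (xs @ [?x]) v) (subdivision_iter M a k c) q'" .
  moreover have "map snd (xs @ [?x]) = map a [Suc k..<Suc (k + Suc n)]" using xs(1) by simp
  moreover have "fst ` set (xs @ [?x]) \<subseteq> E" using xs(2) \<epsilon>(1) by auto
  ultimately show ?case by blast
qed

end

section \<open>Contraction and limit masks\<close>

lemma finite_function_convergent_subsequence:
  fixes f :: "nat \<Rightarrow> 'a \<Rightarrow> real"
  assumes "finite S" "\<And>n x. \<bar>f n x\<bar> \<le> B"
  shows "\<exists>s. strict_mono s \<and> (\<forall>x\<in>S. convergent (\<lambda>n. f (s n) x))"
  using assms(1)
proof (induction S)
  case empty
  have "strict_mono (\<lambda>n::nat. n)" by (simp add: strict_mono_Suc_iff)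
  then show ?case by blast
next
  case (insert x S)
  then obtain s where s: "strict_mono s" "\<And>y. y \<in> S \<Longrightarrow> convergent (\<lambda>n. f (s n) y)" by blast
  have "bounded (range (\<lambda>n. f (s n) x))"
    unfolding bounded_iff using assms(2) by (intro exI[of _ B]) auto
  then obtain l t where t: "strict_mono t" "((\<lambda>n. f (s n) x) \<circ> t) \<longlonglongrightarrow> l"
    using bounded_imp_convergent_subsequence by blast
  have "convergent (\<lambda>n. f (s (t n)) y)" if "y \<in> insert x S" for y
  proof (cases "y = x")
    case True
    then show ?thesis using t(2) by (auto simp: o_def convergent_def)
  next
    case False
    then show ?thesis
      using convergent_subseq_convergent[OF s(2) t(1), of y] that by (simp add: o_def)
  qed
  moreover have "strict_mono (\<lambda>n. s (t n))"
    using strict_mono_o[OF s(1) t(1)] by (simp add: o_def)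
  ultimately show ?case by blast
qed

context dilation_residues
begin

lemma matrix_op_outside: "\<alpha> \<notin> X \<Longrightarrow> matrix_op X T v \<alpha> = 0"
  by (simp add: matrix_op_def)

text \<open>The final conjunct is the exact sum rule of order 1 in spatial form: every coset sum of
  the mask is 1.\<close>

definition exact_mask :: "real \<Rightarrow> (int ^ 's \<Rightarrow> real) \<Rightarrow> bool" where
  "exact_mask B b \<longleftrightarrow> is_mask N b \<and> (\<forall>\<alpha>. \<bar>b \<alpha>\<bar> \<le> B) \<and> (\<forall>\<alpha>. subdivision M b (\<lambda>_. 1) \<alpha> = 1)"

lemma sum_abs_le_L2: "(\<Sum>i\<in>I. \<bar>v i\<bar>) \<le> card I * L2_set v I" if "finite I"
proof -
  have "(\<Sum>i\<in>I. \<bar>v i\<bar>) \<le> (\<Sum>i\<in>I. L2_set v I)"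
    using member_le_L2_set[OF that, of _ "\<lambda>i. \<bar>v i\<bar>"] by (intro sum_mono) (simp add: L2_set_def)
  then show ?thesis by simp
qed

text \<open>Exactness preserves total mass, hence the zero-sum space. In the bound,
  \<open>card K * B\<close> is the l1 growth of one step and the other \<open>card K\<close>
  compares the l1 with the Euclidean norm.\<close>

lemma bounded_operator_family_index_set:
  fixes B :: real
  assumes "B \<ge> 0" "Lm \<noteq> {}" and Lm: "\<And>b. b \<in> Lm \<Longrightarrow> exact_mask B b"
  shows "bounded_operator_family K (zero_sum_space K) (transition_ops M K E Lm) (card K * B * card K)"
proof -
  interpret KI: invariant_set M N E K
    by unfold_locales (rule finite_index_set, rule index_set_successors)
  show ?thesis
  proof
    show "(\<lambda>_. 0) \<in> zero_sum_space K" by (simp add: zero_sum_space_def)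
    show "(\<lambda>i. c * v i) \<in> zero_sum_space K" if "v \<in> zero_sum_space K" for v c
      using that by (auto simp: zero_sum_space_def simp flip: sum_distrib_left)
    show "0 \<le> card K * B * card K" using assms by simp
    show "transition_ops M K E Lm \<noteq> {}"
      using assms E_nonempty by (auto simp: transition_ops_def)
    fix T v assume T: "T \<in> transition_ops M K E Lm" and v: "v \<in> zero_sum_space K"
    then obtain \<epsilon> b where Tb: "T = matrix_op K (transition_matrix M \<epsilon> b)" "\<epsilon> \<in> E" "b \<in> Lm"
      by (auto simp: transition_ops_def)
    have b: "is_mask N b" "\<And>\<alpha>. \<bar>b \<alpha>\<bar> \<le> B" "\<And>\<alpha>. subdivision M b (\<lambda>_. 1) \<alpha> = 1"
      using Lm[OF Tb(3)] by (auto simp: exact_mask_def)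
    show "T v \<in> zero_sum_space K"
      using KI.sum_step[OF b(1) Tb(2), of v] v
      by (simp add: zero_sum_space_def Tb(1) b(3) matrix_op_outside)
    show "T (\<lambda>i. c * v i) = (\<lambda>i. c * T v i)" for c
      by (rule ext) (simp add: Tb(1) KI.step_nth sum_distrib_left mult_ac)
    have "L2_set (T v) K \<le> (\<Sum>i\<in>K. \<bar>T v i\<bar>)" by (rule L2_set_le_sum_abs)
    also have "\<dots> \<le> (card K * B) * (\<Sum>i\<in>K. \<bar>v i\<bar>)"
      using KI.step_l1[of "(\<epsilon>, b)" B v] b(2) by (simp add: Tb(1))
    also have "\<dots> \<le> (card K * B) * (card K * L2_set v K)"
      using assms(1) finite_index_set by (intro mult_left_mono sum_abs_le_L2) auto
    finally show "L2_set (T v) K \<le> (card K * B * card K) * L2_set v K"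
      by (simp only: mult.assoc)
  qed
qed

end

context invariant_set
begin

text \<open>The first \<open>J\<close> steps move the support from \<open>F\<close> into \<open>K\<close>; there the joint spectral radius takes over.\<close>

theorem steps_contraction:
  fixes B \<delta> :: real
  assumes KF: "K \<subseteq> F" and B: "B \<ge> 0" and "Lm \<noteq> {}" and Lm: "\<And>b. b \<in> Lm \<Longrightarrow> exact_mask B b"
    and jsr: "joint_spectral_radius K (zero_sum_space K) (transition_ops M K E Lm) < 1"
    and "0 < \<delta>"
  shows "\<exists>L\<ge>1. \<forall>xs v. length xs = L \<longrightarrow> (\<forall>x\<in>set xs. fst x \<in> E \<and> snd x \<in> Lm) \<longrightarrow>
    supported F v \<longrightarrow> sum v F = 0 \<longrightarrow> l1 (steps xs v) \<le> \<delta> * l1 v"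
proof -
  let ?Ts = "transition_ops M K E Lm"
  interpret KI: invariant_set M N E K
    by unfold_locales (rule finite_index_set, rule index_set_successors)
  interpret BO: bounded_operator_family K "zero_sum_space K" ?Ts "card K * B * card K"
    by (rule bounded_operator_family_index_set[OF B \<open>Lm \<noteq> {}\<close> Lm])
  obtain n q where n: "n \<ge> 1" "0 \<le> q" "q < 1" and
    contr: "\<And>Ts v. length Ts = n \<Longrightarrow> set Ts \<subseteq> ?Ts \<Longrightarrow> v \<in> zero_sum_space K \<Longrightarrow>
      L2_set (word_op Ts v) K \<le> q * L2_set v K"
    using BO.contracting_word_length[OF jsr] by blast
  have contr_iter: "L2_set (word_op Ts v) K \<le> q ^ j * L2_set v K"
    if "length Ts = n * j" "set Ts \<subseteq> ?Ts" "v \<in> zero_sum_space K" for Ts v j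
    using that
  proof (induction j arbitrary: Ts)
    case (Suc j)
    define Us Ws where "Us = take n Ts" and "Ws = drop n Ts"
    have TU: "Ts = Us @ Ws" by (simp add: Us_def Ws_def)
    have len: "length Us = n" "length Ws = n * j" using Suc.prems(1) by (simp_all add: Us_def Ws_def)
    have sets: "set Us \<subseteq> ?Ts" "set Ws \<subseteq> ?Ts"
      using Suc.prems(2) by (auto simp: TU)
    have "L2_set (word_op Ts v) K \<le> q * L2_set (word_op Ws v) K"
      unfolding TU word_op_append o_apply using Suc.prems sets len by (intro contr BO.word_V)
    also have "\<dots> \<le> q * (q ^ j * L2_set v K)"
      using Suc.IH[OF len(2) sets(2) Suc.prems(3)] n by (intro mult_left_mono) auto
    finally show ?case by simp
  qed (simp add: n)
  have exact: "fst x \<in> E \<and> is_mask N (snd x)" "\<bar>snd x \<alpha>\<bar> \<le> B" "subdivision M (snd x) (\<lambda>_. 1) \<alpha> = 1"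
    if "fst x \<in> E \<and> snd x \<in> Lm" for x \<alpha>
    using Lm[of "snd x"] that by (auto simp: exact_mask_def)
  \<comment> \<open>On vectors supported in \<open>K\<close> the matrices over \<open>F\<close> and
    over \<open>K\<close> agree, because successors of \<open>K\<close> stay in
    \<open>K\<close>.\<close>
  have steps_K: "supported K (KI.steps xs w) \<and> steps xs w = KI.steps xs w"
    if "\<forall>x\<in>set xs. fst x \<in> E \<and> snd x \<in> Lm" "supported K w" for xs w
    using that
  proof (induction xs)
    case (Cons x xs)
    let ?u = "KI.steps xs w"
    have IH: "supported K ?u" "steps xs w = ?u" using Cons by auto
    have x: "fst x \<in> E" "is_mask N (snd x)" using exact(1)[of x] Cons.prems by auto
    have "step x ?u \<alpha> = KI.step x ?u \<alpha>" for \<alpha>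
    proof (cases "\<alpha> \<in> K")
      case True
      then have "\<alpha> \<in> F" using KF by blast
      have "(\<Sum>\<beta>\<in>F. snd x (fst x + M *v \<alpha> - \<beta>) * ?u \<beta>) = (\<Sum>\<beta>\<in>K. snd x (fst x + M *v \<alpha> - \<beta>) * ?u \<beta>)"
        using IH(1) KF finite_F by (intro sum.mono_neutral_right) auto
      then show ?thesis using True \<open>\<alpha> \<in> F\<close> by (simp add: step_nth KI.step_nth)
    next
      case False
      then have "\<alpha> \<notin> successors K" using index_set_successors by blast
      then have "step x ?u \<alpha> = 0"
        using step_supported[OF x(2,1) IH(1)] by simp
      then show ?thesis using False by (simp add: matrix_op_outside)
    qed
    then have "step x ?u = KI.step x ?u" by (rule ext)
    then show ?case using IH(2) by (simp add: matrix_op_outside)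
  qed simp
  obtain J where J: "(successors ^^ J) F \<subseteq> K"
    using successors_absorbed[OF finite_F invariant] by blast
  let ?c = "card F * B"
  have c0: "0 \<le> ?c" using B by simp
  \<comment> \<open>\<open>card K\<close> is the price of returning from the Euclidean to the l1
    norm, \<open>?c ^ J\<close> the growth in the first \<open>J\<close> steps; the 1 makes
    \<open>G\<close> positive.\<close>
  define G where "G = card K * ?c ^ J + 1"
  have "0 < G" using c0 by (simp add: G_def add_nonneg_pos)
  then obtain j where j: "q ^ j < \<delta> / G"
    using real_arch_pow_inv[of "\<delta> / G" q] \<open>0 < \<delta>\<close> n by auto
  \<comment> \<open>The exponent \<open>Suc j\<close> rather than \<open>j\<close> guarantees a
    positive total length, since \<open>n\<close> is positive.\<close>
  have qG: "card K * q ^ Suc j * ?c ^ J \<le> \<delta>"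
  proof -
    have "q ^ Suc j \<le> q ^ j" using n by (intro power_decreasing) auto
    then have "q ^ Suc j \<le> \<delta> / G" using j by linarith
    then have "q ^ Suc j * G \<le> \<delta>" using \<open>0 < G\<close> by (simp add: pos_le_divide_eq)
    moreover have "q ^ Suc j * (card K * ?c ^ J) \<le> q ^ Suc j * G"
      using n by (intro mult_left_mono) (auto simp: G_def)
    ultimately show ?thesis by (simp add: mult_ac)
  qed
  have "l1 (steps xs v) \<le> \<delta> * l1 v"
    if len: "length xs = n * Suc j + J" and xs: "\<forall>x\<in>set xs. fst x \<in> E \<and> snd x \<in> Lm"
      and v: "supported F v" "sum v F = 0" for xs v
  proof -
    \<comment> \<open>The tail \<open>zs\<close> acts first: it moves the support into
      \<open>K\<close>, where \<open>ys\<close> contracts.\<close>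
    define ys zs where "ys = take (n * Suc j) xs" and "zs = drop (n * Suc j) xs"
    have yz: "xs = ys @ zs" by (simp add: ys_def zs_def)
    have lens: "length ys = n * Suc j" "length zs = J" using len by (simp_all add: ys_def zs_def)
    have ys: "\<forall>x\<in>set ys. fst x \<in> E \<and> snd x \<in> Lm" and zs: "\<forall>x\<in>set zs. fst x \<in> E \<and> snd x \<in> Lm"
      using xs by (auto simp: yz)
    define w where "w = steps zs v"
    have w_supp: "supported K w"
      using steps_supported[of zs F v] zs exact(1) v(1) J unfolding w_def lens(2) by blast
    \<comment> \<open>Limit masks have defect 0, so the total mass is still 0 when \<open>K\<close>
      is reached.\<close>
    have "\<bar>sum w F - sum v F\<bar> \<le> (\<Sum>x\<leftarrow>zs. 0) * (1 + card F * B) ^ length zs * l1 v"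
      unfolding w_def using zs exact by (intro steps_sum[OF B]) auto
    then have "sum w F = 0" using v(2) by simp
    moreover have "sum w F = sum w K"
      using w_supp KF finite_F by (intro sum.mono_neutral_right) auto
    ultimately have w_V: "w \<in> zero_sum_space K"
      using w_supp by (simp add: zero_sum_space_def)
    have w_l1: "(\<Sum>i\<in>K. \<bar>w i\<bar>) \<le> ?c ^ J * l1 v"
    proof -
      have "(\<Sum>i\<in>K. \<bar>w i\<bar>) \<le> l1 w" using KF finite_F by (intro sum_mono2) auto
      also have "\<dots> \<le> ?c ^ length zs * l1 v"
        unfolding w_def using zs exact(2) B by (intro steps_l1) auto
      finally show ?thesis by (simp add: lens)
    qed
    have eq: "steps xs v = KI.steps ys w" and supp: "supported K (KI.steps ys w)"
      using steps_K[OF ys w_supp] by (simp_all add: yz word_op_append w_def)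
    have "l1 (steps xs v) = (\<Sum>i\<in>K. \<bar>KI.steps ys w i\<bar>)"
      unfolding eq using supp KF finite_F by (intro sum.mono_neutral_right) auto
    also have "\<dots> \<le> card K * L2_set (KI.steps ys w) K"
      by (rule sum_abs_le_L2[OF finite_index_set])
    also have "\<dots> \<le> card K * (q ^ Suc j * L2_set w K)"
    proof (intro mult_left_mono contr_iter w_V)
      show "length (map KI.step ys) = n * Suc j" by (simp add: lens)
      show "set (map KI.step ys) \<subseteq> ?Ts"
        using ys by (auto simp: transition_ops_def)
    qed simp
    also have "\<dots> \<le> card K * (q ^ Suc j * (?c ^ J * l1 v))"
      using n by (intro mult_left_mono order_trans[OF L2_set_le_sum_abs w_l1]) auto
    also have "\<dots> = (card K * q ^ Suc j * ?c ^ J) * l1 v"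
      by (simp only: mult.assoc)
    also have "\<dots> \<le> \<delta> * l1 v"
      by (intro mult_right_mono qG l1_nonneg)
    finally show ?thesis .
  qed
  moreover have "n * Suc j + J \<ge> 1" using n(1) by simp
  ultimately show ?thesis by blast
qed

end

section \<open>Limit masks: exactness and compactness\<close>

context dilation_residues
begin

context
  fixes a :: "nat \<Rightarrow> int ^ 's \<Rightarrow> real" and B :: real and \<eta> :: "nat \<Rightarrow> real"
  assumes mask: "\<And>k. k \<ge> 1 \<Longrightarrow> is_mask N (a k)"
    and bounded_masks: "\<And>k \<alpha>. k \<ge> 1 \<Longrightarrow> \<bar>a k \<alpha>\<bar> \<le> B"
    and defect: "summable \<eta>" "\<And>k \<alpha>. \<bar>subdivision M (a (Suc k)) (\<lambda>_. 1) \<alpha> - 1\<bar> \<le> \<eta> k"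
begin

text \<open>Support, bound and coset sums are conditions on finitely many coefficients and pass to
  the limit; the summable defect tends to 0.\<close>

lemma limit_masks_exact:
  assumes "b \<in> limit_masks a"
  shows "exact_mask B b"
proof -
  obtain r where r: "strict_mono r" and lim: "\<And>\<alpha>. (\<lambda>n. a (r n) \<alpha>) \<longlonglongrightarrow> b \<alpha>"
    using assms by (auto simp: limit_masks_def)
  \<comment> \<open>The subsequence may start at index 0, where \<open>a\<close> is unconstrained,
    so its first member is skipped.\<close>
  have r1: "r (Suc n) \<ge> 1" for n
    using seq_suble[OF r, of "Suc n"] by simp
  have lim': "(\<lambda>n. a (r (Suc n)) \<alpha>) \<longlonglongrightarrow> b \<alpha>" for \<alpha>
    using lim by (rule LIMSEQ_Suc)
  have b_mask: "is_mask N b"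
    unfolding is_mask_def
  proof
    fix \<alpha> assume "\<alpha> \<in> {\<alpha>. b \<alpha> \<noteq> 0}"
    then have "\<not> (\<lambda>n. a (r (Suc n)) \<alpha>) \<longlonglongrightarrow> 0"
      using LIMSEQ_unique[OF lim'] by auto
    moreover have "(\<lambda>n. a (r (Suc n)) \<alpha>) = (\<lambda>_. 0)" if "\<alpha> \<notin> mask_box"
      using mask[OF r1] that unfolding is_mask_def by blast
    ultimately show "\<alpha> \<in> mask_box" by (metis tendsto_const)
  qed
  have "\<bar>b \<alpha>\<bar> \<le> B" for \<alpha>
    by (rule tendsto_upperbound[OF tendsto_rabs[OF lim']]) (intro always_eventually allI bounded_masks r1, simp)
  moreover have "subdivision M b (\<lambda>_. 1) \<alpha> = 1" for \<alpha>
  proof -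
    have "(\<lambda>n. subdivision M (a (r (Suc n))) (\<lambda>_. 1) \<alpha>) \<longlonglongrightarrow> subdivision M b (\<lambda>_. 1) \<alpha>"
      unfolding subdivision_one_mask[OF mask[OF r1]] subdivision_one_mask[OF b_mask]
      by (intro tendsto_sum) (auto intro: lim')
    moreover have "(\<lambda>n. subdivision M (a (r (Suc n))) (\<lambda>_. 1) \<alpha>) \<longlonglongrightarrow> 1"
    proof (rule LIM_zero_cancel, rule Lim_null_comparison)
      \<comment> \<open>Index shift: the defect of the mask \<open>a (Suc k)\<close> is bounded by
        \<open>\<eta> k\<close>.\<close>
      have "strict_mono (\<lambda>n. r (Suc n) - 1)"
        using r r1 unfolding strict_mono_Suc_iff by (metis Suc_le_D Suc_less_eq diff_Suc_1 One_nat_def)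
      then show "(\<lambda>n. \<eta> (r (Suc n) - 1)) \<longlonglongrightarrow> 0"
        using LIMSEQ_subseq_LIMSEQ[OF summable_LIMSEQ_zero[OF defect(1)]] by (simp add: o_def)
      show "\<forall>\<^sub>F n in sequentially. norm (subdivision M (a (r (Suc n))) (\<lambda>_. 1) \<alpha> - 1) \<le> \<eta> (r (Suc n) - 1)"
      proof (intro always_eventually allI)
        fix n
        have "Suc (r (Suc n) - 1) = r (Suc n)" using r1[of n] by simp
        then show "norm (subdivision M (a (r (Suc n))) (\<lambda>_. 1) \<alpha> - 1) \<le> \<eta> (r (Suc n) - 1)"
          using defect(2)[of "r (Suc n) - 1" \<alpha>] by (simp only: real_norm_def)
      qed
    qed
    ultimately show ?thesis by (rule LIMSEQ_unique)
  qed
  ultimately show ?thesis using b_mask by (simp add: exact_mask_def)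
qed

lemma convergent_subsequence_of_masks:
  fixes r :: "nat \<Rightarrow> nat"
  assumes "strict_mono r" "\<And>n. r n \<ge> 1"
  obtains s b where "strict_mono s" "\<And>\<alpha>. (\<lambda>n. a (r (s n)) \<alpha>) \<longlonglongrightarrow> b \<alpha>" "b \<in> limit_masks a"
proof -
  obtain s where s: "strict_mono (s :: nat \<Rightarrow> nat)" "\<And>\<alpha>. \<alpha> \<in> mask_box \<Longrightarrow> convergent (\<lambda>n. a (r (s n)) \<alpha>)"
    using finite_function_convergent_subsequence[of mask_box "\<lambda>n. a (r n)" B] bounded_masks[OF assms(2)] by auto
  have "convergent (\<lambda>n. a (r (s n)) \<alpha>)" for \<alpha>
  proof (cases "\<alpha> \<in> mask_box")
    case False
    then have "a (r (s n)) \<alpha> = 0" for n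
      using mask[OF assms(2)] unfolding is_mask_def by blast
    then show ?thesis by (simp add: convergent_const)
  qed (rule s(2))
  then have "\<forall>\<alpha>. \<exists>l. (\<lambda>n. a (r (s n)) \<alpha>) \<longlonglongrightarrow> l" by (simp add: convergent_def)
  then obtain b where b: "\<And>\<alpha>. (\<lambda>n. a (r (s n)) \<alpha>) \<longlonglongrightarrow> b \<alpha>" by metis
  moreover have "strict_mono (r \<circ> s)" using assms(1) s(1) by (rule strict_mono_o)
  then have "b \<in> limit_masks a" unfolding limit_masks_def using b by (auto intro!: exI[of _ "r \<circ> s"])
  ultimately show ?thesis using that s(1) by blast
qed

lemma limit_masks_nonempty: "limit_masks a \<noteq> {}"
proof -
  have "strict_mono Suc" by (simp add: strict_mono_Suc_iff)
  then show ?thesis using convergent_subsequence_of_masks[of Suc] by auto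
qed

text \<open>Otherwise infinitely many masks stay away from all limit masks, and a convergent
  subsequence of these produces a limit mask that some of them approach. Finiteness of the box makes
  the approach uniform.\<close>

lemma eventually_near_limit_mask:
  assumes "0 < \<tau>"
  shows "\<forall>\<^sub>F k in sequentially. \<exists>b\<in>limit_masks a. \<forall>\<alpha>. \<bar>a k \<alpha> - b \<alpha>\<bar> \<le> \<tau>"
proof (rule ccontr)
  let ?P = "\<lambda>k. \<exists>b\<in>limit_masks a. \<forall>\<alpha>. \<bar>a k \<alpha> - b \<alpha>\<bar> \<le> \<tau>"
  assume "\<not> (\<forall>\<^sub>F k in sequentially. ?P k)"
  then have "\<exists>k>m. \<not> ?P k" for m
    unfolding eventually_sequentially by (metis Suc_le_eq)
  then have "infinite {k. k \<ge> 1 \<and> \<not> ?P k}"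
    unfolding infinite_nat_iff_unbounded
  proof (intro allI)
    fix m
    from \<open>\<And>m. \<exists>k>m. \<not> ?P k\<close>[of m] obtain k where "k > m" "\<not> ?P k" by blast
    then show "\<exists>n>m. n \<in> {k. k \<ge> 1 \<and> \<not> ?P k}" by (intro exI[of _ k]) auto
  qed
  from infinite_enumerate[OF this] obtain r :: "nat \<Rightarrow> nat"
    where "strict_mono r \<and> (\<forall>n. r n \<in> {k. k \<ge> 1 \<and> \<not> ?P k})" ..
  then have r: "strict_mono r" "\<And>n. r n \<ge> 1" "\<And>n. \<not> ?P (r n)"
    by simp_all
  obtain s b where s: "strict_mono s" "\<And>\<alpha>. (\<lambda>n. a (r (s n)) \<alpha>) \<longlonglongrightarrow> b \<alpha>" "b \<in> limit_masks a"
    by (rule convergent_subsequence_of_masks[OF r(1,2)]) (rule that)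
  have "\<forall>\<^sub>F n in sequentially. \<forall>\<alpha>\<in>mask_box. \<bar>a (r (s n)) \<alpha> - b \<alpha>\<bar> < \<tau>"
    using tendstoD[OF s(2) assms] by (intro eventually_ball_finite) (auto simp: dist_real_def)
  then obtain n where n: "\<And>\<alpha>. \<alpha> \<in> mask_box \<Longrightarrow> \<bar>a (r (s n)) \<alpha> - b \<alpha>\<bar> < \<tau>"
    using eventually_happens'[OF sequentially_bot] by blast
  have "\<bar>a (r (s n)) \<alpha> - b \<alpha>\<bar> \<le> \<tau>" for \<alpha>
  proof (cases "\<alpha> \<in> mask_box")
    case False
    have "is_mask N (a (r (s n)))" "is_mask N b"
      using mask r(2) limit_masks_exact[OF s(3)] by (auto simp: exact_mask_def)
    then have "a (r (s n)) \<alpha> = 0" "b \<alpha> = 0"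
      using False by (auto simp: is_mask_def)
    then show ?thesis using assms by simp
  qed (use n less_imp_le in blast)
  then show False using r(3)[of "s n"] s(3) by blast
qed

end

end

section \<open>Decay of the differences\<close>

text \<open>The Lyapunov function is \<open>X k + \<Lambda> * (y k + \<dots> + y (k + L - 1))\<close>.\<close>

lemma delayed_contraction_summable:
  fixes X y \<eta> H :: "nat \<Rightarrow> real"
  assumes nonneg: "\<And>k. 0 \<le> X k" "\<And>k. 0 \<le> y k" "\<And>k. 0 \<le> \<eta> k" "\<And>k. 0 \<le> H k"
    and sm: "summable \<eta>" "summable H"
    and C: "0 \<le> C" and q: "0 \<le> q" "q < 1"
    and X_step: "\<And>k. X (Suc k) \<le> (1 + \<eta> k) * X k + C * y k"
    and y_step: "\<And>k. k \<ge> k0 \<Longrightarrow> y (k + L) \<le> q * y k + H k * X k"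
  shows "\<exists>B. \<forall>k. X k \<le> B" "summable y"
proof -
  \<comment> \<open>With \<open>\<Lambda> * (1 - q) = C + 1\<close>, the contraction pays for the
    term \<open>C * y k\<close> of the first recursion and leaves one full \<open>y k\<close>
    over.\<close>
  define \<Lambda> where "\<Lambda> = (C + 1) / (1 - q)"
  have \<Lambda>: "0 \<le> \<Lambda>" "\<Lambda> * (1 - q) = C + 1" using C q by (simp_all add: \<Lambda>_def)
  define Z where "Z n = X (n + k0) + \<Lambda> * (\<Sum>j<L. y (n + k0 + j))" for n
  define h where "h n = \<eta> (n + k0) + \<Lambda> * H (n + k0)" for n
  have h0: "0 \<le> h n" for n using nonneg \<Lambda> by (simp add: h_def)
  have sh: "summable h"
    unfolding h_def using sm by (intro summable_add summable_mult) (simp_all add: summable_iff_shift)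
  have Z0: "0 \<le> Z n" for n using nonneg \<Lambda> by (simp add: Z_def sum_nonneg)
  have X_le_Z: "X (n + k0) \<le> Z n" for n
    using nonneg \<Lambda> by (simp add: Z_def sum_nonneg)
  have step: "Z (Suc n) + y (n + k0) \<le> (1 + h n) * Z n" for n
  proof -
    let ?k = "n + k0"
    let ?S = "\<Sum>j<L. y (?k + j)"
    have S0: "0 \<le> ?S" using nonneg by (simp add: sum_nonneg)
    have "(\<Sum>j<L. y (Suc ?k + j)) + y ?k = (\<Sum>j<Suc L. y (?k + j))"
      by (subst sum.lessThan_Suc_shift) simp
    then have S: "(\<Sum>j<L. y (Suc ?k + j)) = ?S + y (?k + L) - y ?k" by simp
    have "Z (Suc n) = X (Suc ?k) + \<Lambda> * (?S + y (?k + L) - y ?k)"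
      by (simp add: Z_def flip: S)
    also have "\<dots> \<le> ((1 + \<eta> ?k) * X ?k + C * y ?k) + \<Lambda> * (?S + (q * y ?k + H ?k * X ?k) - y ?k)"
      using X_step y_step \<Lambda> by (intro add_mono mult_left_mono diff_right_mono) auto
    also have "\<dots> = (1 + h n) * X ?k + \<Lambda> * ?S + (C - \<Lambda> * (1 - q)) * y ?k"
      by (simp add: h_def algebra_simps)
    also have "\<dots> = (1 + h n) * X ?k + 1 * (\<Lambda> * ?S) - y ?k"
      unfolding \<Lambda>(2) by simp
    also have "\<dots> \<le> (1 + h n) * X ?k + (1 + h n) * (\<Lambda> * ?S) - y ?k"
      using h0 \<Lambda> S0 by (intro diff_right_mono add_left_mono mult_right_mono) auto
    also have "\<dots> = (1 + h n) * Z n - y ?k" by (simp add: Z_def algebra_simps)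
    finally show ?thesis by simp
  qed
  \<comment> \<open>The growth factors \<open>1 + h n\<close> multiply to at most
    \<open>exp (suminf h)\<close>.\<close>
  define W where "W = Z 0 * exp (suminf h)"
  have Z_le: "Z n \<le> W" for n
  proof -
    have "Z n \<le> Z 0 * exp (sum h {..<n})"
    proof (induction n)
      case (Suc n)
      have "Z (Suc n) \<le> (1 + h n) * Z n" using step[of n] nonneg(2)[of "n + k0"] by linarith
      also have "\<dots> \<le> exp (h n) * (Z 0 * exp (sum h {..<n}))"
        using Suc Z0 h0 by (intro mult_mono exp_ge_add_one_self) auto
      finally show ?case by (simp add: exp_add mult_ac)
    qed simp
    also have "\<dots> \<le> W"
      unfolding W_def using Z0 h0 sh by (intro mult_left_mono) (auto intro!: sum_le_suminf)
    finally show ?thesis .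
  qed
  have W0: "0 \<le> W" using Z0[of 0] by (simp add: W_def)
  show "\<exists>B. \<forall>k. X k \<le> B"
  proof (intro exI allI)
    fix k
    show "X k \<le> W + (\<Sum>i<k0. X i)"
    proof (cases "k < k0")
      case True
      then have "X k \<le> (\<Sum>i<k0. X i)" using nonneg by (intro member_le_sum) auto
      then show ?thesis using W0 by simp
    next
      case False
      then have "X k \<le> W" using X_le_Z[of "k - k0"] Z_le[of "k - k0"] by simp
      moreover have "0 \<le> (\<Sum>i<k0. X i)" using nonneg by (simp add: sum_nonneg)
      ultimately show ?thesis by simp
    qed
  qed
  have "summable (\<lambda>n. y (n + k0))"
  proof (rule summableI_nonneg_bounded)
    show "0 \<le> y (n + k0)" for n by (rule nonneg)
    show "(\<Sum>i<n. y (i + k0)) \<le> Z 0 + suminf h * W" for n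
    proof -
      \<comment> \<open>Summing the surplus \<open>y\<close> left over in each step bounds its
        partial sums, as \<open>Z\<close> is nonnegative.\<close>
      have "(\<Sum>i<n. y (i + k0)) + Z n \<le> Z 0 + sum h {..<n} * W"
      proof (induction n)
        case (Suc n)
        have "h n * Z n \<le> h n * W" using h0 Z_le by (intro mult_left_mono)
        then show ?case using Suc step[of n] by (simp add: algebra_simps)
      qed simp
      moreover have "sum h {..<n} * W \<le> suminf h * W"
        using W0 h0 sh by (intro mult_right_mono sum_le_suminf) auto
      ultimately show ?thesis using Z0[of n] by linarith
    qed
  qed
  then show "summable y" by (simp add: summable_iff_shift)
qed

context invariant_set
begin

text \<open>Replacing all sampled values by the one at \<open>p - \<beta>\<^sub>0\<close> costs only
  oscillation; what remains is the total mass times a single value.\<close>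

lemma pairing_diff_le:
  assumes "\<beta>\<^sub>0 \<in> F" "\<And>\<beta>. \<beta> \<in> F \<Longrightarrow> \<bar>c (p - \<beta>) - c (p - \<beta>\<^sub>0)\<bar> \<le> Y"
  shows "\<bar>pairing w c p - sum w F * c (p - \<beta>\<^sub>0)\<bar> \<le> l1 w * Y"
proof -
  have "pairing w c p - sum w F * c (p - \<beta>\<^sub>0) = (\<Sum>\<beta>\<in>F. w \<beta> * (c (p - \<beta>) - c (p - \<beta>\<^sub>0)))"
    by (simp add: pairing_def right_diff_distrib sum_subtractf sum_distrib_right)
  also have "\<bar>\<dots>\<bar> \<le> (\<Sum>\<beta>\<in>F. \<bar>w \<beta> * (c (p - \<beta>) - c (p - \<beta>\<^sub>0))\<bar>)" by (rule sum_abs)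
  also have "\<dots> \<le> (\<Sum>\<beta>\<in>F. \<bar>w \<beta>\<bar> * Y)"
    using assms(2) by (intro sum_mono) (simp add: abs_mult mult_left_mono)
  finally show ?thesis by (simp add: sum_distrib_right)
qed

end

context dilation_residues
begin

text \<open>The radius \<open>r\<close> is arbitrary because the support of a test function is. The
  set \<open>F\<close> depends on \<open>r\<close>, the spectral hypothesis on \<open>K\<close> does
  not.\<close>

theorem summable_differences:
  fixes a :: "nat \<Rightarrow> int ^ 's \<Rightarrow> real" and B :: real and \<eta> :: "nat \<Rightarrow> real"
  assumes mask: "\<And>k. k \<ge> 1 \<Longrightarrow> is_mask N (a k)"
    and bounded_masks: "\<And>k \<alpha>. k \<ge> 1 \<Longrightarrow> \<bar>a k \<alpha>\<bar> \<le> B"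
    and defect: "summable \<eta>" "\<And>k \<alpha>. \<bar>subdivision M (a (Suc k)) (\<lambda>_. 1) \<alpha> - 1\<bar> \<le> \<eta> k"
    and jsr: "joint_spectral_radius K (zero_sum_space K) (transition_ops M K E (limit_masks a)) < 1"
    and c: "bounded (range c)"
  shows "\<exists>z :: nat \<Rightarrow> real. summable z \<and>
    (\<forall>k \<alpha> \<beta>. norm (vec_of_int (\<alpha> - \<beta>) :: real ^ 's) \<le> r \<longrightarrow>
       \<bar>subdivision_iter M a k c \<alpha> - subdivision_iter M a k c \<beta>\<bar> \<le> z k) \<and>
    (\<forall>k \<alpha> \<beta>. norm (A *v vec_of_int \<alpha> - vec_of_int \<beta>) \<le> r \<longrightarrow>
       \<bar>subdivision_iter M a (Suc k) c \<alpha> - subdivision_iter M a k c \<beta>\<bar> \<le> z k)"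
proof -
  let ?v = "vec_of_int :: int ^ 's \<Rightarrow> real ^ 's"
  \<comment> \<open>For \<open>\<alpha> = \<epsilon> + M *v q\<close> the vectors
    \<open>A *v vec_of_int \<alpha>\<close> and \<open>vec_of_int q\<close> differ by
    \<open>A *v vec_of_int \<epsilon>\<close>; \<open>DE\<close> bounds this shift, so that
    \<open>q - \<beta>\<close> still lands in \<open>F\<close>.\<close>
  define DE where "DE = (\<Sum>\<epsilon>\<in>E. norm (A *v ?v \<epsilon>))"
  have DE: "norm (A *v ?v \<epsilon>) \<le> DE" if "\<epsilon> \<in> E" for \<epsilon>
    unfolding DE_def using that finite_E by (intro member_le_sum[of \<epsilon> E "\<lambda>\<epsilon>. norm (A *v ?v \<epsilon>)"]) auto
  have DE0: "0 \<le> DE" unfolding DE_def by (intro sum_nonneg) auto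
  obtain F where F: "finite F" "K \<subseteq> F" "successors F \<subseteq> F" "\<And>\<beta>. norm (?v \<beta>) \<le> \<bar>r\<bar> + DE \<Longrightarrow> \<beta> \<in> F"
    by (rule ex_large_invariant_set[OF finite_index_set, of "\<bar>r\<bar> + DE"]) (rule that)
  interpret invariant_set M N E F by unfold_locales (rule F(1), rule F(3))
  have F0: "0 \<in> F" using F(4)[of 0] DE0 by simp
  have B0: "0 \<le> B" using bounded_masks[of 1 0] by (meson abs_ge_zero order_trans order_refl)
  have \<eta>0: "0 \<le> \<eta> k" for k using defect(2)[of k 0] by (meson abs_ge_zero order_trans)
  let ?cs = "\<lambda>k. subdivision_iter M a k c"
  let ?C = "card F * B"
  have C0: "0 \<le> ?C" using B0 by simp
  let ?\<delta> = "\<lambda>\<beta> \<gamma>. if \<gamma> = \<beta> then 1 else 0 :: real"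
  have point: "pairing (?\<delta> 0) d p = d p" "l1 (?\<delta> 0) = 1" for d p
    using F0 finite_F by (simp_all add: pairing_def if_distrib[of "\<lambda>t. t * _"] if_distrib[of abs] cong: if_cong)
  have bdd: "\<exists>b. \<forall>\<alpha>. \<bar>?cs k \<alpha>\<bar> \<le> b" for k
  proof (induction k)
    case 0
    then show ?case using c by (auto simp: bounded_iff)
  next
    case (Suc k)
    then obtain b where b: "\<And>\<alpha>. \<bar>?cs k \<alpha>\<bar> \<le> b" by blast
    have "\<bar>?cs (Suc k) \<alpha>\<bar> \<le> ?C * b" for \<alpha>
    proof -
      obtain \<epsilon> q where \<epsilon>: "\<epsilon> \<in> E" "\<alpha> = \<epsilon> + M *v q" by (rule residue_decomposition)
      let ?w = "step (\<epsilon>, a (Suc k)) (?\<delta> 0)"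
      have eq: "?cs (Suc k) \<alpha> = pairing ?w (?cs k) q"
        using pairing_subdivision[OF mask \<epsilon>(1), of "Suc k" "?\<delta> 0" "?cs k" q] by (simp add: point \<epsilon>(2))
      have "\<bar>pairing ?w (?cs k) q\<bar> \<le> (\<Sum>\<beta>\<in>F. \<bar>?w \<beta> * ?cs k (q - \<beta>)\<bar>)"
        unfolding pairing_def by (rule sum_abs)
      also have "\<dots> \<le> (\<Sum>\<beta>\<in>F. \<bar>?w \<beta>\<bar> * b)"
        unfolding abs_mult by (intro sum_mono mult_left_mono b abs_ge_zero)
      also have "\<dots> = l1 ?w * b" by (rule sum_distrib_right[symmetric])
      also have "\<dots> \<le> (?C * l1 (?\<delta> 0)) * b"
        using b[of 0] bounded_masks by (intro mult_right_mono step_l1) auto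
      finally show ?thesis unfolding eq by (simp add: F0 finite_F)
    qed
    then show ?case by blast
  qed
  define X where "X k = (SUP \<alpha>. \<bar>?cs k \<alpha>\<bar>)" for k
  have X_bdd: "bdd_above (range (\<lambda>\<alpha>. \<bar>?cs k \<alpha>\<bar>))" for k
    using bdd[of k] by (auto intro: bdd_aboveI)
  have X: "\<bar>?cs k \<alpha>\<bar> \<le> X k" for k \<alpha>
    unfolding X_def by (intro cSUP_upper X_bdd) auto
  define y where "y k = (SUP (p, \<beta>, \<gamma>)\<in>UNIV \<times> F \<times> F. \<bar>?cs k (p - \<beta>) - ?cs k (p - \<gamma>)\<bar>)" for k
  have y_bdd: "bdd_above ((\<lambda>(p, \<beta>, \<gamma>). \<bar>?cs k (p - \<beta>) - ?cs k (p - \<gamma>)\<bar>) ` (UNIV \<times> F \<times> F))" for k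
  proof (rule bdd_aboveI2, clarify)
    fix p \<beta> \<gamma>
    show "\<bar>?cs k (p - \<beta>) - ?cs k (p - \<gamma>)\<bar> \<le> 2 * X k"
      using X[of k "p - \<beta>"] X[of k "p - \<gamma>"] by linarith
  qed
  have y: "\<bar>?cs k (p - \<beta>) - ?cs k (p - \<gamma>)\<bar> \<le> y k" if "\<beta> \<in> F" "\<gamma> \<in> F" for k p \<beta> \<gamma>
    using cSUP_upper[OF _ y_bdd, of "(p, \<beta>, \<gamma>)" k] that unfolding y_def by simp
  have X0: "0 \<le> X k" for k using X[of k 0] by (meson abs_ge_zero order_trans)
  have y0: "0 \<le> y k" for k using y[OF F0 F0, of k 0] by simp
  \<comment> \<open>A value at the finer level is a functional on the coarser level with mass within
    \<open>\<eta> k\<close> of 1: oscillation gives the first term, the mass error times the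
    supremum the second.\<close>
  have level: "\<bar>?cs (Suc k) (\<epsilon> + M *v q) - ?cs k (q - \<beta>)\<bar> \<le> ?C * y k + \<eta> k * X k"
    if "\<epsilon> \<in> E" "\<beta> \<in> F" for k \<epsilon> q \<beta>
  proof -
    let ?w = "step (\<epsilon>, a (Suc k)) (?\<delta> 0)"
    have eq: "?cs (Suc k) (\<epsilon> + M *v q) = pairing ?w (?cs k) q"
      using pairing_subdivision[OF mask that(1), of "Suc k" "?\<delta> 0" "?cs k" q] by (simp add: point)
    have "\<bar>pairing ?w (?cs k) q - sum ?w F * ?cs k (q - \<beta>)\<bar> \<le> l1 ?w * y k"
      using that y by (intro pairing_diff_le) auto
    also have "\<dots> \<le> (?C * l1 (?\<delta> 0)) * y k"
      using y0 bounded_masks by (intro mult_right_mono step_l1) auto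
    finally have 1: "\<bar>pairing ?w (?cs k) q - sum ?w F * ?cs k (q - \<beta>)\<bar> \<le> ?C * y k"
      by (simp add: F0 finite_F)
    have "sum ?w F = subdivision M (a (Suc k)) (\<lambda>_. 1) \<epsilon>"
      using sum_step[OF mask that(1), of "Suc k" "?\<delta> 0"] F0 finite_F
      by (simp add: if_distrib[of "\<lambda>t. t * _"] cong: if_cong)
    then have "\<bar>sum ?w F - 1\<bar> * \<bar>?cs k (q - \<beta>)\<bar> \<le> \<eta> k * X k"
      using defect(2) X \<eta>0 by (intro mult_mono) auto
    then have "\<bar>(sum ?w F - 1) * ?cs k (q - \<beta>)\<bar> \<le> \<eta> k * X k" by (simp only: abs_mult)
    then have "\<bar>sum ?w F * ?cs k (q - \<beta>) - ?cs k (q - \<beta>)\<bar> \<le> \<eta> k * X k" by (simp add: left_diff_distrib)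
    with 1 show ?thesis unfolding eq by linarith
  qed
  have X_step: "X (Suc k) \<le> (1 + \<eta> k) * X k + ?C * y k" for k
    unfolding X_def[of "Suc k"]
  proof (rule cSUP_least)
    fix \<alpha>
    obtain \<epsilon> q where \<epsilon>: "\<epsilon> \<in> E" "\<alpha> = \<epsilon> + M *v q" by (rule residue_decomposition)
    show "\<bar>?cs (Suc k) \<alpha>\<bar> \<le> (1 + \<eta> k) * X k + ?C * y k"
      using level[OF \<epsilon>(1) F0, of k q] X[of k q] unfolding \<epsilon>(2) by (simp add: distrib_right)
  qed simp
  have Lm: "limit_masks a \<noteq> {}" "\<And>b. b \<in> limit_masks a \<Longrightarrow> exact_mask B b"
    using limit_masks_nonempty[OF mask bounded_masks defect] limit_masks_exact[OF mask bounded_masks defect] by blast+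
  \<comment> \<open>1/8 for the limit masks and 1/8 for the perturbation, times the norm 2 of a
    difference of unit masses, give the factor 1/2.\<close>
  have "0 < (1/8 :: real)" by simp
  from steps_contraction[OF F(2) B0 Lm jsr this] obtain L where "1 \<le> L \<and> (\<forall>xs v. length xs = L \<longrightarrow>
    (\<forall>x\<in>set xs. fst x \<in> E \<and> snd x \<in> limit_masks a) \<longrightarrow> supported F v \<longrightarrow> sum v F = 0 \<longrightarrow> l1 (steps xs v) \<le> 1/8 * l1 v)" ..
  from conjunct2[OF this] have contr: "l1 (steps xs v) \<le> 1/8 * l1 v" if "length xs = L" "\<forall>x\<in>set xs. fst x \<in> E \<and> snd x \<in> limit_masks a"
    "supported F v" "sum v F = 0" for xs v
    using that by (auto dest!: spec[of _ xs] spec[of _ v])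
  \<comment> \<open>Chosen so that the constant of \<open>steps_perturbation\<close> for
    \<open>L\<close> letters is at most 1/8; the added 1 keeps the denominator positive.\<close>
  define \<tau> where "\<tau> = 1 / (8 * (1 + L * (card F * (1 + \<bar>B\<bar>)) ^ L))"
  have den: "0 < 1 + L * (card F * (1 + \<bar>B\<bar>)) ^ L" by (intro add_pos_nonneg) auto
  have \<tau>: "0 < \<tau>" "L * (card F * (1 + \<bar>B\<bar>)) ^ L * \<tau> \<le> 1/8"
    using den by (simp_all add: \<tau>_def field_simps)
  obtain k0 where k0: "\<And>k. k \<ge> k0 \<Longrightarrow> \<exists>b\<in>limit_masks a. \<forall>\<alpha>. \<bar>a k \<alpha> - b \<alpha>\<bar> \<le> \<tau>"
    using eventually_near_limit_mask[OF mask bounded_masks defect \<tau>(1)] unfolding eventually_sequentially by blast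
  define h where "h k = (\<Sum>j<L. \<eta> (k + j))" for k
  have h: "summable h"
    unfolding h_def using defect(1) by (intro summable_sum) (simp add: summable_iff_shift)
  have h0: "0 \<le> h k" for k unfolding h_def using \<eta>0 by (intro sum_nonneg)
  \<comment> \<open>\<open>steps_sum\<close> collects the window bound \<open>h k\<close> once for
    each of the \<open>L\<close> letters; the factor 2 bounds \<open>l1 v\<close>.\<close>
  define H where "H k = L * h k * (1 + ?C) ^ L * 2" for k
  have y_step: "y (k + L) \<le> 1/2 * y k + H k * X k" if k: "k \<ge> k0" for k
    unfolding y_def[of "k + L"]
  proof (rule cSUP_least)
    show "UNIV \<times> F \<times> F \<noteq> {}" using F0 by blast
    fix t assume "t \<in> (UNIV :: (int ^ 's) set) \<times> F \<times> F"
    then obtain p \<beta> \<gamma> where t: "t = (p, \<beta>, \<gamma>)" "\<beta> \<in> F" "\<gamma> \<in> F" by blast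
    define v where "v i = ?\<delta> \<beta> i - ?\<delta> \<gamma> i" for i
    have v_supp: "supported F v" using t by (auto simp: v_def)
    have v_sum: "sum v F = 0" using t finite_F by (simp add: v_def sum_subtractf)
    have "l1 v \<le> (\<Sum>i\<in>F. ?\<delta> \<beta> i + ?\<delta> \<gamma> i)" unfolding v_def by (intro sum_mono) auto
    then have v_l1: "l1 v \<le> 2" using t finite_F by (simp add: sum.distrib)
    have v_pair: "pairing v d p = d (p - \<beta>) - d (p - \<gamma>)" for d
      using t finite_F by (simp add: pairing_def v_def left_diff_distrib sum_subtractf if_distrib[of "\<lambda>t. t * _"] cong: if_cong)
    obtain xs q where xs: "map snd xs = map a [Suc k..<Suc (k + L)]" "fst ` set xs \<subseteq> E"
      "pairing v (?cs (k + L)) p = pairing (steps xs v) (?cs k) q"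
      using pairing_iterate[where a = a and k = k and n = L and v = v and c = c and p = p, OF mask] by blast
    have len: "length xs = L" using arg_cong[OF xs(1), of length] by simp
    have snd_xs: "\<exists>j<L. snd x = a (Suc (k + j))" if "x \<in> set xs" for x
    proof -
      have "snd x \<in> set (map snd xs)" using that by simp
      then obtain i where "i \<in> {Suc k..<Suc (k + L)}" "snd x = a i"
        unfolding xs(1) set_map set_upt by blast
      then show ?thesis by (intro exI[of _ "i - Suc k"]) auto
    qed
    have good: "fst x \<in> E \<and> is_mask N (snd x) \<and> (\<forall>\<alpha>. \<bar>snd x \<alpha>\<bar> \<le> B)"
      and near: "\<exists>b\<in>limit_masks a. \<forall>\<alpha>. \<bar>snd x \<alpha> - b \<alpha>\<bar> \<le> \<tau>"
      and def: "\<bar>subdivision M (snd x) (\<lambda>_. 1) \<alpha> - 1\<bar> \<le> h k" if x: "x \<in> set xs" for x \<alpha>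
    proof -
      obtain j where j: "j < L" "snd x = a (Suc (k + j))" using snd_xs[OF x] by blast
      show "fst x \<in> E \<and> is_mask N (snd x) \<and> (\<forall>\<alpha>. \<bar>snd x \<alpha>\<bar> \<le> B)"
        using x xs(2) mask[of "Suc (k + j)"] bounded_masks[of "Suc (k + j)"] by (auto simp: j(2))
      show "\<exists>b\<in>limit_masks a. \<forall>\<alpha>. \<bar>snd x \<alpha> - b \<alpha>\<bar> \<le> \<tau>" using k0[of "Suc (k + j)"] k by (simp add: j(2))
      have "\<eta> (k + j) \<le> h k" unfolding h_def using j(1) \<eta>0 by (intro member_le_sum[of j _ "\<lambda>j. \<eta> (k + j)"]) auto
      then show "\<bar>subdivision M (snd x) (\<lambda>_. 1) \<alpha> - 1\<bar> \<le> h k" using defect(2)[of "k + j" \<alpha>] by (simp add: j(2))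
    qed
    \<comment> \<open>Each mask of the window is replaced by its own nearby limit mask; mixed
      products are exactly what the joint spectral radius controls.\<close>
    define nb where "nb x = (SOME b. b \<in> limit_masks a \<and> (\<forall>\<alpha>. \<bar>snd x \<alpha> - b \<alpha>\<bar> \<le> \<tau>))" for x :: "(int ^ 's) \<times> (int ^ 's \<Rightarrow> real)"
    have nb: "nb x \<in> limit_masks a \<and> (\<forall>\<alpha>. \<bar>snd x \<alpha> - nb x \<alpha>\<bar> \<le> \<tau>)" if "x \<in> set xs" for x
      unfolding nb_def
      by (rule someI_ex[where P = "\<lambda>b. b \<in> limit_masks a \<and> (\<forall>\<alpha>. \<bar>snd x \<alpha> - b \<alpha>\<bar> \<le> \<tau>)"])
        (rule near[OF that, unfolded Bex_def])
    define ys where "ys = map (\<lambda>x. (fst x, nb x)) xs"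
    have ys_len: "length ys = L" by (simp add: ys_def len)
    have "l1 (\<lambda>\<alpha>. steps xs v \<alpha> - steps ys v \<alpha>) \<le> L * (card F * (1 + \<bar>B\<bar>)) ^ L * \<tau> * l1 v"
      unfolding len[symmetric]
    proof (rule steps_perturbation)
      show "length xs = length ys" "0 \<le> \<tau>" using len ys_len \<tau> by auto
      fix x x' assume "(x, x') \<in> set (zip xs ys)"
      then have x: "x \<in> set xs" "x' = (fst x, nb x)" by (auto simp: ys_def zip_map2 zip_same_conv_map)
      have "exact_mask B (nb x)" using nb[OF x(1)] Lm(2) by blast
      then show "fst x = fst x' \<and> (\<forall>\<alpha>. \<bar>snd x \<alpha> - snd x' \<alpha>\<bar> \<le> \<tau> \<and> \<bar>snd x \<alpha>\<bar> \<le> B \<and> \<bar>snd x' \<alpha>\<bar> \<le> B)"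
        using nb[OF x(1)] good[OF x(1)] by (simp add: x(2) exact_mask_def)
    qed
    also have "\<dots> \<le> 1/8 * l1 v" by (intro mult_right_mono \<tau> l1_nonneg)
    finally have d: "l1 (\<lambda>\<alpha>. steps xs v \<alpha> - steps ys v \<alpha>) \<le> 1/8 * l1 v" .
    have e: "l1 (steps ys v) \<le> 1/8 * l1 v"
    proof (rule contr[OF ys_len _ v_supp v_sum], rule ballI)
      fix x' assume "x' \<in> set ys"
      then obtain x where x: "x \<in> set xs" "x' = (fst x, nb x)" by (auto simp: ys_def)
      show "fst x' \<in> E \<and> snd x' \<in> limit_masks a"
        using good[OF x(1)] nb[OF x(1)] by (simp add: x(2))
    qed
    have "l1 (steps xs v) \<le> (\<Sum>\<alpha>\<in>F. \<bar>steps xs v \<alpha> - steps ys v \<alpha>\<bar> + \<bar>steps ys v \<alpha>\<bar>)"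
      by (intro sum_mono) linarith
    then have w_l1: "l1 (steps xs v) \<le> 1/2"
      using d e v_l1 by (simp add: sum.distrib)
    have "\<bar>sum (steps xs v) F - sum v F\<bar> \<le> (\<Sum>x\<leftarrow>xs. h k) * (1 + card F * B) ^ length xs * l1 v"
      using good def by (intro steps_sum[OF B0]) auto
    then have "\<bar>sum (steps xs v) F\<bar> \<le> L * h k * (1 + ?C) ^ L * l1 v"
      by (simp add: v_sum len sum_list_triv)
    also have "\<dots> \<le> H k"
      unfolding H_def using v_l1 h0 C0 by (intro mult_left_mono) auto
    finally have w_sum: "\<bar>sum (steps xs v) F\<bar> \<le> H k" .
    have "\<bar>pairing (steps xs v) (?cs k) q - sum (steps xs v) F * ?cs k (q - 0)\<bar> \<le> l1 (steps xs v) * y k"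
      by (rule pairing_diff_le[OF F0]) (rule y[OF _ F0])
    also have "\<dots> \<le> 1/2 * y k" using w_l1 y0 by (intro mult_right_mono)
    finally have "\<bar>pairing (steps xs v) (?cs k) q - sum (steps xs v) F * ?cs k q\<bar> \<le> 1/2 * y k" by simp
    moreover have "\<bar>sum (steps xs v) F\<bar> * \<bar>?cs k q\<bar> \<le> H k * X k"
      using w_sum X by (intro mult_mono) (auto intro: order_trans[OF abs_ge_zero w_sum])
    then have "\<bar>sum (steps xs v) F * ?cs k q\<bar> \<le> H k * X k" by (simp only: abs_mult)
    ultimately have "\<bar>pairing v (?cs (k + L)) p\<bar> \<le> 1/2 * y k + H k * X k"
      unfolding xs(3) by linarith
    then show "(case t of (p, \<beta>, \<gamma>) \<Rightarrow> \<bar>?cs (k + L) (p - \<beta>) - ?cs (k + L) (p - \<gamma>)\<bar>) \<le> 1/2 * y k + H k * X k"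
      by (simp add: t(1) v_pair)
  qed
  have H0: "0 \<le> H k" for k unfolding H_def using h0 C0 by simp
  have H_sum: "summable H" unfolding H_def using h by (intro summable_mult summable_mult2)
  have res: "\<exists>b. \<forall>k. X k \<le> b" "summable y"
    by (rule delayed_contraction_summable[where X = X and y = y and \<eta> = \<eta> and H = H and C = ?C and q = "1/2" and L = L and ?k0.0 = k0];
        use X0 y0 \<eta>0 H0 defect(1) H_sum C0 X_step y_step in \<open>auto\<close>)+
  then obtain b where b: "\<And>k. X k \<le> b" by blast
  define z where "z k = y k + (?C * y k + \<eta> k * b)" for k
  have b0: "0 \<le> b" using X0[of 0] b[of 0] by linarith
  have "summable z" unfolding z_def using res(2) defect(1) by (intro summable_add summable_mult summable_mult2)
  moreover have "\<bar>?cs k \<alpha> - ?cs k \<beta>\<bar> \<le> z k" if "norm (?v (\<alpha> - \<beta>)) \<le> r" for k \<alpha> \<beta>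
  proof -
    have "\<alpha> - \<beta> \<in> F" using that DE0 by (intro F(4)) linarith
    from y[OF F0 this, of k \<alpha>] have "\<bar>?cs k \<alpha> - ?cs k \<beta>\<bar> \<le> y k" by simp
    moreover have "0 \<le> ?C * y k + \<eta> k * b" using C0 y0 \<eta>0 b0 by simp
    ultimately show ?thesis by (simp add: z_def)
  qed
  moreover have "\<bar>?cs (Suc k) \<alpha> - ?cs k \<beta>\<bar> \<le> z k" if n: "norm (A *v ?v \<alpha> - ?v \<beta>) \<le> r" for k \<alpha> \<beta>
  proof -
    obtain \<epsilon> q where \<epsilon>: "\<epsilon> \<in> E" "\<alpha> = \<epsilon> + M *v q" by (rule residue_decomposition)
    have "?v (q - \<beta>) = (A *v ?v \<alpha> - ?v \<beta>) - A *v ?v \<epsilon>"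
      by (simp add: \<epsilon>(2) matrix_vector_right_distrib flip: map_matrix_of_int_mult)
    then have "norm (?v (q - \<beta>)) \<le> norm (A *v ?v \<alpha> - ?v \<beta>) + norm (A *v ?v \<epsilon>)"
      by (metis norm_triangle_ineq4)
    then have "q - \<beta> \<in> F" using n DE[OF \<epsilon>(1)] by (intro F(4)) linarith
    from level[OF \<epsilon>(1) this, of k q] have "\<bar>?cs (Suc k) \<alpha> - ?cs k \<beta>\<bar> \<le> ?C * y k + \<eta> k * X k"
      unfolding \<epsilon>(2) by simp
    also have "\<dots> \<le> ?C * y k + \<eta> k * b" using b \<eta>0 by (intro add_left_mono mult_left_mono)
    also have "\<dots> \<le> z k" using y0 by (simp add: z_def)
    finally show ?thesis .
  qed
  ultimately show ?thesis by blast
qed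

end

section \<open>Convergence\<close>

lemma uniform_limit_of_summable_increments:
  fixes h :: "nat \<Rightarrow> 'a \<Rightarrow> real"
  assumes "summable z" "\<And>k x. \<bar>h (Suc k) x - h k x\<bar> \<le> z k"
  shows "\<exists>g. uniform_limit UNIV h g sequentially"
proof -
  have "uniform_limit UNIV (\<lambda>n x. \<Sum>k<n. h (Suc k) x - h k x) (\<lambda>x. \<Sum>k. h (Suc k) x - h k x) sequentially"
    using assms by (intro Weierstrass_m_test) auto
  then have "uniform_limit UNIV (\<lambda>n x. h 0 x + (\<Sum>k<n. h (Suc k) x - h k x))
      (\<lambda>x. h 0 x + (\<Sum>k. h (Suc k) x - h k x)) sequentially"
    by (intro uniform_limit_add uniform_limit_const)
  moreover have "(\<lambda>n x. h 0 x + (\<Sum>k<n. h (Suc k) x - h k x)) = h"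
    by (intro ext) (use sum_lessThan_telescope[of "\<lambda>k. h k x" n for x n] in simp)
  ultimately show ?thesis by auto
qed

text \<open>By the partition of unity the error is the sum of
  \<open>(d \<alpha> - d (vec_floor u)) * f (u - vec_of_int \<alpha>)\<close>. The number of nonzero
  terms is bounded independently of \<open>u\<close>.\<close>

lemma test_function_sum_bound:
  fixes f :: "real ^ 's \<Rightarrow> real"
  assumes f: "continuous_test_function f"
  shows "\<exists>r C. \<forall>d u y. (\<forall>\<alpha>. norm (vec_of_int (\<alpha> - vec_floor u) :: real ^ 's) \<le> r \<longrightarrow> \<bar>d \<alpha> - d (vec_floor u)\<bar> \<le> y) \<longrightarrow>
       \<bar>(\<Sum>\<^sub>\<infinity>\<alpha>. d \<alpha> * f (u - vec_of_int \<alpha>)) - d (vec_floor u)\<bar> \<le> C * y"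
proof -
  have cont: "continuous_on UNIV f" and comp: "compact (closure {x. f x \<noteq> 0})"
    using f unfolding continuous_test_function_def by blast+
  obtain r0 where r0: "\<And>x. f x \<noteq> 0 \<Longrightarrow> norm x \<le> r0"
    using compact_imp_bounded[OF comp] closure_subset[of "{x. f x \<noteq> 0}"] unfolding bounded_iff by blast
  have "bounded (f ` closure {x. f x \<noteq> 0})"
    using comp cont by (intro compact_imp_bounded compact_continuous_image) (auto intro: continuous_on_subset)
  then obtain b0 where b0: "\<And>x. x \<in> closure {x. f x \<noteq> 0} \<Longrightarrow> \<bar>f x\<bar> \<le> b0"
    unfolding bounded_iff by auto
  have b: "\<bar>f x\<bar> \<le> \<bar>b0\<bar>" for x
  proof (cases "f x = 0")
    case False
    then have "x \<in> closure {x. f x \<noteq> 0}" by (intro subsetD[OF closure_subset]) simp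
    then show ?thesis using b0[of x] by linarith
  qed simp
  \<comment> \<open>The radius of the support plus the distance from \<open>u\<close> to its integer
    part.\<close>
  let ?r = "r0 + real CARD('s)"
  let ?v = "vec_of_int :: int ^ 's \<Rightarrow> real ^ 's"
  define G where "G = {\<alpha>. norm (?v \<alpha>) \<le> ?r}"
  have finG: "finite G" unfolding G_def by (rule finite_int_vec_bounded)
  have main: "\<bar>(\<Sum>\<^sub>\<infinity>\<alpha>. d \<alpha> * f (u - ?v \<alpha>)) - d (vec_floor u)\<bar> \<le> (card G * \<bar>b0\<bar>) * y"
    if "\<forall>\<alpha>. norm (?v (\<alpha> - vec_floor u)) \<le> ?r \<longrightarrow> \<bar>d \<alpha> - d (vec_floor u)\<bar> \<le> y" for d u y
  proof -
    note d = that[rule_format]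
    let ?f0 = "vec_floor u"
    define S where "S = (\<lambda>\<alpha>. \<alpha> + ?f0) ` G"
    have finS: "finite S" and cardS: "card S \<le> card G"
      using finG by (simp_all add: S_def card_image_le)
    have S: "norm (?v (\<alpha> - ?f0)) \<le> ?r" if "\<alpha> \<in> S" for \<alpha>
      using that by (auto simp: S_def G_def)
    have out: "f (u - ?v \<alpha>) = 0" if "\<alpha> \<notin> S" for \<alpha>
    proof (rule ccontr)
      assume "f (u - ?v \<alpha>) \<noteq> 0"
      then have 1: "norm (u - ?v \<alpha>) \<le> r0" by (rule r0)
      have "?v (\<alpha> - ?f0) = (u - ?v ?f0) - (u - ?v \<alpha>)" by simp
      then have "norm (?v (\<alpha> - ?f0)) \<le> norm (u - ?v ?f0) + norm (u - ?v \<alpha>)"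
        by (metis norm_triangle_ineq4)
      then have "norm (?v (\<alpha> - ?f0)) \<le> ?r" using 1 norm_diff_vec_floor_le[of u] by linarith
      then have "\<alpha> - ?f0 \<in> G" unfolding G_def by blast
      then have "\<alpha> \<in> S" unfolding S_def by (intro image_eqI[of _ _ "\<alpha> - ?f0"]) auto
      then show False using that by blast
    qed
    have fin_sum: "(\<Sum>\<^sub>\<infinity>\<alpha>. e \<alpha> * f (u - ?v \<alpha>)) = (\<Sum>\<alpha>\<in>S. e \<alpha> * f (u - ?v \<alpha>))" for e
    proof -
      have "(\<Sum>\<^sub>\<infinity>\<alpha>. e \<alpha> * f (u - ?v \<alpha>)) = (\<Sum>\<^sub>\<infinity>\<alpha>\<in>S. e \<alpha> * f (u - ?v \<alpha>))"
        using out by (intro infsum_cong_neutral) auto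
      then show ?thesis by (simp only: infsum_finite[OF finS])
    qed
    have one: "(\<Sum>\<alpha>\<in>S. f (u - ?v \<alpha>)) = 1"
      using fin_sum[of "\<lambda>_. 1"] partition_of_unity[OF f, of u] by simp
    have y0: "0 \<le> y" if "S \<noteq> {}"
    proof -
      obtain \<alpha> where "\<alpha> \<in> S" using \<open>S \<noteq> {}\<close> by blast
      then show ?thesis using d[OF S] by (meson abs_ge_zero order_trans)
    qed
    have S_ne: "S \<noteq> {}" using one by auto
    have "(\<Sum>\<^sub>\<infinity>\<alpha>. d \<alpha> * f (u - ?v \<alpha>)) - d ?f0 = (\<Sum>\<alpha>\<in>S. d \<alpha> * f (u - ?v \<alpha>)) - d ?f0 * (\<Sum>\<alpha>\<in>S. f (u - ?v \<alpha>))"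
      by (simp add: fin_sum one)
    also have "\<dots> = (\<Sum>\<alpha>\<in>S. (d \<alpha> - d ?f0) * f (u - ?v \<alpha>))"
      by (simp add: sum_distrib_left left_diff_distrib sum_subtractf)
    finally have eq: "(\<Sum>\<^sub>\<infinity>\<alpha>. d \<alpha> * f (u - ?v \<alpha>)) - d ?f0 = (\<Sum>\<alpha>\<in>S. (d \<alpha> - d ?f0) * f (u - ?v \<alpha>))" .
    have "\<bar>\<Sum>\<alpha>\<in>S. (d \<alpha> - d ?f0) * f (u - ?v \<alpha>)\<bar> \<le> (\<Sum>\<alpha>\<in>S. \<bar>(d \<alpha> - d ?f0) * f (u - ?v \<alpha>)\<bar>)"
      by (rule sum_abs)
    also have "\<dots> \<le> (\<Sum>\<alpha>\<in>S. y * \<bar>b0\<bar>)"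
      unfolding abs_mult using d[OF S] b y0[OF S_ne] by (intro sum_mono mult_mono) auto
    also have "\<dots> = card S * (y * \<bar>b0\<bar>)" by simp
    also have "\<dots> \<le> card G * (y * \<bar>b0\<bar>)" using cardS y0[OF S_ne] by (intro mult_right_mono) auto
    finally show ?thesis unfolding eq by (simp add: mult_ac)
  qed
  show ?thesis
    by (intro exI allI impI) (rule main)
qed

context dilation
begin

lemma norm_A_le: "norm (A *v x) \<le> anorm_const * norm x"
proof -
  have "norm (A *v x) \<le> anorm (A *v x)" by (rule norm_le_anorm)
  also have "\<dots> \<le> anorm x" by (simp add: anorm_mult)
  also have "\<dots> \<le> anorm_const * norm x" by (rule anorm_le)
  finally show ?thesis .
qed

lemma linear_R_power: "linear ((*v) R ^^ k)"
  by (intro linear_funpow matrix_vector_mul_linear)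

text \<open>Both sides approximate \<open>u\<close> up to rounding, so the cells of a point at
  consecutive levels correspond up to a bounded shift.\<close>

lemma norm_A_vec_floor_le:
  "norm (A *v vec_of_int (vec_floor (R *v u)) - vec_of_int (vec_floor u)) \<le> (anorm_const + 1) * CARD('s)"
proof -
  let ?w = "R *v u"
  have "A *v vec_of_int (vec_floor ?w) - vec_of_int (vec_floor u)
      = (u - vec_of_int (vec_floor u)) - A *v (?w - vec_of_int (vec_floor ?w))"
    by (simp add: matrix_vector_mult_diff_distrib)
  then have "norm (A *v vec_of_int (vec_floor ?w) - vec_of_int (vec_floor u))
      \<le> norm (u - vec_of_int (vec_floor u)) + norm (A *v (?w - vec_of_int (vec_floor ?w)))"
    by (metis norm_triangle_ineq4)
  also have "\<dots> \<le> CARD('s) + anorm_const * CARD('s)"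
    using norm_diff_vec_floor_le[of ?w] anorm_const_ge_1
    by (intro add_mono norm_diff_vec_floor_le order_trans[OF norm_A_le] mult_left_mono) auto
  finally show ?thesis by (simp add: algebra_simps)
qed

text \<open>The approximants are discontinuous, but one late level \<open>k\<close> makes both the
  uniform error and the jumps small. Points so close that their images under the \<open>k\<close>-th
  power are less than 1 apart have integer parts within \<open>2 * CARD('s) + 1\<close>: two
  rounding errors plus 1.\<close>

lemma continuous_limit_of_step_functions:
  fixes d :: "nat \<Rightarrow> int ^ 's \<Rightarrow> real"
  assumes lim: "uniform_limit UNIV (\<lambda>k x. d k (vec_floor (((*v) R ^^ k) x))) g sequentially"
    and z: "z \<longlonglongrightarrow> 0"
      "\<And>k \<alpha> \<beta>. norm (vec_of_int (\<alpha> - \<beta>) :: real ^ 's) \<le> 2 * CARD('s) + 1 \<Longrightarrow> \<bar>d k \<alpha> - d k \<beta>\<bar> \<le> z k"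
  shows "continuous_on UNIV g"
  unfolding continuous_on_iff
proof (intro ballI allI impI)
  fix x :: "real ^ 's" and e :: real
  assume "0 < e"
  let ?h = "\<lambda>k x. d k (vec_floor (((*v) R ^^ k) x))"
  have "\<forall>\<^sub>F k in sequentially. (\<forall>x\<in>UNIV. dist (?h k x) (g x) < e / 3) \<and> dist (z k) 0 < e / 3"
    using \<open>0 < e\<close> by (intro eventually_conj uniform_limitD[OF lim] tendstoD[OF z(1)]) auto
  then obtain k where k: "\<And>x. dist (?h k x) (g x) < e / 3" "z k < e / 3"
    using eventually_happens'[OF sequentially_bot] by fastforce
  let ?T = "(*v) R ^^ k"
  have "isCont ?T x"
    using linear_continuous_at[of ?T x] linear_R_power[of k] by (simp add: linear_conv_bounded_linear)
  then obtain \<delta> where \<delta>: "\<delta> > 0" "\<And>y. dist y x < \<delta> \<Longrightarrow> dist (?T y) (?T x) < 1"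
    unfolding continuous_at_eps_delta by (metis zero_less_one)
  have "dist (g y) (g x) < e" if "dist y x < \<delta>" for y
  proof -
    let ?p = "?T y" and ?q = "?T x"
    have "vec_of_int (vec_floor ?p - vec_floor ?q)
        = (?p - ?q) - (?p - vec_of_int (vec_floor ?p)) + (?q - vec_of_int (vec_floor ?q))" by simp
    then have "norm (vec_of_int (vec_floor ?p - vec_floor ?q) :: real ^ 's)
        \<le> norm (?p - ?q) + norm (?p - vec_of_int (vec_floor ?p)) + norm (?q - vec_of_int (vec_floor ?q))"
      using norm_triangle_ineq[of "(?p - ?q) - (?p - vec_of_int (vec_floor ?p))" "?q - vec_of_int (vec_floor ?q)"]
        norm_triangle_ineq4[of "?p - ?q" "?p - vec_of_int (vec_floor ?p)"] by (simp only:)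
    then have "norm (vec_of_int (vec_floor ?p - vec_floor ?q) :: real ^ 's) \<le> 2 * CARD('s) + 1"
      using \<delta>(2)[OF that] norm_diff_vec_floor_le[of ?p] norm_diff_vec_floor_le[of ?q] by (simp add: dist_norm)
    then have "\<bar>?h k y - ?h k x\<bar> \<le> z k" by (rule z(2))
    then show ?thesis
      using k(1)[of x] k(1)[of y] k(2) unfolding dist_real_def by linarith
  qed
  then show "\<exists>\<delta>>0. \<forall>y\<in>UNIV. dist y x < \<delta> \<longrightarrow> dist (g y) (g x) < e"
    using \<delta>(1) by blast
qed

end

theorem theorem4:
  fixes M :: "int ^ 's ^ 's"
    and N :: nat
    and a :: "nat \<Rightarrow> int ^ 's \<Rightarrow> real"
    and E :: "(int ^ 's) set"
  assumes "dilation_matrix M"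
    and "complete_residues M E"
    and "\<And>k. k \<ge> 1 \<Longrightarrow> is_mask N (a k)"
    and "\<exists>B. \<forall>k\<ge>1. \<forall>\<alpha>. \<bar>a k \<alpha>\<bar> \<le> B"
    and "approx_sum_rules_1 M a"
    and "joint_spectral_radius (index_set M N E) (zero_sum_space (index_set M N E))
           (transition_ops M (index_set M N E) E (limit_masks a)) < 1"
  shows "C0_convergent M a"
proof -
  interpret dilation_residues M N E
    by unfold_locales (rule assms(1), rule assms(2))
  obtain B where B: "\<And>k \<alpha>. k \<ge> 1 \<Longrightarrow> \<bar>a k \<alpha>\<bar> \<le> B" using assms(4) by blast
  obtain \<eta> :: "nat \<Rightarrow> real" where \<eta>: "summable \<eta>"
    "\<And>k \<alpha>. \<bar>subdivision M (a (Suc k)) (\<lambda>_. 1) \<alpha> - 1\<bar> \<le> \<eta> k"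
    by (rule approx_sum_rules_defect[OF assms(5,3)]) (assumption, rule that)
  show ?thesis
    unfolding C0_convergent_def
  proof (intro allI impI)
    fix c :: "int ^ 's \<Rightarrow> real"
    assume c: "bounded (range c)"
    \<comment> \<open>The radius stays open here and is fixed three times: for consecutive levels,
      for neighbouring points, and for the support of the test function.\<close>
    note diffs = summable_differences[OF assms(3) B \<eta> assms(6) c]
    let ?cs = "\<lambda>k. subdivision_iter M a k c"
    let ?T = "\<lambda>k. (*v) R ^^ k"
    let ?h = "\<lambda>k x. ?cs k (vec_floor (?T k x))"
    obtain z where z: "summable z" "\<And>k \<alpha> \<beta>. norm (A *v vec_of_int \<alpha> - vec_of_int \<beta>) \<le> (anorm_const + 1) * CARD('s) \<Longrightarrow>
       \<bar>?cs (Suc k) \<alpha> - ?cs k \<beta>\<bar> \<le> z k"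
      using diffs[of "(anorm_const + 1) * CARD('s)"] by blast
    have "\<bar>?h (Suc k) x - ?h k x\<bar> \<le> z k" for k x
      using z(2)[OF norm_A_vec_floor_le, of k "?T k x"] by simp
    then obtain g where g: "uniform_limit UNIV ?h g sequentially"
      using uniform_limit_of_summable_increments[OF z(1), of ?h] by blast
    obtain z' where z': "summable z'" "\<And>k \<alpha> \<beta>. norm (vec_of_int (\<alpha> - \<beta>) :: real ^ 's) \<le> 2 * CARD('s) + 1 \<Longrightarrow>
       \<bar>?cs k \<alpha> - ?cs k \<beta>\<bar> \<le> z' k"
      using diffs[of "2 * CARD('s) + 1"] by blast
    have cont: "continuous_on UNIV g"
      by (rule continuous_limit_of_step_functions[OF g summable_LIMSEQ_zero[OF z'(1)] z'(2)])
    have conv: "uniform_limit UNIV (\<lambda>k x. \<Sum>\<^sub>\<infinity>\<alpha>. ?cs k \<alpha> * f (?T k x - vec_of_int \<alpha>)) g sequentially"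
      if f: "continuous_test_function f" for f :: "real ^ 's \<Rightarrow> real"
    proof -
      let ?G = "\<lambda>k x. \<Sum>\<^sub>\<infinity>\<alpha>. ?cs k \<alpha> * f (?T k x - vec_of_int \<alpha>)"
      from test_function_sum_bound[OF f] obtain r C
        where C: "\<forall>d u y. (\<forall>\<alpha>. norm (vec_of_int (\<alpha> - vec_floor u) :: real ^ 's) \<le> r \<longrightarrow> \<bar>d \<alpha> - d (vec_floor u)\<bar> \<le> y) \<longrightarrow>
         \<bar>(\<Sum>\<^sub>\<infinity>\<alpha>. d \<alpha> * f (u - vec_of_int \<alpha>)) - d (vec_floor u)\<bar> \<le> C * y"
        by (elim exE)
      obtain w where w: "summable w" "\<And>k \<alpha> \<beta>. norm (vec_of_int (\<alpha> - \<beta>) :: real ^ 's) \<le> r \<Longrightarrow>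
         \<bar>?cs k \<alpha> - ?cs k \<beta>\<bar> \<le> w k"
        using diffs[of r] by blast
      have bound: "\<bar>?G k x - ?h k x\<bar> \<le> C * w k" for k x
        by (rule C[rule_format]) (rule w(2))
      have "(\<lambda>k. C * w k) \<longlonglongrightarrow> 0"
        using tendsto_mult_right_zero[OF summable_LIMSEQ_zero[OF w(1)]] by simp
      have "uniform_limit UNIV (\<lambda>k x. ?G k x - ?h k x) (\<lambda>_. 0) sequentially"
      proof (rule uniform_limitI)
        fix e :: real assume "0 < e"
        then have "\<forall>\<^sub>F k in sequentially. dist (C * w k) 0 < e"
          by (rule tendstoD[OF \<open>(\<lambda>k. C * w k) \<longlonglongrightarrow> 0\<close>])
        then show "\<forall>\<^sub>F k in sequentially. \<forall>x\<in>UNIV. dist (?G k x - ?h k x) 0 < e"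
        proof eventually_elim
          case (elim k)
          then have "C * w k < e" by (simp add: dist_real_def)
          with bound[of k] show ?case by (auto simp: dist_real_def intro: le_less_trans)
        qed
      qed
      from uniform_limit_add[OF this g] show ?thesis by (simp only: diff_add_cancel add_0_left)
    qed
    show "\<exists>g :: real ^ 's \<Rightarrow> real. continuous_on UNIV g \<and>
         (\<forall>f. continuous_test_function f \<longrightarrow>
           uniform_limit UNIV
             (\<lambda>k x. \<Sum>\<^sub>\<infinity>\<alpha>. subdivision_iter M a k c \<alpha>
                        * f (((*v) (real_mat M) ^^ k) x - vec_of_int \<alpha>))
             g sequentially)"
      by (intro exI[of _ g] conjI allI impI cont conv)
  qed
qed

end
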